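(* Let $\delta>0$. If a regular $N$-network $\Gamma$ of class $H^2$, with curves $\gamma^1,\dots,\gamma^N$, is a stationary point for $F_\delta$, then each curve $\gamma^i$ of $\Gamma$ is of class $C^\infty$ and satisfies $$2(\partial_s^\perp)^2\boldsymbol{\kappa}^i+|\boldsymbol{\kappa}^i|^2\boldsymbol{\kappa}^i-\delta\boldsymbol{\kappa}^i=0\quad\text{on }(0,1),$$ or, in terms of the scalar curvature, $$2\partial_s^2k^i+(k^i)^3-\delta k^i=0\quad\text{on }(0,1).$$ Moreover, if the problem is considered only for networks with triple junctions and all angles at the triple junctions are fixed to be equal (so the three curves meet at $120$ degrees), then at every junction, with the three curves meeting there denoted $\gamma^1,\gamma^2,\gamma^3$ and all oriented so as to start at that junction, the following conditions hold at the junction: $$\sum_{i=1}^3k^i=0\qquad\text{and}\qquad\sum_{i=1}^3\bigl(2\,\partial_sk^i\,\nu^i+(k^i)^2\tau^i\bigr)=0.$$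
   Context: An $N$-network is a connected set in the plane that is the union of $N$ curves $\gamma^i:[0,1]\to\mathbb{R}^2$ whose end points meet in junctions; it is regular if each $\gamma^i$ is regular ($|\partial_x\gamma^i|\ne0$ on $[0,1]$) and of class $H^2$ if each curve is. A curve is of class $C^k$ or $H^k$ if it admits a parametrization of that class. For a regular curve $\gamma$: $\partial_s=|\partial_x\gamma|^{-1}\partial_x$, $\mathrm{d}s=|\partial_x\gamma|\mathrm{d}x$, $\tau=\partial_s\gamma$ is the unit tangent, $\nu$ is the counter-clockwise rotation of $\tau$ by $\pi/2$, the curvature vector is $\boldsymbol{\kappa}=\partial_{ss}\gamma=k\nu$ with $k$ the (signed) scalar curvature, and for a vector field $\phi$ along $\gamma$, $\partial_s^\perp\phi=\partial_s\phi-\langle\partial_s\phi,\partial_s\gamma\rangle\partial_s\gamma$. A superscript $i$ refers to the curve $\gamma^i$. The functional is $F_\delta(\Gamma)=\sum_{i=1}^N\int_{\gamma^i}\bigl((k^i)^2+\delta\bigr)\,\mathrm{d}s^i$. Stationary point: $\frac{d}{dt}F_\delta(\Gamma_t)|_{t=0}=0$ for every admissible variation $\Gamma_t$, with curves $\gamma^i+t\psi^i$, where $\psi^i\in C^\infty([0,1];\mathbb{R}^2)$ (equivalently, by approximation, $\psi^i\in H^2$) take equal values at all curve ends meeting at the same junction, so that junctions are preserved. If angles at the junctions are fixed, admissible variations are moreover required to preserve the angle conditions at the junctions to first order in $t$; in the equal-angle triple-junction case, with the curves oriented to start at the junction, the angle condition is $\sum_{i=1}^3\tau^i=0$ there and the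 first-order requirement is $\sum_{i=1}^3\partial_s^\perp\psi^i=0$ there. *)

theory Defs
  imports "HOL-Analysis.Analysis"
begin

section \<open>Differential geometry of plane curves on the unit interval\<close>

text \<open>
  Curves and fields along curves are functions on \<^typ>\<open>real\<close> of which only the values on
  \<open>{0..1}\<close> matter. All derivatives are taken within \<open>{0..1}\<close>, so they are one-sided at 0 and 1.
\<close>

abbreviation D_I :: "(real \<Rightarrow> 'a::real_normed_vector) \<Rightarrow> real \<Rightarrow> 'a" where
  "D_I f x \<equiv> vector_derivative f (at x within {0..1})"

definition regular_curve :: "(real \<Rightarrow> real^2) \<Rightarrow> bool" where
  "regular_curve \<gamma> \<longleftrightarrow>
     (\<forall>x\<in>{0..1}. \<gamma> differentiable (at x within {0..1}) \<and> D_I \<gamma> x \<noteq> 0)"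

definition ds :: "(real \<Rightarrow> real^2) \<Rightarrow> (real \<Rightarrow> 'a::real_normed_vector) \<Rightarrow> real \<Rightarrow> 'a" where
  "ds \<gamma> f x = D_I f x /\<^sub>R norm (D_I \<gamma> x)"

definition rot90 :: "real^2 \<Rightarrow> real^2" where
  "rot90 v = vector [- (v $ 2), v $ 1]"

definition tangent :: "(real \<Rightarrow> real^2) \<Rightarrow> real \<Rightarrow> real^2" where
  "tangent \<gamma> = ds \<gamma> \<gamma>"

definition normal :: "(real \<Rightarrow> real^2) \<Rightarrow> real \<Rightarrow> real^2" where
  "normal \<gamma> x = rot90 (tangent \<gamma> x)"

definition curvature_vec :: "(real \<Rightarrow> real^2) \<Rightarrow> real \<Rightarrow> real^2" where
  "curvature_vec \<gamma> = ds \<gamma> (ds \<gamma> \<gamma>)"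

definition curvature :: "(real \<Rightarrow> real^2) \<Rightarrow> real \<Rightarrow> real" where
  "curvature \<gamma> x = curvature_vec \<gamma> x \<bullet> normal \<gamma> x"

definition ds_perp :: "(real \<Rightarrow> real^2) \<Rightarrow> (real \<Rightarrow> real^2) \<Rightarrow> real \<Rightarrow> real^2" where
  "ds_perp \<gamma> \<phi> x = ds \<gamma> \<phi> x - (ds \<gamma> \<phi> x \<bullet> tangent \<gamma> x) *\<^sub>R tangent \<gamma> x"


section \<open>Regularity classes\<close>

text \<open>
  The Sobolev space \<open>H\<^sup>2(0,1)\<close>, through its \<open>C\<^sup>1\<close> representative: the derivative \<open>v\<close> is absolutely
  continuous, i.e. differentiable almost everywhere and equal to the integral of its derivative
  \<open>w\<close>, and \<open>w\<close> is square integrable. On the exceptional null set \<^const>\<open>curvature\<close> is unspecified;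
  it is only used under an integral sign for such curves.
\<close>

definition H2_curve :: "(real \<Rightarrow> real^2) \<Rightarrow> bool" where
  "H2_curve \<gamma> \<longleftrightarrow> (\<exists>v w S.
     (\<forall>x\<in>{0..1}. (\<gamma> has_vector_derivative v x) (at x within {0..1})) \<and>
     negligible S \<and>
     (\<forall>x\<in>{0..1} - S. (v has_vector_derivative w x) (at x within {0..1})) \<and>
     w absolutely_integrable_on {0..1} \<and>
     (\<forall>x\<in>{0..1}. (w has_integral (v x - v 0)) {0..x}) \<and>
     (\<lambda>x. (norm (w x))\<^sup>2) integrable_on {0..1})"

definition smooth_I :: "(real \<Rightarrow> 'a::real_normed_vector) \<Rightarrow> bool" where
  "smooth_I f \<longleftrightarrow> (\<exists>D :: nat \<Rightarrow> real \<Rightarrow> 'a.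
     (\<forall>x\<in>{0..1}. D 0 x = f x) \<and>
     (\<forall>n. \<forall>x\<in>{0..1}. (D n has_vector_derivative D (Suc n) x) (at x within {0..1})))"

definition reparametrization :: "(real \<Rightarrow> real^2) \<Rightarrow> (real \<Rightarrow> real^2) \<Rightarrow> bool" where
  "reparametrization \<gamma> \<sigma> \<longleftrightarrow> (\<exists>\<phi> \<phi>' :: real \<Rightarrow> real.
     \<phi> 0 = 0 \<and> \<phi> 1 = 1 \<and>
     (\<forall>x\<in>{0..1}. (\<phi> has_real_derivative \<phi>' x) (at x within {0..1}) \<and> \<phi>' x > 0) \<and>
     continuous_on {0..1} \<phi>' \<and>
     (\<forall>x\<in>{0..1}. \<sigma> x = \<gamma> (\<phi> x)))"

definition smooth_parametrization :: "(real \<Rightarrow> real^2) \<Rightarrow> (real \<Rightarrow> real^2) \<Rightarrow> bool" where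
  "smooth_parametrization \<gamma> \<sigma> \<longleftrightarrow> reparametrization \<gamma> \<sigma> \<and> regular_curve \<sigma> \<and> smooth_I \<sigma>"

definition smooth_curve :: "(real \<Rightarrow> real^2) \<Rightarrow> bool" where
  "smooth_curve \<gamma> \<longleftrightarrow> (\<exists>\<sigma>. smooth_parametrization \<gamma> \<sigma>)"


section \<open>Networks\<close>

text \<open>
  The curves are \<open>\<gamma> 1, \<dots>, \<gamma> N\<close>. A curve end is a pair \<open>(i, e)\<close> with \<open>e \<in> {0, 1}\<close>, located at
  \<open>\<gamma> i e\<close>, so a curve that starts and stops at the same junction contributes two ends to it.
  Junctions are points of the plane.
\<close>

definition ends_at :: "nat \<Rightarrow> (nat \<Rightarrow> real \<Rightarrow> real^2) \<Rightarrow> real^2 \<Rightarrow> (nat \<times> real) set" where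
  "ends_at N \<gamma> p = {(i, e). i \<in> {1..N} \<and> e \<in> {0, 1} \<and> \<gamma> i e = p}"

definition junctions :: "nat \<Rightarrow> (nat \<Rightarrow> real \<Rightarrow> real^2) \<Rightarrow> (real^2) set" where
  "junctions N \<gamma> = {\<gamma> i e | i e. i \<in> {1..N} \<and> e \<in> {0, 1}}"

definition network :: "nat \<Rightarrow> (nat \<Rightarrow> real \<Rightarrow> real^2) \<Rightarrow> bool" where
  "network N \<gamma> \<longleftrightarrow>
     (\<forall>i\<in>{1..N}. continuous_on {0..1} (\<gamma> i)) \<and>
     connected (\<Union>i\<in>{1..N}. \<gamma> i ` {0..1}) \<and>
     (\<forall>p\<in>junctions N \<gamma>. card (ends_at N \<gamma> p) \<ge> 2)"

definition regular_H2_network :: "nat \<Rightarrow> (nat \<Rightarrow> real \<Rightarrow> real^2) \<Rightarrow> bool" where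
  "regular_H2_network N \<gamma> \<longleftrightarrow>
     network N \<gamma> \<and> (\<forall>i\<in>{1..N}. regular_curve (\<gamma> i) \<and> H2_curve (\<gamma> i))"

text \<open>The curve (or the field along it) with the orientation in which the given end is the start.\<close>

definition from_end :: "(nat \<Rightarrow> real \<Rightarrow> real^2) \<Rightarrow> nat \<times> real \<Rightarrow> real \<Rightarrow> real^2" where
  "from_end \<gamma> c = (if snd c = 0 then \<gamma> (fst c) else reversepath (\<gamma> (fst c)))"

definition equal_angle_triple_junctions :: "nat \<Rightarrow> (nat \<Rightarrow> real \<Rightarrow> real^2) \<Rightarrow> bool" where
  "equal_angle_triple_junctions N \<gamma> \<longleftrightarrow>
     (\<forall>p\<in>junctions N \<gamma>. card (ends_at N \<gamma> p) = 3 \<and>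
        (\<Sum>c\<in>ends_at N \<gamma> p. tangent (from_end \<gamma> c) 0) = 0)"


section \<open>The elastic energy and its stationary points\<close>

definition elastic_energy :: "real \<Rightarrow> nat \<Rightarrow> (nat \<Rightarrow> real \<Rightarrow> real^2) \<Rightarrow> real" where
  "elastic_energy \<delta> N \<gamma> =
     (\<Sum>i = 1..N. integral {0..1} (\<lambda>x. ((curvature (\<gamma> i) x)\<^sup>2 + \<delta>) * norm (D_I (\<gamma> i) x)))"

definition perturb ::
  "(nat \<Rightarrow> real \<Rightarrow> real^2) \<Rightarrow> (nat \<Rightarrow> real \<Rightarrow> real^2) \<Rightarrow> real \<Rightarrow> nat \<Rightarrow> real \<Rightarrow> real^2" where
  "perturb \<gamma> \<psi> t i x = \<gamma> i x + t *\<^sub>R \<psi> i x"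

definition preserves_junctions ::
  "nat \<Rightarrow> (nat \<Rightarrow> real \<Rightarrow> real^2) \<Rightarrow> (nat \<Rightarrow> real \<Rightarrow> real^2) \<Rightarrow> bool" where
  "preserves_junctions N \<gamma> \<psi> \<longleftrightarrow>
     (\<forall>p\<in>junctions N \<gamma>. \<forall>(i, e)\<in>ends_at N \<gamma> p. \<forall>(j, f)\<in>ends_at N \<gamma> p. \<psi> i e = \<psi> j f)"

text \<open>
  First-order preservation of arbitrary angles between the curves at a junction: cosine and sine
  of the oriented angle between any two outgoing unit tangents are stationary at \<open>t = 0\<close>.
\<close>

definition preserves_angles ::
  "nat \<Rightarrow> (nat \<Rightarrow> real \<Rightarrow> real^2) \<Rightarrow> (nat \<Rightarrow> real \<Rightarrow> real^2) \<Rightarrow> bool" where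
  "preserves_angles N \<gamma> \<psi> \<longleftrightarrow>
     (\<forall>p\<in>junctions N \<gamma>. \<forall>c\<in>ends_at N \<gamma> p. \<forall>d\<in>ends_at N \<gamma> p.
        ((\<lambda>t. tangent (from_end (perturb \<gamma> \<psi> t) c) 0 \<bullet> tangent (from_end (perturb \<gamma> \<psi> t) d) 0)
           has_real_derivative 0) (at 0) \<and>
        ((\<lambda>t. normal (from_end (perturb \<gamma> \<psi> t) c) 0 \<bullet> tangent (from_end (perturb \<gamma> \<psi> t) d) 0)
           has_real_derivative 0) (at 0))"

text \<open>
  The linearization of the equal-angle condition that the three outgoing unit tangents sum to 0.
\<close>

definition preserves_equal_angles ::
  "nat \<Rightarrow> (nat \<Rightarrow> real \<Rightarrow> real^2) \<Rightarrow> (nat \<Rightarrow> real \<Rightarrow> real^2) \<Rightarrow> bool" where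
  "preserves_equal_angles N \<gamma> \<psi> \<longleftrightarrow>
     (\<forall>p\<in>junctions N \<gamma>. (\<Sum>c\<in>ends_at N \<gamma> p. ds_perp (from_end \<gamma> c) (from_end \<psi> c) 0) = 0)"

text \<open>
  Stationarity with respect to the smooth, junction preserving variations that moreover satisfy
  the condition \<open>C\<close>; taking \<open>C\<close> to be constantly true leaves the angles free.
\<close>

definition stationary_point ::
  "real \<Rightarrow> nat \<Rightarrow> (nat \<Rightarrow> real \<Rightarrow> real^2) \<Rightarrow> ((nat \<Rightarrow> real \<Rightarrow> real^2) \<Rightarrow> bool) \<Rightarrow> bool" where
  "stationary_point \<delta> N \<gamma> C \<longleftrightarrow>
     (\<forall>\<psi>. (\<forall>i\<in>{1..N}. smooth_I (\<psi> i)) \<and> preserves_junctions N \<gamma> \<psi> \<and> C \<psi> \<longrightarrow>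
        ((\<lambda>t. elastic_energy \<delta> N (perturb \<gamma> \<psi> t)) has_real_derivative 0) (at 0))"

end

theory Submission
  imports Defs
begin

text \<open>
  The first variation of the energy of a regular \<open>H\<^sup>2\<close> curve with velocity \<open>v\<close> and acceleration \<open>w\<close> in
  direction \<open>\<psi>\<close> has the form \<open>\<integral> P \<bullet> \<psi>'' + Q \<bullet> \<psi>'\<close>, where the bending flux \<open>P\<close> equals \<open>2 k \<nu> / norm v\<close> and
  \<open>Q\<close> is integrable (\<open>first_variation_density\<close>, \<open>energy_density_deriv_flux\<close>). Fields on a single curve
  that vanish to first order at its ends respect every junction and angle condition, so along each
  curve this integral vanishes for all of them (\<open>stationary_imp_H2_critical\<close>). The second order
  fundamental lemma of the calculus of variations (\<open>du_Bois_Reymond_second_order\<close>) then says that \<open>P\<close>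
  is almost everywhere a primitive of \<open>Q + b\<close> with a constant vector \<open>b\<close>.

  The curve is given in an arbitrary parametrization, so \<open>Q\<close> contains the tangential acceleration, which
  is merely square integrable. It cancels in the product \<open>norm v *\<^sub>R P = 2 k \<nu>\<close>, by the product rule for
  primitives: the derivative of \<open>2 k \<nu>\<close> is \<open>norm v\<close> times \<open>(\<delta> - 3 k\<^sup>2) \<tau> + b\<close>, which is continuous.
  Hence \<open>k\<close> and \<open>\<tau>\<close> are continuously differentiable and solve the system with arclength derivatives
  \<open>\<tau>' = k \<nu>\<close>, \<open>2 k' = b \<bullet> \<nu>\<close> and with the relation \<open>b \<bullet> \<tau> = k\<^sup>2 - \<delta>\<close>; that is, the force
  \<open>b = 2 k' \<nu> + k\<^sup>2 \<tau> - \<delta> \<tau>\<close> is constant along the curve (\<open>H2_critical_imp_elastica\<close>). One more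
  derivative gives \<open>2 k'' + k\<^sup>3 - \<delta> k = 0\<close>. In arclength the system is polynomial in \<open>(\<tau>, k)\<close>, so its
  solutions are smooth (\<open>elastica_smooth_curve\<close>). All these quantities are invariant under
  reparametrization, so the equations hold for every smooth parametrization.

  On a network of elastica the first variation consists of boundary terms only (\<open>elastic_network\<close>). At
  a junction, with outgoing orientation, they are minus the sum of \<open>2 k \<nu> \<bullet> \<psi>' - b \<bullet> \<psi>\<close>, with \<open>\<psi>'\<close> the
  arclength derivative. Translating an equal-angle triple junction shows that the three forces sum
  to 0, and rotating the three tangents rigidly shows that the three curvatures sum to 0
  (\<open>equal_angle_junction_conditions\<close>).
\<close>

section \<open>Primitives\<close>

text \<open>
  Indefinite Henstock-Kurzweil integrals. For a curve of class \<open>H\<^sup>2\<close> the velocity is the primitive of an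
  integrable function that is only specified almost everywhere; every differential identity below is
  first an identity between primitives, and pointwise derivatives appear only once the integrand is
  known to be continuous.
\<close>

definition primitive :: "(real \<Rightarrow> 'a::euclidean_space) \<Rightarrow> (real \<Rightarrow> 'a) \<Rightarrow> bool" where
  "primitive f f' \<longleftrightarrow> (\<forall>x\<in>{0..1}. (f' has_integral (f x - f 0)) {0..x})"

lemma primitiveD:
  assumes "primitive f f'" "0 \<le> u" "u \<le> v" "v \<le> 1"
  shows "(f' has_integral (f v - f u)) {u..v}"
proof -
  have v: "(f' has_integral (f v - f 0)) {0..v}" and u: "(f' has_integral (f u - f 0)) {0..u}"
    using assms by (auto simp: primitive_def)
  have "f' integrable_on {u..v}"
    using v assms(2,3) by (meson atLeastatMost_subset_iff has_integral_integrable integrable_on_subinterval order_refl)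
  then have "(f' has_integral (f u - f 0 + integral {u..v} f')) {0..v}"
    using has_integral_combine[OF assms(2,3) u] by blast
  then have "f u - f 0 + integral {u..v} f' = f v - f 0"
    using v has_integral_unique by blast
  then have "integral {u..v} f' = f v - f u" by (simp add: algebra_simps)
  then show ?thesis using \<open>f' integrable_on {u..v}\<close> by (metis integrable_integral)
qed

lemma primitive_integrable: "primitive f f' \<Longrightarrow> f' integrable_on {0..1}"
  unfolding primitive_def by (auto simp: has_integral_integrable)

lemma primitive_eq_integral:
  assumes "primitive f f'" "x \<in> {0..1}"
  shows "f x = f 0 + integral {0..x} f'"
proof -
  have "(f' has_integral (f x - f 0)) {0..x}" using assms by (auto simp: primitive_def)
  then show ?thesis by (simp add: integral_unique)
qed

lemma primitive_continuous:
  assumes "primitive f f'"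
  shows "continuous_on {0..1} f"
proof -
  have "continuous_on {0..1} (\<lambda>x. f 0 + integral {0..x} f')"
    by (intro continuous_intros indefinite_integral_continuous_1 primitive_integrable[OF assms])
  moreover have "f 0 + integral {0..x} f' = f x" if "x \<in> {0..1}" for x
    using primitive_eq_integral[OF assms that] by simp
  ultimately show ?thesis by (rule continuous_on_eq)
qed

text \<open>
  The Henstock lemma makes \<open>f v - f u - (v - u) f' x\<close> small in sum over every fine tagged division, not
  merely in total. Composing with a map that is strictly differentiable along \<open>f\<close> preserves this up to
  the bound \<open>B\<close> of its derivative. The product and the chain rule for primitives are both instances.
\<close>

lemma primitive_chain:
  fixes f f' :: "real \<Rightarrow> 'a::euclidean_space" and \<Phi> :: "'a \<Rightarrow> 'b::euclidean_space"
  assumes prim: "primitive f f'"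
    and lin: "\<And>x. x \<in> {0..1} \<Longrightarrow> linear (L x)"
    and bound: "\<And>x y. x \<in> {0..1} \<Longrightarrow> norm (L x y) \<le> B * norm y"
    and strict: "\<And>x e. \<lbrakk>x \<in> {0..1}; e > 0\<rbrakk> \<Longrightarrow> \<exists>d>0. \<forall>a b. norm (a - f x) < d \<longrightarrow> norm (b - f x) < d \<longrightarrow>
        norm (\<Phi> a - \<Phi> b - L x (a - b)) \<le> e * norm (a - b)"
  shows "primitive (\<lambda>x. \<Phi> (f x)) (\<lambda>x. L x (f' x))"
  unfolding primitive_def
proof
  fix z :: real assume z: "z \<in> {0..1}"
  have "((\<lambda>x. L x (f' x)) has_integral (\<Phi> (f z) - \<Phi> (f 0))) (cbox 0 z)"
    unfolding has_integral
  proof (intro allI impI)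
    fix e :: real assume e: "e > 0"
    have B0: "norm (L x y) \<le> \<bar>B\<bar> * norm y" if "x \<in> {0..1}" for x y
      using bound[OF that, of y] by (meson abs_ge_self mult_right_mono norm_ge_zero order_trans)
    \<comment> \<open>The total error below is at most \<open>(\<bar>B\<bar> + \<epsilon>) * \<epsilon> + \<epsilon>\<close>, and \<open>\<epsilon> \<le> 1\<close>.\<close>
    define \<epsilon> where "\<epsilon> = min 1 (e / (\<bar>B\<bar> + 3))"
    have eps: "0 < \<epsilon>" "\<epsilon> \<le> 1" "(\<bar>B\<bar> + 2) * \<epsilon> < e"
    proof -
      show "0 < \<epsilon>" "\<epsilon> \<le> 1" using e by (auto simp: \<epsilon>_def)
      have "\<epsilon> \<le> e / (\<bar>B\<bar> + 3)" by (simp add: \<epsilon>_def)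
      then have "(\<bar>B\<bar> + 3) * \<epsilon> \<le> e" by (simp add: field_simps)
      then show "(\<bar>B\<bar> + 2) * \<epsilon> < e" using \<open>0 < \<epsilon>\<close> by (simp add: algebra_simps)
    qed
    have "f' integrable_on cbox 0 z"
      using prim z by (auto simp: primitive_def has_integral_integrable)
    then obtain \<gamma>1 where g1: "gauge \<gamma>1"
      and H: "\<And>p. \<lbrakk>p tagged_partial_division_of (cbox 0 z); \<gamma>1 fine p\<rbrakk> \<Longrightarrow>
             sum (\<lambda>(x,k). norm (measure lborel k *\<^sub>R f' x - integral k f')) p < \<epsilon>"
      using Henstock_lemma[of f' 0 z \<epsilon>] eps(1) by blast
    have "\<exists>d>0. \<forall>u\<in>{0..1}. \<forall>v\<in>{0..1}. \<bar>u - x\<bar> < d \<longrightarrow> \<bar>v - x\<bar> < d \<longrightarrow>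
        norm (\<Phi> (f v) - \<Phi> (f u) - L x (f v - f u)) \<le> \<epsilon> / (1 + norm (f' x)) * norm (f v - f u)"
      if x: "x \<in> {0..1}" for x
    proof -
      have "\<epsilon> / (1 + norm (f' x)) > 0" using eps(1) by (simp add: add_pos_nonneg)
      then obtain d where d: "d > 0" "\<And>a b. norm (a - f x) < d \<Longrightarrow> norm (b - f x) < d \<Longrightarrow>
        norm (\<Phi> a - \<Phi> b - L x (a - b)) \<le> \<epsilon> / (1 + norm (f' x)) * norm (a - b)"
        using strict[OF x] by blast
      obtain d' where "d' > 0" "\<And>u. u \<in> {0..1} \<Longrightarrow> \<bar>u - x\<bar> < d' \<Longrightarrow> norm (f u - f x) < d"
        using primitive_continuous[OF prim] x d(1) unfolding continuous_on_iff dist_norm by (metis real_norm_def)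
      then show ?thesis using d(2) by (intro exI[of _ d']) auto
    qed
    then obtain \<delta> where \<delta>: "\<And>x. x \<in> {0..1} \<Longrightarrow> \<delta> x > 0"
      "\<And>x u v. \<lbrakk>x \<in> {0..1}; u \<in> {0..1}; v \<in> {0..1}; \<bar>u - x\<bar> < \<delta> x; \<bar>v - x\<bar> < \<delta> x\<rbrakk> \<Longrightarrow>
        norm (\<Phi> (f v) - \<Phi> (f u) - L x (f v - f u)) \<le> \<epsilon> / (1 + norm (f' x)) * norm (f v - f u)"
      by metis
    define \<gamma> where "\<gamma> x = \<gamma>1 x \<inter> ball x (if x \<in> {0..1} then \<delta> x else 1)" for x
    have "gauge \<gamma>" unfolding \<gamma>_def
      by (intro gauge_Int g1 gauge_ball_dependent) (use \<delta>(1) in auto)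
    moreover have "norm ((\<Sum>(x, k)\<in>p. measure lborel k *\<^sub>R L x (f' x)) - (\<Phi> (f z) - \<Phi> (f 0))) < e"
      if p: "p tagged_division_of cbox 0 z" "\<gamma> fine p" for p
    proof -
      have fine1: "\<gamma>1 fine p" using p(2) unfolding \<gamma>_def fine_Int by (meson fine_def le_inf_iff)
      have Hp: "(\<Sum>(x,k)\<in>p. norm (measure lborel k *\<^sub>R f' x - integral k f')) < \<epsilon>"
        by (rule H[OF _ fine1]) (use p(1) tagged_division_of_def in blast)
      have tele: "(\<Sum>(x,K)\<in>p. \<Phi> (f (Sup K)) - \<Phi> (f (Inf K))) = \<Phi> (f z) - \<Phi> (f 0)"
        using additive_tagged_division_1[of 0 z p "\<lambda>x. \<Phi> (f x)"] z p(1) by simp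
      have len: "(\<Sum>(x,K)\<in>p. measure lborel K) = z"
        using additive_content_tagged_division[OF p(1)] z by simp
      have "norm ((\<Sum>(x, K)\<in>p. measure lborel K *\<^sub>R L x (f' x)) - (\<Phi> (f z) - \<Phi> (f 0)))
          = norm (\<Sum>(x,K)\<in>p. measure lborel K *\<^sub>R L x (f' x) - (\<Phi> (f (Sup K)) - \<Phi> (f (Inf K))))"
        unfolding tele[symmetric] by (simp add: split_def sum_subtractf)
      also have "\<dots> \<le> (\<Sum>(x,K)\<in>p. (\<bar>B\<bar> + \<epsilon>) * norm (measure lborel K *\<^sub>R f' x - integral K f') + \<epsilon> * measure lborel K)"
      proof (rule sum_norm_le, clarify)
        fix x K assume xK: "(x, K) \<in> p"
        then obtain u v where K: "K = {u..v}" using p(1) by (metis box_real(2) tagged_division_ofD(4))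
        have xin: "x \<in> K" and sub: "K \<subseteq> {0..z}" using p(1) xK by auto
        then have uv: "u \<le> x" "x \<le> v" "0 \<le> u" "v \<le> z" using K by auto
        have I: "integral K f' = f v - f u"
          using primitiveD[OF prim, of u v] uv z K by (intro integral_unique) auto
        have "u \<in> K" "v \<in> K" using K uv by auto
        moreover have "K \<subseteq> ball x (\<delta> x)"
          using p(2) xK uv z unfolding fine_def \<gamma>_def by fastforce
        ultimately have "u \<in> ball x (\<delta> x)" "v \<in> ball x (\<delta> x)" by auto
        then have near: "\<bar>u - x\<bar> < \<delta> x" "\<bar>v - x\<bar> < \<delta> x"
          by (simp_all add: dist_real_def abs_minus_commute)
        have x1: "x \<in> {0..1}" using uv z by auto
        \<comment> \<open>The Henstock error of this piece, and a tolerance that also beats a large \<open>f' x\<close>.\<close>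
        define E where "E = norm (measure lborel K *\<^sub>R f' x - integral K f')"
        define \<eta> where "\<eta> = \<epsilon> / (1 + norm (f' x))"
        have \<eta>: "\<eta> \<ge> 0" "\<eta> \<le> \<epsilon>" "\<eta> * norm (f' x) \<le> \<epsilon>"
          using eps(1) by (auto simp: \<eta>_def field_simps add_pos_nonneg)
        have 1: "norm (\<Phi> (f v) - \<Phi> (f u) - L x (f v - f u)) \<le> \<eta> * norm (f v - f u)"
          unfolding \<eta>_def using \<delta>(2)[OF x1 _ _ near] uv z by auto
        have "norm (f v - f u) \<le> E + norm (measure lborel K *\<^sub>R f' x)"
          unfolding E_def I by (metis add.commute norm_minus_commute norm_triangle_sub)
        then have 2: "norm (f v - f u) \<le> E + measure lborel K * norm (f' x)" by simp
        have c0: "measure lborel K \<ge> 0" by simp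
        have E0: "E \<ge> 0" by (simp add: E_def)
        have "\<eta> * norm (f v - f u) \<le> \<eta> * E + measure lborel K * (\<eta> * norm (f' x))"
          using mult_left_mono[OF 2 \<eta>(1)] by (simp add: algebra_simps)
        also have "\<dots> \<le> \<epsilon> * E + measure lborel K * \<epsilon>"
          using \<eta> E0 c0 by (intro add_mono mult_mono mult_left_mono) auto
        finally have 3: "\<eta> * norm (f v - f u) \<le> \<epsilon> * E + \<epsilon> * measure lborel K" by (simp add: mult.commute)
        have 4: "norm (L x (measure lborel K *\<^sub>R f' x - (f v - f u))) \<le> \<bar>B\<bar> * E"
          using B0[OF x1] unfolding E_def I by blast
        interpret linear "L x" by (rule lin[OF x1])
        have "measure lborel K *\<^sub>R L x (f' x) - (\<Phi> (f v) - \<Phi> (f u)) =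
          L x (measure lborel K *\<^sub>R f' x - (f v - f u)) - (\<Phi> (f v) - \<Phi> (f u) - L x (f v - f u))"
          by (simp add: diff scale)
        then have "norm (measure lborel K *\<^sub>R L x (f' x) - (\<Phi> (f v) - \<Phi> (f u))) \<le>
            norm (L x (measure lborel K *\<^sub>R f' x - (f v - f u))) + norm (\<Phi> (f v) - \<Phi> (f u) - L x (f v - f u))"
          by (metis norm_triangle_ineq4)
        also have "\<dots> \<le> (\<bar>B\<bar> + \<epsilon>) * E + \<epsilon> * measure lborel K"
          using 1 3 4 by (simp add: algebra_simps)
        finally show "norm (measure lborel K *\<^sub>R L x (f' x) - (\<Phi> (f (Sup K)) - \<Phi> (f (Inf K))))
           \<le> (\<bar>B\<bar> + \<epsilon>) * norm (measure lborel K *\<^sub>R f' x - integral K f') + \<epsilon> * measure lborel K"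
          using uv K by (simp add: E_def)
      qed
      also have "\<dots> = (\<bar>B\<bar> + \<epsilon>) * (\<Sum>(x,k)\<in>p. norm (measure lborel k *\<^sub>R f' x - integral k f')) + \<epsilon> * z"
        by (simp only: len[symmetric] split_def sum.distrib sum_distrib_left)
      also have "\<dots> \<le> (\<bar>B\<bar> + 1) * \<epsilon> + \<epsilon> * 1"
        using Hp eps z by (intro add_mono mult_mono) (auto intro!: sum_nonneg)
      also have "\<dots> < e" using eps(3) by (simp add: algebra_simps)
      finally show ?thesis .
    qed
    ultimately show "\<exists>\<gamma>. gauge \<gamma> \<and> (\<forall>p. p tagged_division_of cbox 0 z \<and> \<gamma> fine p \<longrightarrow>
        norm ((\<Sum>(x, k)\<in>p. measure lborel k *\<^sub>R L x (f' x)) - (\<Phi> (f z) - \<Phi> (f 0))) < e)"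
      by metis
  qed
  then show "((\<lambda>x. L x (f' x)) has_integral (\<Phi> (f z) - \<Phi> (f 0))) {0..z}" by simp
qed

lemma primitive_linear:
  assumes "primitive f f'" "bounded_linear h" shows "primitive (\<lambda>x. h (f x)) (\<lambda>x. h (f' x))"
  unfolding primitive_def linear_diff[OF bounded_linear.linear[OF assms(2)], symmetric]
  using has_integral_linear[OF _ assms(2), unfolded o_def] assms(1) unfolding primitive_def by blast

lemma primitive_add:
  assumes "primitive f f'" "primitive g g'" shows "primitive (\<lambda>x. f x + g x) (\<lambda>x. f' x + g' x)"
  unfolding primitive_def
proof
  fix x :: real assume "x \<in> {0..1}"
  then have "((\<lambda>x. f' x + g' x) has_integral (f x - f 0) + (g x - g 0)) {0..x}"
    using assms by (intro has_integral_add) (auto simp: primitive_def)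
  then show "((\<lambda>x. f' x + g' x) has_integral f x + g x - (f 0 + g 0)) {0..x}"
    by (simp add: algebra_simps)
qed

lemma primitive_diff:
  assumes "primitive f f'" "primitive g g'" shows "primitive (\<lambda>x. f x - g x) (\<lambda>x. f' x - g' x)"
  using primitive_add[OF assms(1) primitive_linear[OF assms(2) bounded_linear_minus[OF bounded_linear_ident]]] by simp

lemma primitive_integral:
  assumes "f' integrable_on {0..1}" shows "primitive (\<lambda>x. c + integral {0..x} f') f'"
  unfolding primitive_def using assms
  by (auto intro!: integrable_integral integrable_on_subinterval[OF assms])

lemma primitive_deriv:
  assumes "\<And>x. x \<in> {0..1} \<Longrightarrow> (f has_vector_derivative f' x) (at x within {0..1})"
  shows "primitive f f'"
  unfolding primitive_def
  by (intro ballI fundamental_theorem_of_calculus)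
     (auto intro: has_vector_derivative_within_subset[OF assms])

lemma primitive_continuous_imp_deriv:
  assumes "primitive f f'" "continuous_on {0..1} f'" "x \<in> {0..1}"
  shows "(f has_vector_derivative f' x) (at x within {0..1})"
proof -
  have "((\<lambda>x. f 0 + integral {0..x} f') has_vector_derivative f' x) (at x within {0..1})"
    using integral_has_vector_derivative[OF assms(2,3)] by (auto intro!: derivative_eq_intros)
  with primitive_eq_integral[OF assms(1)] show ?thesis
    by (rule has_vector_derivative_transform[OF assms(3)])
qed

lemma primitive_spike:
  assumes "primitive f f'" "negligible S" "\<And>x. x \<in> {0..1} - S \<Longrightarrow> g x = f' x"
  shows "primitive f g"
  unfolding primitive_def
proof
  fix x :: real assume "x \<in> {0..1}"
  then show "(g has_integral (f x - f 0)) {0..x}"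
    using assms by (intro has_integral_spike[OF assms(2), of "{0..x}" g f']) (auto simp: primitive_def)
qed

lemma primitive_Pair:
  assumes "primitive f f'" "primitive g g'" shows "primitive (\<lambda>x. (f x, g x)) (\<lambda>x. (f' x, g' x))"
proof -
  have "bounded_linear (\<lambda>x::'a. (x, 0::'b))" "bounded_linear (\<lambda>x::'b. (0::'a, x))"
    by (auto intro!: bounded_linear_Pair bounded_linear_ident bounded_linear_zero)
  from primitive_add[OF primitive_linear[OF assms(1) this(1)] primitive_linear[OF assms(2) this(2)]]
  show ?thesis by simp
qed

text \<open>
  The second order remainder of a bilinear map is a product of two increments, which is what
  strictness requires.
\<close>

lemma primitive_bilinear:
  assumes bl: "bounded_bilinear pr" and f: "primitive f f'" and g: "primitive g g'"
  shows "primitive (\<lambda>x. pr (f x) (g x)) (\<lambda>x. pr (f x) (g' x) + pr (f' x) (g x))"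
proof -
  interpret bounded_bilinear pr by (rule bl)
  obtain K where K: "K > 0" "\<And>a b. norm (pr a b) \<le> norm a * norm b * K" using pos_bounded by blast
  have "compact (f ` {0..1})" "compact (g ` {0..1})"
    using primitive_continuous[OF f] primitive_continuous[OF g] by (auto intro: compact_continuous_image)
  then obtain Cf Cg where C: "\<And>x. x \<in> {0..1} \<Longrightarrow> norm (f x) \<le> Cf" "\<And>x. x \<in> {0..1} \<Longrightarrow> norm (g x) \<le> Cg"
    by (metis compact_imp_bounded bounded_iff imageI)
  have "primitive (\<lambda>x. (\<lambda>(a,b). pr a b) (f x, g x)) (\<lambda>x. (\<lambda>(a,b). pr (f x) b + pr a (g x)) (f' x, g' x))"
  proof (rule primitive_chain[OF primitive_Pair[OF f g], where B = "(Cf + Cg) * K"])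
    fix x :: real assume x: "x \<in> {0..1}"
    show "linear (\<lambda>(a, b). pr (f x) b + pr a (g x))"
      by (auto intro!: linearI simp: add_left add_right scaleR_left scaleR_right scaleR_add_right)
    show "norm (case y of (a, b) \<Rightarrow> pr (f x) b + pr a (g x)) \<le> (Cf + Cg) * K * norm y" for y
    proof -
      obtain a b where y: "y = (a,b)" by (cases y)
      have n: "norm a \<le> norm y" "norm b \<le> norm y" unfolding y by (rule norm_fst_le norm_snd_le)+
      have "norm (pr (f x) b + pr a (g x)) \<le> norm (f x) * norm b * K + norm a * norm (g x) * K"
        using norm_triangle_ineq K(2) add_mono order_trans by metis
      also have "\<dots> \<le> Cf * norm y * K + norm y * Cg * K"
        using n C[OF x] K(1) by (intro add_mono mult_right_mono mult_mono) (auto intro: order_trans[OF norm_ge_zero])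
      finally show ?thesis by (simp add: y algebra_simps)
    qed
    fix e :: real assume e: "e > 0"
    define d where "d = e / (2 * K)"
    have d: "d > 0" using e K by (simp add: d_def)
    show "\<exists>d>0. \<forall>a b. norm (a - (f x, g x)) < d \<longrightarrow> norm (b - (f x, g x)) < d \<longrightarrow>
      norm ((case a of (a, b) \<Rightarrow> pr a b) - (case b of (a, b) \<Rightarrow> pr a b) -
        (case a - b of (a, b) \<Rightarrow> pr (f x) b + pr a (g x))) \<le> e * norm (a - b)"
    proof (intro exI[of _ d] conjI d allI impI)
      fix a b :: "'a \<times> 'b"
      assume na: "norm (a - (f x, g x)) < d" and nb: "norm (b - (f x, g x)) < d"
      obtain a1 a2 b1 b2 where ab: "a = (a1,a2)" "b = (b1,b2)" by (cases a, cases b)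
      have n1: "norm (a1 - f x) \<le> d" and n2: "norm (b2 - g x) \<le> d"
        using na nb ab norm_fst_le[of "a1 - f x" "a2 - g x"] norm_snd_le[of "b2 - g x" "b1 - f x"] by auto
      have n3: "norm (a1 - b1) \<le> norm (a - b)" "norm (a2 - b2) \<le> norm (a - b)"
        unfolding ab by (simp_all add: norm_fst_le norm_snd_le)
      have eq: "pr a1 a2 - pr b1 b2 - (pr (f x) (a2 - b2) + pr (a1 - b1) (g x))
          = pr (a1 - f x) (a2 - b2) + pr (a1 - b1) (b2 - g x)"
        by (simp add: diff_left diff_right)
      have "norm (pr (a1 - f x) (a2 - b2) + pr (a1 - b1) (b2 - g x))
         \<le> norm (a1 - f x) * norm (a2 - b2) * K + norm (a1 - b1) * norm (b2 - g x) * K"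
        using norm_triangle_ineq K(2) add_mono order_trans by metis
      also have "\<dots> \<le> d * norm (a - b) * K + norm (a - b) * d * K"
        using n1 n2 n3 K(1) d by (intro add_mono mult_right_mono mult_mono) auto
      also have "\<dots> = e * norm (a - b)" using K(1) by (simp add: d_def field_simps)
      finally show "norm ((case a of (a, b) \<Rightarrow> pr a b) - (case b of (a, b) \<Rightarrow> pr a b) -
        (case a - b of (a, b) \<Rightarrow> pr (f x) b + pr a (g x))) \<le> e * norm (a - b)"
        using eq by (simp add: ab)
    qed
  qed
  then show ?thesis by simp
qed

lemma primitive_chain_real:
  fixes f f' :: "real \<Rightarrow> real" and h h' :: "real \<Rightarrow> real"
  assumes prim: "primitive f f'" and U: "open U" "\<And>x. x \<in> {0..1} \<Longrightarrow> f x \<in> U"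
    and h: "\<And>y. y \<in> U \<Longrightarrow> (h has_real_derivative h' y) (at y)"
    and cont: "continuous_on U h'"
  shows "primitive (\<lambda>x. h (f x)) (\<lambda>x. h' (f x) * f' x)"
proof -
  have cf: "continuous_on {0..1} f" by (rule primitive_continuous[OF prim])
  have "continuous_on {0..1} (\<lambda>x. h' (f x))"
    by (rule continuous_on_compose2[OF cont cf]) (use U in auto)
  then have "compact ((\<lambda>x. h' (f x)) ` {0..1})" by (auto intro: compact_continuous_image)
  then obtain B where B: "\<And>x. x \<in> {0..1} \<Longrightarrow> \<bar>h' (f x)\<bar> \<le> B"
    by (metis compact_imp_bounded bounded_iff imageI real_norm_def)
  show ?thesis
  proof (rule primitive_chain[OF prim, where L = "\<lambda>x y. h' (f x) * y" and B = B])
    fix x :: real assume x: "x \<in> {0..1}"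
    show "linear ((*) (h' (f x)))" by (auto intro!: linearI simp: algebra_simps)
    show "norm (h' (f x) * y) \<le> B * norm y" for y
      using B[OF x] by (simp add: abs_mult mult_right_mono)
    fix e :: real assume e: "e > 0"
    obtain d1 where d1: "d1 > 0" "ball (f x) d1 \<subseteq> U" using U x by (meson open_contains_ball)
    obtain d2 where d2: "d2 > 0" "\<And>y. y \<in> U \<Longrightarrow> \<bar>y - f x\<bar> < d2 \<Longrightarrow> \<bar>h' y - h' (f x)\<bar> < e"
      using cont U(2)[OF x] e unfolding continuous_on_iff dist_real_def by blast
    define d where "d = min d1 d2"
    show "\<exists>d>0. \<forall>a b. norm (a - f x) < d \<longrightarrow> norm (b - f x) < d \<longrightarrow>
        norm (h a - h b - h' (f x) * (a - b)) \<le> e * norm (a - b)"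
    proof (intro exI[of _ d] conjI allI impI)
      show "d > 0" using d1 d2 by (simp add: d_def)
      fix a b assume ab: "norm (a - f x) < d" "norm (b - f x) < d"
      have "norm ((h a - h' (f x) * a) - (h b - h' (f x) * b)) \<le> e * norm (a - b)"
      proof (rule field_differentiable_bound[where S = "ball (f x) d" and f' = "\<lambda>y. h' y - h' (f x)"])
        fix z assume z: "z \<in> ball (f x) d"
        then have zU: "z \<in> U" using d1(2) by (auto simp: d_def)
        show "((\<lambda>y. h y - h' (f x) * y) has_field_derivative h' z - h' (f x)) (at z within ball (f x) d)"
          by (rule has_field_derivative_at_within) (auto intro!: derivative_eq_intros h zU)
        show "norm (h' z - h' (f x)) \<le> e"
          using d2(2)[OF zU] z by (auto simp: d_def dist_real_def abs_minus_commute)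
      qed (use ab in \<open>auto simp: dist_real_def abs_minus_commute\<close>)
      then show "norm (h a - h b - h' (f x) * (a - b)) \<le> e * norm (a - b)" by (simp add: algebra_simps)
    qed
  qed
qed

text \<open>
  If every interval integral of \<open>f\<close> vanishes, the Henstock lemma says that the Riemann sums of \<open>norm f\<close>
  are themselves small, so \<open>norm f\<close> has integral 0.
\<close>

lemma primitive_zero_imp_ae_zero:
  fixes f :: "real \<Rightarrow> 'a::euclidean_space"
  assumes "primitive (\<lambda>x. 0) f"
  obtains S where "negligible S" "\<And>x. x \<in> {0..1} - S \<Longrightarrow> f x = 0"
proof -
  have int: "f integrable_on cbox 0 1" using primitive_integrable[OF assms] by simp
  have norm0: "((\<lambda>x. norm (f x)) has_integral 0) (cbox 0 1)"
    unfolding has_integral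
  proof (intro allI impI)
    fix e :: real assume "e > 0"
    then obtain \<gamma> where g: "gauge \<gamma>"
      and H: "\<And>p. \<lbrakk>p tagged_partial_division_of (cbox 0 1); \<gamma> fine p\<rbrakk> \<Longrightarrow>
             sum (\<lambda>(x,k). norm (measure lborel k *\<^sub>R f x - integral k f)) p < e"
      using Henstock_lemma[OF int] by blast
    have "norm ((\<Sum>(x, k)\<in>p. measure lborel k *\<^sub>R norm (f x)) - 0) < e"
      if p: "p tagged_division_of cbox 0 1" "\<gamma> fine p" for p
    proof -
      have "(\<Sum>(x, k)\<in>p. measure lborel k *\<^sub>R norm (f x)) = (\<Sum>(x,k)\<in>p. norm (measure lborel k *\<^sub>R f x - integral k f))"
      proof (rule sum.cong[OF refl], clarify)
        fix x K assume xK: "(x, K) \<in> p"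
        then obtain u v where K: "K = {u..v}" using p(1) by (metis box_real(2) tagged_division_ofD(4))
        have "x \<in> K" and sub: "K \<subseteq> {0..1}" using p(1) xK by auto
        then have "u \<le> v" "0 \<le> u" "v \<le> 1" using K by auto
        then have "integral K f = 0"
          using primitiveD[OF assms, of u v] K by (auto intro: integral_unique)
        then show "measure lborel K *\<^sub>R norm (f x) = norm (measure lborel K *\<^sub>R f x - integral K f)" by simp
      qed
      also have "\<dots> < e" by (rule H) (use p tagged_division_of_def in blast)+
      finally have lt: "(\<Sum>(x, k)\<in>p. measure lborel k *\<^sub>R norm (f x)) < e" .
      moreover have "0 \<le> (\<Sum>(x, k)\<in>p. measure lborel k *\<^sub>R norm (f x))"
        by (intro sum_nonneg) auto
      ultimately show ?thesis by simp
    qed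
    then show "\<exists>\<gamma>. gauge \<gamma> \<and> (\<forall>p. p tagged_division_of cbox 0 1 \<and> \<gamma> fine p \<longrightarrow>
        norm ((\<Sum>(x, k)\<in>p. measure lborel k *\<^sub>R norm (f x)) - 0) < e)" using g by metis
  qed
  have ni: "(\<lambda>x. norm (f x)) absolutely_integrable_on {0..1}"
    using norm0 by (intro nonnegative_absolutely_integrable_1) (auto simp: has_integral_integrable)
  have "integral\<^sup>L lebesgue (\<lambda>x. indicat_real {0..1} x *\<^sub>R norm (f x)) = 0"
    using set_lebesgue_integral_eq_integral(2)[OF ni] integral_unique[OF norm0]
    by (simp add: set_lebesgue_integral_def)
  then have "AE x in lebesgue. indicat_real {0..1} x *\<^sub>R norm (f x) = 0"
    using ni by (subst (asm) integral_nonneg_eq_0_iff_AE) (auto simp: set_integrable_def)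
  then obtain S where S: "S \<in> null_sets lebesgue" "{x. indicat_real {0..1} x *\<^sub>R norm (f x) \<noteq> 0} \<subseteq> S"
    by (auto simp: eventually_ae_filter)
  show thesis
  proof (rule that[of S])
    show "negligible S" using S by (simp add: negligible_iff_null_sets)
    show "f x = 0" if "x \<in> {0..1} - S" for x using S(2) that by (auto simp: indicator_def)
  qed
qed

lemma continuous_ae_zero_imp_zero:
  fixes f :: "real \<Rightarrow> 'a::euclidean_space"
  assumes "continuous_on {0..1} f" "negligible S" "\<And>x. x \<in> {0..1} - S \<Longrightarrow> f x = 0" "x \<in> {0..1}"
  shows "f x = 0"
proof -
  have "primitive (\<lambda>x. 0::'a) f"
  proof (rule primitive_spike[OF _ assms(2)])
    show "primitive (\<lambda>x. 0::'a) (\<lambda>x. 0)" by (simp add: primitive_def)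
  qed (use assms in auto)
  then have "((\<lambda>x. 0) has_vector_derivative f x) (at x within {0..1})"
    using primitive_continuous_imp_deriv assms by blast
  then show ?thesis
    using vector_derivative_unique_within[of x "{0..1}" "\<lambda>x. 0" "f x" 0] assms(4)
    by (auto simp: trivial_limit_within islimpt_Icc)
qed

section \<open>Smooth functions on the unit interval\<close>

text \<open>
  Smoothness is proved by exhibiting a class of functions that is closed under taking derivatives.
\<close>

lemma smooth_I_coinduct:
  fixes f :: "real \<Rightarrow> 'a::real_normed_vector"
  assumes "f \<in> X" and "\<And>g. g \<in> X \<Longrightarrow> \<exists>h\<in>X. \<forall>x\<in>{0..1}. (g has_vector_derivative h x) (at x within {0..1})"
  shows "smooth_I f"
proof -
  obtain d where d: "\<And>g. g \<in> X \<Longrightarrow> d g \<in> X"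
    "\<And>g x. g \<in> X \<Longrightarrow> x \<in> {0..1} \<Longrightarrow> (g has_vector_derivative d g x) (at x within {0..1})"
    using assms(2) by metis
  have "(d ^^ n) f \<in> X" for n using assms(1) d(1) by (induction n) auto
  then show ?thesis
    unfolding smooth_I_def by (intro exI[of _ "\<lambda>n. (d ^^ n) f"]) (auto intro: d(2))
qed

lemma smooth_I_deriv:
  assumes "smooth_I f"
  obtains f' where "smooth_I f'" "\<And>x. x \<in> {0..1} \<Longrightarrow> (f has_vector_derivative f' x) (at x within {0..1})"
proof -
  obtain D where D: "\<And>x. x \<in> {0..1} \<Longrightarrow> D 0 x = f x"
    "\<And>n x. x \<in> {0..1} \<Longrightarrow> (D n has_vector_derivative D (Suc n) x) (at x within {0..1})"
    using assms unfolding smooth_I_def by metis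
  show thesis
  proof (rule that[of "D 1"])
    show "smooth_I (D 1)" unfolding smooth_I_def
      by (intro exI[of _ "\<lambda>n. D (Suc n)"]) (use D(2) in auto)
    fix x :: real assume x: "x \<in> {0..1}"
    show "(f has_vector_derivative D 1 x) (at x within {0..1})"
      using has_vector_derivative_transform[OF x _ D(2)[OF x, of 0]] D(1) by simp
  qed
qed

lemma smooth_I_antideriv:
  assumes "smooth_I f'" "\<And>x. x \<in> {0..1} \<Longrightarrow> (f has_vector_derivative f' x) (at x within {0..1})"
  shows "smooth_I f"
proof (rule smooth_I_coinduct)
  show "f \<in> insert f {g. smooth_I g}" by simp
  fix g assume "g \<in> insert f {g. smooth_I g}"
  then consider "g = f" | "smooth_I g" by blast
  then show "\<exists>h\<in>insert f {g. smooth_I g}. \<forall>x\<in>{0..1}. (g has_vector_derivative h x) (at x within {0..1})"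
  proof cases
    case 1
    then show ?thesis using assms by (intro bexI[of _ f']) auto
  next
    case 2
    from smooth_I_deriv[OF this]
    obtain h where "smooth_I h" "\<And>x. x \<in> {0..1} \<Longrightarrow> (g has_vector_derivative h x) (at x within {0..1})"
      by blast
    then show ?thesis by (intro bexI[of _ h]) auto
  qed
qed

lemma smooth_I_continuous:
  assumes "smooth_I f" shows "continuous_on {0..1} f"
proof -
  obtain f' where "\<And>x. x \<in> {0..1} \<Longrightarrow> (f has_vector_derivative f' x) (at x within {0..1})"
    using smooth_I_deriv[OF assms] by blast
  then show ?thesis
    by (meson continuous_on_eq_continuous_within has_vector_derivative_continuous)
qed

lemma smooth_I_linear:
  assumes "smooth_I f" "smooth_I g"
  shows "smooth_I (\<lambda>x. a *\<^sub>R f x + b *\<^sub>R g x)"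
proof (rule smooth_I_coinduct)
  show "(\<lambda>x. a *\<^sub>R f x + b *\<^sub>R g x) \<in> {\<lambda>x. a *\<^sub>R f x + b *\<^sub>R g x | f g. smooth_I f \<and> smooth_I g}"
    using assms by blast
  fix h assume "h \<in> {\<lambda>x. a *\<^sub>R f x + b *\<^sub>R g x | f g. smooth_I f \<and> smooth_I g}"
  then obtain f g where h: "h = (\<lambda>x. a *\<^sub>R f x + b *\<^sub>R g x)" "smooth_I f" "smooth_I g" by blast
  obtain f' where f': "smooth_I f'" "\<And>x. x \<in> {0..1} \<Longrightarrow> (f has_vector_derivative f' x) (at x within {0..1})"
    using smooth_I_deriv[OF h(2)] by blast
  obtain g' where g': "smooth_I g'" "\<And>x. x \<in> {0..1} \<Longrightarrow> (g has_vector_derivative g' x) (at x within {0..1})"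
    using smooth_I_deriv[OF h(3)] by blast
  show "\<exists>k\<in>{\<lambda>x. a *\<^sub>R f x + b *\<^sub>R g x | f g. smooth_I f \<and> smooth_I g}. \<forall>x\<in>{0..1}. (h has_vector_derivative k x) (at x within {0..1})"
    unfolding h by (rule bexI[of _ "\<lambda>x. a *\<^sub>R f' x + b *\<^sub>R g' x"])
      (use f' g' in \<open>auto intro!: derivative_eq_intros\<close>)
qed

lemma smooth_I_scaleR_const:
  assumes "smooth_I f" shows "smooth_I (\<lambda>x. f x *\<^sub>R (e::'a::real_normed_vector))"
proof (rule smooth_I_coinduct)
  show "(\<lambda>x. f x *\<^sub>R e) \<in> {\<lambda>x. f x *\<^sub>R e | f. smooth_I f}" using assms by blast
  fix h assume "h \<in> {\<lambda>x. f x *\<^sub>R e | f. smooth_I f}"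
  then obtain f where h: "h = (\<lambda>x. f x *\<^sub>R e)" "smooth_I f" by blast
  obtain f' where f': "smooth_I f'" "\<And>x. x \<in> {0..1} \<Longrightarrow> (f has_vector_derivative f' x) (at x within {0..1})"
    using smooth_I_deriv[OF h(2)] by blast
  show "\<exists>k\<in>{\<lambda>x. f x *\<^sub>R e | f. smooth_I f}. \<forall>x\<in>{0..1}. (h has_vector_derivative k x) (at x within {0..1})"
    unfolding h
    by (rule bexI[of _ "\<lambda>x. f' x *\<^sub>R e"]) (use f' in \<open>auto intro!: derivative_eq_intros simp: has_real_derivative_iff_has_vector_derivative\<close>)
qed

lemma real_polynomial_function_const: "real_polynomial_function (\<lambda>x::real. c)"
  by auto

lemma smooth_I_real_polynomial_function:
  assumes "real_polynomial_function p" shows "smooth_I p"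
proof (rule smooth_I_coinduct[of _ "Collect real_polynomial_function"])
  fix g :: "real \<Rightarrow> real" assume "g \<in> Collect real_polynomial_function"
  then obtain p' where "real_polynomial_function p'" "\<And>x. (g has_real_derivative p' x) (at x)"
    using has_real_derivative_polynomial_function by blast
  then show "\<exists>h\<in>Collect real_polynomial_function. \<forall>x\<in>{0..1}. (g has_vector_derivative h x) (at x within {0..1})"
    by (metis has_field_derivative_at_within has_real_derivative_iff_has_vector_derivative mem_Collect_eq)
qed (use assms in simp)

lemma integral_has_deriv:
  fixes f :: "real \<Rightarrow> 'a::euclidean_space"
  assumes "continuous_on {0..1} f" "x \<in> {0..1}"
  shows "((\<lambda>x. c + integral {0..x} f) has_vector_derivative f x) (at x within {0..1})"
  using integral_has_vector_derivative[OF assms] by (auto intro!: derivative_eq_intros)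

lemma integrable_times_smooth:
  fixes f p :: "real \<Rightarrow> real"
  assumes f: "f integrable_on {0..1}" and p: "smooth_I p"
  shows "(\<lambda>x. f x * p x) integrable_on {0..1}"
proof -
  obtain p' where p': "smooth_I p'" "\<And>x. x \<in> {0..1} \<Longrightarrow> (p has_vector_derivative p' x) (at x within {0..1})"
    using smooth_I_deriv[OF p] by blast
  let ?F = "\<lambda>x. 0 + integral {0..x} f"
  have F: "primitive ?F f" by (rule primitive_integral[OF f])
  have "primitive (\<lambda>x. ?F x * p x) (\<lambda>x. ?F x * p' x + f x * p x)"
    by (rule primitive_bilinear[OF bounded_bilinear_mult F primitive_deriv[OF p'(2)]])
  then have 1: "(\<lambda>x. ?F x * p' x + f x * p x) integrable_on {0..1}" by (rule primitive_integrable)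
  have "(\<lambda>x. ?F x * p' x) integrable_on {0..1}"
    by (intro integrable_continuous_real continuous_intros primitive_continuous[OF F] smooth_I_continuous[OF p'(1)])
  from integrable_diff[OF 1 this] show ?thesis by simp
qed

section \<open>The fundamental lemma of the calculus of variations\<close>

text \<open>
  Integration by parts transfers the vanishing moments from \<open>g\<close> to its primitive \<open>G\<close>, which is
  continuous; approximating \<open>G\<close> uniformly by polynomials then gives that the integral of \<open>G * G\<close> is 0.
\<close>

lemma zero_moments_imp_ae_zero:
  fixes g :: "real \<Rightarrow> real"
  assumes g: "g integrable_on {0..1}"
    and mom: "\<And>p. smooth_I p \<Longrightarrow> integral {0..1} (\<lambda>x. g x * p x) = 0"
  obtains S where "negligible S" "\<And>x. x \<in> {0..1} - S \<Longrightarrow> g x = 0"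
proof -
  define G where "G = (\<lambda>x. 0 + integral {0..x} g)"
  have G: "primitive G g" unfolding G_def by (rule primitive_integral[OF g])
  have cG: "continuous_on {0..1} G" by (rule primitive_continuous[OF G])
  have G1: "G 1 = 0"
    using mom[OF smooth_I_real_polynomial_function[OF real_polynomial_function_const, of 1]] by (simp add: G_def)
  have G0: "G 0 = 0" by (simp add: G_def)
  have ortho: "integral {0..1} (\<lambda>x. G x * r x) = 0" if r: "smooth_I r" for r :: "real \<Rightarrow> real"
  proof -
    let ?p = "\<lambda>x. 0 + integral {0..x} r"
    have pd: "\<And>x. x \<in> {0..1} \<Longrightarrow> (?p has_vector_derivative r x) (at x within {0..1})"
      by (rule integral_has_deriv[OF smooth_I_continuous[OF r]])
    have sp: "smooth_I ?p" by (rule smooth_I_antideriv[OF r pd])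
    have "primitive (\<lambda>x. G x * ?p x) (\<lambda>x. G x * r x + g x * ?p x)"
      by (rule primitive_bilinear[OF bounded_bilinear_mult G primitive_deriv[OF pd]])
    then have "((\<lambda>x. G x * r x + g x * ?p x) has_integral 0) {0..1}"
      unfolding primitive_def using G0 G1 by (auto dest: bspec[where x = 1])
    moreover have "((\<lambda>x. g x * ?p x) has_integral 0) {0..1}"
      using mom[OF sp] integrable_times_smooth[OF g sp] by (metis integrable_integral)
    ultimately have "((\<lambda>x. G x * r x + g x * ?p x - g x * ?p x) has_integral 0 - 0) {0..1}"
      by (rule has_integral_diff)
    then show ?thesis by (simp add: integral_unique)
  qed
  have int2: "(\<lambda>x. G x * G x) integrable_on {0..1}"
    by (intro integrable_continuous_real continuous_intros cG)
  have "\<bar>integral {0..1} (\<lambda>x. G x * G x)\<bar> \<le> 0 + e" if e: "e > 0" for e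
  proof -
    obtain B where B: "B > 0" "\<And>x. x \<in> {0..1} \<Longrightarrow> \<bar>G x\<bar> \<le> B"
      using compact_imp_bounded[OF compact_continuous_image[OF cG]] by (auto simp: bounded_pos)
    obtain r where r: "real_polynomial_function r" "\<And>x. x \<in> {0..1} \<Longrightarrow> \<bar>G x - r x\<bar> < e / B"
      using Stone_Weierstrass_real_polynomial_function[of "{0..1}" G "e / B"] cG e B(1) by auto
    have sr: "smooth_I r" by (rule smooth_I_real_polynomial_function[OF r(1)])
    have intr: "(\<lambda>x. G x * r x) integrable_on {0..1}"
      by (intro integrable_continuous_real continuous_intros cG smooth_I_continuous[OF sr])
    have "integral {0..1} (\<lambda>x. G x * G x) = integral {0..1} (\<lambda>x. G x * (G x - r x))"
      using integral_diff[OF int2 intr] ortho[OF sr] by (simp add: algebra_simps)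
    moreover have "norm (integral {0..1} (\<lambda>x. G x * (G x - r x))) \<le> e * (1 - 0)"
    proof (rule integral_bound)
      fix x :: real assume x: "x \<in> {0..1}"
      have "\<bar>G x\<bar> * \<bar>G x - r x\<bar> \<le> B * (e / B)"
        using B r(2)[OF x] x by (intro mult_mono) auto
      then show "norm (G x * (G x - r x)) \<le> e" using B(1) by (simp add: abs_mult)
    qed (auto intro!: continuous_intros cG smooth_I_continuous[OF sr])
    ultimately show ?thesis by simp
  qed
  then have "integral {0..1} (\<lambda>x. G x * G x) = 0" using field_le_epsilon[of "\<bar>integral {0..1} (\<lambda>x. G x * G x)\<bar>" 0] by auto
  then have "((\<lambda>x. G x * G x) has_integral 0) (cbox 0 1)" using int2 by (metis box_real(2) integrable_integral)
  then have "G x * G x = 0" if "x \<in> {0..1}" for x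
    using has_integral_0_cbox_imp_0[of 0 1 "\<lambda>x. G x * G x" x] that cG by (auto intro!: continuous_intros)
  then have "primitive (\<lambda>x. 0) g" using G by (auto simp: primitive_def)
  then show thesis using that by (rule primitive_zero_imp_ae_zero)
qed

lemma has_integral_id_01: "((\<lambda>x. x) has_integral (1/2::real)) {0..1}" "((\<lambda>x. x * x) has_integral (1/3::real)) {0..1}"
proof -
  show "((\<lambda>x. x) has_integral (1/2::real)) {0..1}"
    using ident_has_integral[of 0 "1::real"] by simp
  have "((\<lambda>x. x * x) has_integral (1^3/3 - 0^3/3::real)) {0..1}"
    by (rule fundamental_theorem_of_calculus)
       (auto intro!: derivative_eq_intros simp: has_real_derivative_iff_has_vector_derivative[symmetric] power2_eq_square)
  then show "((\<lambda>x. x * x) has_integral (1/3::real)) {0..1}" by simp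
qed

text \<open>
  Integrating \<open>Q\<close> once turns the weak equation into the orthogonality of \<open>f = P - \<integral> Q\<close> to all second
  derivatives \<open>\<psi>''\<close> of admissible tests, which are the smooth \<open>q\<close> orthogonal to 1 and \<open>x\<close>. Subtracting
  from \<open>f\<close> the affine function with the same two moments makes all moments vanish.
\<close>

lemma du_Bois_Reymond_second_order:
  fixes P Q :: "real \<Rightarrow> real"
  assumes P: "P integrable_on {0..1}" and Q: "Q integrable_on {0..1}"
    and tests: "\<And>\<psi> \<psi>' \<psi>''. \<lbrakk>smooth_I \<psi>'';
      \<And>x. x \<in> {0..1} \<Longrightarrow> (\<psi> has_vector_derivative \<psi>' x) (at x within {0..1});
      \<And>x. x \<in> {0..1} \<Longrightarrow> (\<psi>' has_vector_derivative \<psi>'' x) (at x within {0..1});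
      \<psi> 0 = 0; \<psi> 1 = 0; \<psi>' 0 = 0; \<psi>' 1 = 0\<rbrakk> \<Longrightarrow>
      integral {0..1} (\<lambda>x. P x * \<psi>'' x + Q x * \<psi>' x) = 0"
  obtains a b S where "negligible S" "\<And>x. x \<in> {0..1} - S \<Longrightarrow> P x = a + b * x + integral {0..x} Q"
proof -
  define R where "R = (\<lambda>x. 0 + integral {0..x} Q)"
  have R: "primitive R Q" unfolding R_def by (rule primitive_integral[OF Q])
  have cR: "continuous_on {0..1} R" by (rule primitive_continuous[OF R])
  define f where "f x = P x - R x" for x
  have f: "f integrable_on {0..1}"
    unfolding f_def by (intro integrable_diff P integrable_continuous_real cR)
  have sx: "smooth_I (\<lambda>x. x::real)" and s1: "smooth_I (\<lambda>x. c::real)" for c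
    by (auto intro!: smooth_I_real_polynomial_function real_polynomial_function.intros bounded_linear_ident)
  have ortho: "integral {0..1} (\<lambda>x. f x * q x) = 0"
    if q: "smooth_I q" "integral {0..1} q = 0" "integral {0..1} (\<lambda>x. q x * x) = 0" for q
  proof -
    let ?p = "\<lambda>x. 0 + integral {0..x} q"
    let ?\<psi> = "\<lambda>x. 0 + integral {0..x} ?p"
    have pd: "\<And>x. x \<in> {0..1} \<Longrightarrow> (?p has_vector_derivative q x) (at x within {0..1})"
      by (rule integral_has_deriv[OF smooth_I_continuous[OF q(1)]])
    have sp: "smooth_I ?p" by (rule smooth_I_antideriv[OF q(1) pd])
    have psd: "\<And>x. x \<in> {0..1} \<Longrightarrow> (?\<psi> has_vector_derivative ?p x) (at x within {0..1})"
      by (rule integral_has_deriv[OF smooth_I_continuous[OF sp]])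
    have p1: "?p 1 = 0" using q(2) by simp
    have "primitive (\<lambda>x. x * ?p x) (\<lambda>x. x * q x + 1 * ?p x)"
      by (rule primitive_bilinear[OF bounded_bilinear_mult primitive_deriv primitive_deriv[OF pd]])
         (auto intro!: derivative_eq_intros)
    then have "((\<lambda>x. x * q x + ?p x) has_integral 0) {0..1}"
      unfolding primitive_def using p1 by (auto dest: bspec[where x = 1])
    moreover have "((\<lambda>x. x * q x) has_integral 0) {0..1}"
      using q(3) integrable_times_smooth[OF integrable_continuous_real[OF smooth_I_continuous[OF q(1)]] sx]
      by (metis (no_types, lifting) has_integral_cong integrable_integral mult.commute)
    ultimately have "((\<lambda>x. (x * q x + ?p x) - x * q x) has_integral 0 - 0) {0..1}"
      by (rule has_integral_diff)
    then have ps1: "?\<psi> 1 = 0" by (simp add: integral_unique)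
    have z: "integral {0..1} (\<lambda>x. P x * q x + Q x * ?p x) = 0"
      by (rule tests[OF q(1) psd pd]) (use p1 ps1 in auto)
    have i1: "(\<lambda>x. P x * q x + Q x * ?p x) integrable_on {0..1}"
      by (intro integrable_add integrable_times_smooth P Q q sp)
    have "primitive (\<lambda>x. R x * ?p x) (\<lambda>x. R x * q x + Q x * ?p x)"
      by (rule primitive_bilinear[OF bounded_bilinear_mult R primitive_deriv[OF pd]])
    then have "((\<lambda>x. R x * q x + Q x * ?p x) has_integral 0) {0..1}"
      unfolding primitive_def using p1 by (auto dest: bspec[where x = 1] simp: R_def)
    from has_integral_diff[OF integrable_integral[OF i1] this] z
    have "((\<lambda>x. f x * q x) has_integral 0) {0..1}" by (simp add: f_def algebra_simps)
    then show ?thesis by (rule integral_unique)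
  qed
  define A where "A = integral {0..1} f"
  define B where "B = integral {0..1} (\<lambda>x. f x * x)"
  \<comment> \<open>The affine function with moments \<open>A\<close> and \<open>B\<close>: the inverse of the matrix with rows
    \<open>(1, 1/2)\<close> and \<open>(1/2, 1/3)\<close> has rows \<open>(4, -6)\<close> and \<open>(-6, 12)\<close>.\<close>
  define a where "a = 4 * A - 6 * B"
  define b where "b = 12 * B - 6 * A"
  define g where "g x = f x - (a + b * x)" for x
  have g: "g integrable_on {0..1}"
    unfolding g_def by (intro integrable_diff f integrable_continuous_real continuous_intros)
  have "integral {0..1} (\<lambda>x. g x * p x) = 0" if p: "smooth_I p" for p
  proof -
    define m0 where "m0 = integral {0..1} p"
    define m1 where "m1 = integral {0..1} (\<lambda>x. p x * x)"
    have m0: "(p has_integral m0) {0..1}"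
      unfolding m0_def by (intro integrable_integral integrable_continuous_real smooth_I_continuous p)
    have m1: "((\<lambda>x. p x * x) has_integral m1) {0..1}"
      unfolding m1_def by (intro integrable_integral integrable_continuous_real continuous_intros smooth_I_continuous p)
    \<comment> \<open>The same affine correction for \<open>p\<close>; as the moment matrix is symmetric, it can be moved to \<open>f\<close>.\<close>
    define \<alpha> where "\<alpha> = 4 * m0 - 6 * m1"
    define \<beta> where "\<beta> = 12 * m1 - 6 * m0"
    define q where "q x = 1 *\<^sub>R p x + (-1) *\<^sub>R (\<alpha> *\<^sub>R 1 + \<beta> *\<^sub>R x)" for x
    have sq: "smooth_I q" unfolding q_def by (intro smooth_I_linear p s1 sx)
    have q_eq: "q = (\<lambda>x. p x - (\<alpha> + \<beta> * x))" by (auto simp: q_def)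
    have "(q has_integral (m0 - (\<alpha> + \<beta> * (1/2)))) {0..1}"
      unfolding q_eq using has_integral_diff[OF m0 has_integral_add[OF has_integral_const_real[of \<alpha> 0 1] has_integral_mult_right[OF has_integral_id_01(1), of \<beta>]]]
      by simp
    then have q0: "integral {0..1} q = 0" by (simp add: integral_unique \<alpha>_def \<beta>_def field_simps)
    have "((\<lambda>x. q x * x) has_integral (m1 - (\<alpha> * (1/2) + \<beta> * (1/3)))) {0..1}"
      unfolding q_eq using has_integral_diff[OF m1 has_integral_add[OF has_integral_mult_right[OF has_integral_id_01(1), of \<alpha>] has_integral_mult_right[OF has_integral_id_01(2), of \<beta>]]]
      by (simp add: algebra_simps)
    then have q1: "integral {0..1} (\<lambda>x. q x * x) = 0" by (simp add: integral_unique \<alpha>_def \<beta>_def field_simps)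
    have fq: "((\<lambda>x. f x * q x) has_integral 0) {0..1}"
      using ortho[OF sq q0 q1] integrable_times_smooth[OF f sq] by (metis integrable_integral)
    have f0: "(f has_integral A) {0..1}" unfolding A_def using f by (rule integrable_integral)
    have f1: "((\<lambda>x. f x * x) has_integral B) {0..1}" unfolding B_def
      by (intro integrable_integral integrable_times_smooth f sx)
    have "((\<lambda>x. (f x * q x + (\<alpha> * f x + \<beta> * (f x * x))) - (a * p x + b * (p x * x))) has_integral
        (0 + (\<alpha> * A + \<beta> * B)) - (a * m0 + b * m1)) {0..1}"
      by (intro has_integral_add has_integral_diff has_integral_mult_right fq f0 f1 m0 m1)
    moreover have "(f x * q x + (\<alpha> * f x + \<beta> * (f x * x))) - (a * p x + b * (p x * x)) = g x * p x" for x
      by (simp add: q_def g_def algebra_simps)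
    moreover have "(0 + (\<alpha> * A + \<beta> * B)) - (a * m0 + b * m1) = 0"
      by (simp add: \<alpha>_def \<beta>_def a_def b_def algebra_simps)
    ultimately show ?thesis by (simp add: integral_unique)
  qed
  from zero_moments_imp_ae_zero[OF g this]
  obtain S where S: "negligible S" "\<And>x. x \<in> {0..1} - S \<Longrightarrow> g x = 0" by blast
  have "P x = a + b * x + integral {0..x} Q" if "x \<in> {0..1} - S" for x
    using S(2)[OF that] unfolding g_def f_def R_def by linarith
  with S(1) show thesis by (rule that)
qed

section \<open>Plane geometry\<close>

lemma rot90_nth [simp]: "rot90 v $ 1 = - v $ 2" "rot90 v $ 2 = v $ 1"
  by (simp_all add: rot90_def)

lemma inner_vec2: "u \<bullet> v = u $ 1 * v $ 1 + u $ 2 * v $ (2::2)" for u v :: "real^2"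
  by (simp add: inner_vec_def sum_2)

lemma vec2_eq_iff: "u = v \<longleftrightarrow> u $ 1 = v $ 1 \<and> u $ 2 = v $ (2::2)" for u v :: "real^2"
  by (simp add: vec_eq_iff forall_2)

lemma rot90_linear: "rot90 (u + v) = rot90 u + rot90 v" "rot90 (u - v) = rot90 u - rot90 v"
  "rot90 (c *\<^sub>R u) = c *\<^sub>R rot90 u" "rot90 (- u) = - rot90 u" "rot90 0 = 0"
  by (simp_all add: vec2_eq_iff)

lemma rot90_inner [simp]: "rot90 u \<bullet> rot90 v = u \<bullet> v" "rot90 u \<bullet> u = 0" "u \<bullet> rot90 u = 0"
  by (simp_all add: inner_vec2 algebra_simps)

lemma rot90_rot90 [simp]: "rot90 (rot90 u) = - u"
  by (simp add: vec2_eq_iff)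

lemma norm_rot90 [simp]: "norm (rot90 u) = norm u"
  by (simp add: norm_eq_sqrt_inner)

lemma bounded_linear_rot90: "bounded_linear rot90"
  by (rule bounded_linear_intro[of _ 1]) (auto simp: rot90_linear)

lemma frame_expansion:
  assumes "norm T = 1" shows "u = (u \<bullet> T) *\<^sub>R T + (u \<bullet> rot90 T) *\<^sub>R rot90 T"
proof -
  have "T $ 1 * T $ 1 + T $ 2 * T $ 2 = 1" using assms by (simp add: norm_eq_sqrt_inner inner_vec2)
  then show ?thesis unfolding vec2_eq_iff inner_vec2 by simp algebra
qed

lemma D_I_eqI:
  assumes "(f has_vector_derivative f') (at x within {0..1})" "x \<in> {0..1}"
  shows "D_I f x = f'"
  using vector_derivative_at_within_ivl  vector_derivative_within_cbox[of 0 1 x f f'] assms by auto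

lemma D_I_cong:
  assumes "\<And>x. x \<in> {0..1} \<Longrightarrow> f x = g x" "x \<in> {0..1}"
  shows "D_I f x = D_I g x"
proof -
  have "(f has_vector_derivative d) (at x within {0..1}) \<longleftrightarrow> (g has_vector_derivative d) (at x within {0..1})" for d
    using has_vector_derivative_transform[OF assms(2), of f g d] has_vector_derivative_transform[OF assms(2), of g f d] assms(1)
    by metis
  then show ?thesis unfolding vector_derivative_def by simp
qed

section \<open>The first variation of the energy of a curve\<close>

text \<open>
  The integrand of the elastic energy in terms of velocity \<open>v\<close> and acceleration \<open>w\<close>, where the signed
  curvature is \<open>(rot90 v \<bullet> w) / norm v ^ 3\<close>.
\<close>

definition energy_density :: "real \<Rightarrow> real^2 \<Rightarrow> real^2 \<Rightarrow> real" where
  "energy_density \<delta> v w = (rot90 v \<bullet> w)\<^sup>2 / norm v ^ 5 + \<delta> * norm v"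

definition energy_density_deriv :: "real \<Rightarrow> real^2 \<Rightarrow> real^2 \<Rightarrow> real^2 \<Rightarrow> real^2 \<Rightarrow> real" where
  "energy_density_deriv \<delta> v w a b = 2 * (rot90 v \<bullet> w) * (rot90 a \<bullet> w + rot90 v \<bullet> b) / norm v ^ 5
     - 5 * (rot90 v \<bullet> w)\<^sup>2 * (v \<bullet> a) / norm v ^ 7 + \<delta> * (v \<bullet> a) / norm v"

lemma rot90_decomposition: "(rot90 v \<bullet> w) *\<^sub>R rot90 v = (v \<bullet> v) *\<^sub>R w - (v \<bullet> w) *\<^sub>R v"
  by (simp add: vec2_eq_iff inner_vec2 algebra_simps)

lemma norm_has_real_derivative:
  fixes v :: "real \<Rightarrow> 'a::real_inner"
  assumes "(v has_vector_derivative w) (at x within A)" "v x \<noteq> 0"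
  shows "((\<lambda>x. norm (v x)) has_real_derivative (v x \<bullet> w / norm (v x))) (at x within A)"
proof -
  have "((\<lambda>x. v x \<bullet> v x) has_derivative (\<lambda>h. v x \<bullet> (h *\<^sub>R w) + (h *\<^sub>R w) \<bullet> v x)) (at x within A)"
    using assms(1) unfolding has_vector_derivative_def by (intro has_derivative_inner)
  then have "((\<lambda>x. v x \<bullet> v x) has_real_derivative 2 * (v x \<bullet> w)) (at x within A)"
    unfolding has_field_derivative_def by (rule has_derivative_eq_rhs) (auto simp: inner_commute)
  moreover have "v x \<bullet> v x > 0" using assms(2) by simp
  ultimately have "((\<lambda>x. sqrt (v x \<bullet> v x)) has_real_derivative
      inverse (sqrt (v x \<bullet> v x)) / 2 * (2 * (v x \<bullet> w))) (at x within A)"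
    by (intro DERIV_chain2[OF DERIV_real_sqrt])
  then show ?thesis
    unfolding norm_eq_sqrt_inner[symmetric] by (simp add: inverse_eq_divide)
qed

lemma has_vector_derivative_normalized:
  fixes v :: "real \<Rightarrow> real^2"
  assumes "(v has_vector_derivative w) (at x within A)" "v x \<noteq> 0"
  shows "((\<lambda>x. v x /\<^sub>R norm (v x)) has_vector_derivative
    (rot90 (v x) \<bullet> w / norm (v x) ^ 3) *\<^sub>R rot90 (v x)) (at x within A)"
proof -
  have "((\<lambda>x. inverse (norm (v x))) has_real_derivative - (inverse (norm (v x)) * (v x \<bullet> w / norm (v x)) * inverse (norm (v x)))) (at x within A)"
    using norm_has_real_derivative[OF assms] assms(2) by (intro DERIV_inverse') auto
  then have "((\<lambda>x. v x /\<^sub>R norm (v x)) has_vector_derivative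
      inverse (norm (v x)) *\<^sub>R w + (- (inverse (norm (v x)) * (v x \<bullet> w / norm (v x)) * inverse (norm (v x)))) *\<^sub>R v x) (at x within A)"
    using assms(1) by (intro has_vector_derivative_scaleR)
  moreover have "inverse (norm (v x)) *\<^sub>R w + (- (inverse (norm (v x)) * (v x \<bullet> w / norm (v x)) * inverse (norm (v x)))) *\<^sub>R v x
    = (1 / norm (v x) ^ 3) *\<^sub>R ((v x \<bullet> v x) *\<^sub>R w - (v x \<bullet> w) *\<^sub>R v x)"
    using assms(2) by (simp add: scaleR_diff_right dot_square_norm field_simps power2_eq_square power3_eq_cube)
  ultimately show ?thesis by (simp flip: rot90_decomposition)
qed

lemma energy_density_has_derivative:
  assumes "v + t *\<^sub>R a \<noteq> 0"
  shows "((\<lambda>t. energy_density \<delta> (v + t *\<^sub>R a) (w + t *\<^sub>R b)) has_real_derivative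
    energy_density_deriv \<delta> (v + t *\<^sub>R a) (w + t *\<^sub>R b) a b) (at t)"
proof -
  define V where "V = v + t *\<^sub>R a"
  have V: "V \<noteq> 0" using assms by (simp add: V_def)
  have "((\<lambda>t. v + t *\<^sub>R a) has_vector_derivative a) (at t)"
    by (auto intro!: derivative_eq_intros)
  from norm_has_real_derivative[OF this assms]
  have n: "((\<lambda>t. norm (v + t *\<^sub>R a)) has_real_derivative (V \<bullet> a / norm V)) (at t)"
    by (simp add: V_def)
  have c: "((\<lambda>t. rot90 (v + t *\<^sub>R a) \<bullet> (w + t *\<^sub>R b)) has_real_derivative
     (rot90 a \<bullet> (w + t *\<^sub>R b) + rot90 V \<bullet> b)) (at t)"
    unfolding V_def inner_vec2 rot90_nth
    by (auto intro!: derivative_eq_intros simp: algebra_simps)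
  show ?thesis
    unfolding energy_density_def energy_density_deriv_def
    using V n c
    apply (auto intro!: derivative_eq_intros simp: V_def[symmetric])
    apply (simp add: field_simps power_numeral_reduce)
    done
qed

text \<open>
  A bound by a quadratic polynomial in \<open>norm W\<close> is what square integrability of the acceleration can
  absorb; the velocity must stay away from 0.
\<close>

lemma energy_density_deriv_bound:
  assumes "0 < \<mu>" "\<mu> \<le> norm V" "norm a \<le> M" "norm b \<le> M" "\<delta> \<ge> 0"
  shows "\<bar>energy_density_deriv \<delta> V W a b\<bar> \<le> 7 * M / \<mu> ^ 4 * (norm W)\<^sup>2 + 2 * M / \<mu> ^ 3 * norm W + \<delta> * M"
proof -
  define k y where "k = norm V" and "y = norm W"
  have M: "0 \<le> M" using norm_ge_zero[of a] assms(3) by linarith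
  have k: "0 < k" "\<mu> \<le> k" and y: "0 \<le> y"
    using assms by (auto simp: k_def y_def)
  have cs: "\<bar>rot90 V \<bullet> W\<bar> \<le> k * y" "\<bar>rot90 a \<bullet> W\<bar> \<le> M * y" "\<bar>rot90 V \<bullet> b\<bar> \<le> k * M" "\<bar>V \<bullet> a\<bar> \<le> k * M"
    using Cauchy_Schwarz_ineq2[of "rot90 V" W] Cauchy_Schwarz_ineq2[of "rot90 a" W] Cauchy_Schwarz_ineq2[of "rot90 V" b]
      Cauchy_Schwarz_ineq2[of V a] assms(3,4) k y mult_right_mono[OF assms(3) y]
      mult_left_mono[OF assms(3), of k] mult_left_mono[OF assms(4), of k]
    by (auto simp: k_def y_def intro: order_trans)
  have t1: "\<bar>2 * (rot90 V \<bullet> W) * (rot90 a \<bullet> W + rot90 V \<bullet> b) / norm V ^ 5\<bar> \<le> 2 * M / \<mu> ^ 4 * y\<^sup>2 + 2 * M / \<mu> ^ 3 * y"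
  proof -
    have "\<bar>2 * (rot90 V \<bullet> W) * (rot90 a \<bullet> W + rot90 V \<bullet> b) / norm V ^ 5\<bar>
      = 2 * \<bar>rot90 V \<bullet> W\<bar> * \<bar>rot90 a \<bullet> W + rot90 V \<bullet> b\<bar> / k ^ 5"
      by (simp add: abs_mult k_def)
    also have "\<dots> \<le> 2 * (k * y) * (M * y + k * M) / k ^ 5"
      using cs k y M by (intro divide_right_mono mult_mono order_trans[OF abs_triangle_ineq] add_mono) auto
    also have "\<dots> = 2 * M * y\<^sup>2 / k ^ 4 + 2 * M * y / k ^ 3"
      using k by (simp add: field_simps power_numeral_reduce)
    also have "\<dots> \<le> 2 * M * y\<^sup>2 / \<mu> ^ 4 + 2 * M * y / \<mu> ^ 3"
      using k y M assms(1) by (intro add_mono divide_left_mono power_mono mult_pos_pos) auto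
    finally show ?thesis by simp
  qed
  have t2: "\<bar>5 * (rot90 V \<bullet> W)\<^sup>2 * (V \<bullet> a) / norm V ^ 7\<bar> \<le> 5 * M / \<mu> ^ 4 * y\<^sup>2"
  proof -
    have "\<bar>5 * (rot90 V \<bullet> W)\<^sup>2 * (V \<bullet> a) / norm V ^ 7\<bar> = 5 * \<bar>rot90 V \<bullet> W\<bar>\<^sup>2 * \<bar>V \<bullet> a\<bar> / k ^ 7"
      by (simp add: abs_mult k_def)
    also have "\<dots> \<le> 5 * (k * y)\<^sup>2 * (k * M) / k ^ 7"
      using cs k y M by (intro divide_right_mono mult_mono power_mono) auto
    also have "\<dots> = 5 * M * y\<^sup>2 / k ^ 4"
      using k by (simp add: field_simps power_numeral_reduce)
    also have "\<dots> \<le> 5 * M * y\<^sup>2 / \<mu> ^ 4"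
      using k y M assms(1) by (intro divide_left_mono power_mono mult_pos_pos) auto
    finally show ?thesis by simp
  qed
  have t3: "\<bar>\<delta> * (V \<bullet> a) / norm V\<bar> \<le> \<delta> * M"
  proof -
    have "\<bar>\<delta> * (V \<bullet> a) / norm V\<bar> = \<delta> * \<bar>V \<bullet> a\<bar> / k" using assms(5) by (simp add: abs_mult k_def)
    also have "\<dots> \<le> \<delta> * (k * M) / k" using cs k assms(5) by (intro divide_right_mono mult_left_mono) auto
    finally show ?thesis using k by simp
  qed
  have "\<bar>energy_density_deriv \<delta> V W a b\<bar> \<le> (2 * M / \<mu> ^ 4 * y\<^sup>2 + 2 * M / \<mu> ^ 3 * y) + 5 * M / \<mu> ^ 4 * y\<^sup>2 + \<delta> * M"
    unfolding energy_density_deriv_def using t1 t2 t3 by linarith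
  also have "\<dots> = 7 * M / \<mu> ^ 4 * y\<^sup>2 + 2 * M / \<mu> ^ 3 * y + \<delta> * M"
    by (simp add: field_simps)
  finally show ?thesis by (simp add: y_def)
qed

lemma energy_density_lipschitz:
  assumes \<mu>: "0 < \<mu>" and low: "\<And>s. \<bar>s\<bar> \<le> \<bar>t\<bar> \<Longrightarrow> \<mu> \<le> norm (v + s *\<^sub>R a)"
    and ab: "norm a \<le> M" "norm b \<le> M" and "\<delta> \<ge> 0" and t: "\<bar>t\<bar> \<le> 1"
  shows "\<bar>energy_density \<delta> (v + t *\<^sub>R a) (w + t *\<^sub>R b) - energy_density \<delta> v w\<bar>
    \<le> (7 * M / \<mu> ^ 4 * (norm w + M)\<^sup>2 + 2 * M / \<mu> ^ 3 * (norm w + M) + \<delta> * M) * \<bar>t\<bar>"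
proof -
  let ?B = "7 * M / \<mu> ^ 4 * (norm w + M)\<^sup>2 + 2 * M / \<mu> ^ 3 * (norm w + M) + \<delta> * M"
  let ?f = "\<lambda>s. energy_density \<delta> (v + s *\<^sub>R a) (w + s *\<^sub>R b)"
  have M: "0 \<le> M" using ab(1) norm_ge_zero order_trans by blast
  have "norm (?f t - ?f 0) \<le> ?B * norm (t - 0)"
  proof (rule field_differentiable_bound[where S = "{-\<bar>t\<bar>..\<bar>t\<bar>}"])
    fix s assume "s \<in> {-\<bar>t\<bar>..\<bar>t\<bar>}"
    then have s: "\<bar>s\<bar> \<le> \<bar>t\<bar>" by auto
    have "v + s *\<^sub>R a \<noteq> 0" using low[OF s] \<mu> by auto
    then show "(?f has_field_derivative energy_density_deriv \<delta> (v + s *\<^sub>R a) (w + s *\<^sub>R b) a b) (at s within {-\<bar>t\<bar>..\<bar>t\<bar>})"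
      by (rule has_field_derivative_at_within[OF energy_density_has_derivative])
    have "norm (w + s *\<^sub>R b) \<le> norm w + \<bar>s\<bar> * norm b" using norm_triangle_ineq[of w "s *\<^sub>R b"] by simp
    also have "\<bar>s\<bar> * norm b \<le> 1 * M" using s t ab M by (intro mult_mono) auto
    finally have W: "norm (w + s *\<^sub>R b) \<le> norm w + M" by simp
    have "norm (energy_density_deriv \<delta> (v + s *\<^sub>R a) (w + s *\<^sub>R b) a b) \<le>
       7 * M / \<mu> ^ 4 * (norm (w + s *\<^sub>R b))\<^sup>2 + 2 * M / \<mu> ^ 3 * norm (w + s *\<^sub>R b) + \<delta> * M"
      using energy_density_deriv_bound[OF \<mu> low[OF s] ab] assms(5) by simp
    also have "\<dots> \<le> ?B"
      using W M \<mu> assms(5) by (intro add_mono mult_left_mono power_mono) auto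
    finally show "norm (energy_density_deriv \<delta> (v + s *\<^sub>R a) (w + s *\<^sub>R b) a b) \<le> ?B" .
  qed auto
  then show ?thesis by simp
qed

lemma rot90_measurable [measurable]: "rot90 \<in> borel_measurable borel"
  by (intro borel_measurable_continuous_onI linear_continuous_on bounded_linear_rot90)

lemma energy_density_measurable [measurable]:
  assumes [measurable]: "V \<in> borel_measurable N" "W \<in> borel_measurable N"
  shows "(\<lambda>x. energy_density \<delta> (V x) (W x)) \<in> borel_measurable N"
  unfolding energy_density_def by measurable

text \<open>
  What the hypotheses give for the velocity \<open>v\<close> and acceleration \<open>w\<close> of a regular \<open>H\<^sup>2\<close> curve, without
  any reference to the curve.
\<close>

definition H2_velocity :: "(real \<Rightarrow> real^2) \<Rightarrow> (real \<Rightarrow> real^2) \<Rightarrow> bool" where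
  "H2_velocity v w \<longleftrightarrow> primitive v w \<and> w absolutely_integrable_on {0..1} \<and>
     (\<lambda>x. (norm (w x))\<^sup>2) integrable_on {0..1} \<and> (\<forall>x\<in>{0..1}. v x \<noteq> 0)"

lemma lebesgue_on_measurable_continuous:
  assumes "continuous_on {0..1::real} f" shows "f \<in> borel_measurable (lebesgue_on {0..1})"
  using assms by (intro continuous_imp_measurable_on_sets_lebesgue) auto

lemma H2_velocity_measurable:
  assumes "H2_velocity v w"
  shows "v \<in> borel_measurable (lebesgue_on {0..1})" "w \<in> borel_measurable (lebesgue_on {0..1})"
  using assms unfolding H2_velocity_def
  by (auto intro: lebesgue_on_measurable_continuous primitive_continuous absolutely_integrable_imp_borel_measurable)

lemma continuous_bounded_I:
  fixes f :: "real \<Rightarrow> 'a::real_normed_vector"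
  assumes "continuous_on {0..1} f"
  obtains B where "B > 0" "\<And>x. x \<in> {0..1} \<Longrightarrow> norm (f x) \<le> B"
  using compact_imp_bounded[OF compact_continuous_image[OF assms]] by (auto simp: bounded_pos)

lemma H2_velocity_lower_bound:
  assumes "H2_velocity v w"
  obtains m where "m > 0" "\<And>x. x \<in> {0..1} \<Longrightarrow> m \<le> norm (v x)"
proof -
  have c: "continuous_on {0..1} v" and nz: "\<And>x. x \<in> {0..1} \<Longrightarrow> v x \<noteq> 0"
    using assms primitive_continuous unfolding H2_velocity_def by auto
  obtain z where "z \<in> {0..1}" "\<And>x. x \<in> {0..1} \<Longrightarrow> norm (v z) \<le> norm (v x)"
    using continuous_attains_inf[of "{0..1::real}" "\<lambda>x. norm (v x)"] continuous_on_norm[OF c] by auto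
  then show thesis using that[of "norm (v z)"] nz by auto
qed

lemma H2_velocity_quadratic_integrable:
  assumes "H2_velocity v w"
  shows "(\<lambda>x. A * (norm (w x))\<^sup>2 + B * norm (w x) + C) integrable_on {0..1}"
  using assms unfolding H2_velocity_def absolutely_integrable_on_def
  by (intro integrable_add integrable_on_mult_right) auto

lemma H2_velocity_absolutely_integrable:
  fixes f :: "real \<Rightarrow> 'a::euclidean_space"
  assumes "H2_velocity v w" "f \<in> borel_measurable (lebesgue_on {0..1})"
    and "\<And>x. x \<in> {0..1} \<Longrightarrow> norm (f x) \<le> A * (norm (w x))\<^sup>2 + B * norm (w x) + C"
  shows "f absolutely_integrable_on {0..1}"
  by (rule measurable_bounded_by_integrable_imp_absolutely_integrable[OF assms(2) _ H2_velocity_quadratic_integrable[OF assms(1)] assms(3)])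
     auto

lemma energy_density_bound:
  assumes "0 < m" "m \<le> norm v" "norm v \<le> K" "\<delta> \<ge> 0"
  shows "\<bar>energy_density \<delta> v w\<bar> \<le> 1 / m ^ 3 * (norm w)\<^sup>2 + 0 * norm w + \<delta> * K"
proof -
  have k: "0 < norm v" using assms by linarith
  have "(rot90 v \<bullet> w)\<^sup>2 \<le> (norm v * norm w)\<^sup>2"
    using Cauchy_Schwarz_ineq2[of "rot90 v" w] by (metis abs_ge_zero norm_rot90 power2_abs power_mono)
  then have "(rot90 v \<bullet> w)\<^sup>2 / norm v ^ 5 \<le> (norm v * norm w)\<^sup>2 / norm v ^ 5"
    by (intro divide_right_mono) auto
  also have "\<dots> = (norm w)\<^sup>2 / norm v ^ 3"
    using k by (simp add: field_simps power_numeral_reduce)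
  also have "\<dots> \<le> (norm w)\<^sup>2 / m ^ 3"
    using k assms by (intro divide_left_mono power_mono mult_pos_pos) auto
  finally have "(rot90 v \<bullet> w)\<^sup>2 / norm v ^ 5 \<le> (norm w)\<^sup>2 / m ^ 3" .
  moreover have "\<delta> * norm v \<le> \<delta> * K" using assms by (intro mult_left_mono)
  moreover have "0 \<le> (rot90 v \<bullet> w)\<^sup>2 / norm v ^ 5" "0 \<le> \<delta> * norm v" using assms(4) by auto
  ultimately show ?thesis unfolding energy_density_def by simp
qed

text \<open>
  Differentiation under the integral sign by dominated convergence. The Lipschitz bound provides the
  integrable majorant \<open>h\<close>, uniformly for \<open>t\<close> so small that the perturbed curves remain regular.
\<close>

lemma first_variation_density:
  fixes \<psi>' \<psi>'' :: "real \<Rightarrow> real^2"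
  assumes H2: "H2_velocity v w" and c: "continuous_on {0..1} \<psi>'" "continuous_on {0..1} \<psi>''" and \<delta>: "\<delta> \<ge> 0"
  shows "((\<lambda>t. integral {0..1} (\<lambda>x. energy_density \<delta> (v x + t *\<^sub>R \<psi>' x) (w x + t *\<^sub>R \<psi>'' x))) has_real_derivative
     integral {0..1} (\<lambda>x. energy_density_deriv \<delta> (v x) (w x) (\<psi>' x) (\<psi>'' x))) (at 0)"
    and "\<forall>\<^sub>F t in at 0. \<forall>x\<in>{0..1}. v x + t *\<^sub>R \<psi>' x \<noteq> 0"
proof -
  obtain m where m: "m > 0" "\<And>x. x \<in> {0..1} \<Longrightarrow> m \<le> norm (v x)"
    using H2_velocity_lower_bound[OF H2] by blast
  have cv: "continuous_on {0..1} v" using H2 primitive_continuous unfolding H2_velocity_def by auto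
  obtain K where K: "K > 0" "\<And>x. x \<in> {0..1} \<Longrightarrow> norm (v x) \<le> K" using continuous_bounded_I[OF cv] by blast
  obtain M1 where M1: "M1 > 0" "\<And>x. x \<in> {0..1} \<Longrightarrow> norm (\<psi>' x) \<le> M1" using continuous_bounded_I[OF c(1)] by blast
  obtain M2 where M2: "M2 > 0" "\<And>x. x \<in> {0..1} \<Longrightarrow> norm (\<psi>'' x) \<le> M2" using continuous_bounded_I[OF c(2)] by blast
  define M where "M = max M1 M2"
  have M: "M > 0" "\<And>x. x \<in> {0..1} \<Longrightarrow> norm (\<psi>' x) \<le> M" "\<And>x. x \<in> {0..1} \<Longrightarrow> norm (\<psi>'' x) \<le> M"
    using M1 M2 unfolding M_def by (auto simp: le_max_iff_disj)
  \<comment> \<open>Up to this time the speed stays above half of its initial lower bound \<open>m\<close>.\<close>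
  define t0 where "t0 = min 1 (m / (2 * M))"
  have t0: "t0 > 0" "t0 \<le> 1" using m M by (auto simp: t0_def)
  have low: "m / 2 \<le> norm (v x + s *\<^sub>R \<psi>' x)" if x: "x \<in> {0..1}" and s: "\<bar>s\<bar> \<le> t0" for x s
  proof -
    have "norm (s *\<^sub>R \<psi>' x) \<le> (m / (2 * M)) * M"
      unfolding norm_scaleR using s M(2)[OF x] M(1) m(1) by (intro mult_mono) (auto simp: t0_def)
    also have "\<dots> = m / 2" using M(1) by simp
    finally have "norm (s *\<^sub>R \<psi>' x) \<le> m / 2" .
    moreover have "norm (v x) \<le> norm (v x + s *\<^sub>R \<psi>' x) + norm (s *\<^sub>R \<psi>' x)"
      by (metis add_diff_cancel_right' norm_triangle_ineq4)
    ultimately show ?thesis using m(2)[OF x] by linarith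
  qed
  have "\<forall>\<^sub>F t in at (0::real). \<bar>t\<bar> < t0"
    using t0(1) by (auto simp: eventually_at dist_real_def intro!: exI[of _ t0])
  then show "\<forall>\<^sub>F t in at 0. \<forall>x\<in>{0..1}. v x + t *\<^sub>R \<psi>' x \<noteq> 0"
  proof eventually_elim
    case (elim t)
    have "v x + t *\<^sub>R \<psi>' x \<noteq> 0" if "x \<in> {0..1}" for x
      using low[OF that, of t] elim m(1) by auto
    then show ?case by blast
  qed
  note [measurable] = H2_velocity_measurable[OF H2] lebesgue_on_measurable_continuous[OF c(1)] lebesgue_on_measurable_continuous[OF c(2)]
  let ?f = "\<lambda>t x. energy_density \<delta> (v x + t *\<^sub>R \<psi>' x) (w x + t *\<^sub>R \<psi>'' x)"
  let ?g = "\<lambda>x. energy_density_deriv \<delta> (v x) (w x) (\<psi>' x) (\<psi>'' x)"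
  define h where "h x = 7 * M / (m/2) ^ 4 * (norm (w x) + M)\<^sup>2 + 2 * M / (m/2) ^ 3 * (norm (w x) + M) + \<delta> * M" for x
  have h: "h integrable_on {0..1}"
  proof -
    define \<alpha> \<beta> where "\<alpha> = 7 * M / (m/2) ^ 4" and "\<beta> = 2 * M / (m/2) ^ 3"
    have "h = (\<lambda>x. \<alpha> * (norm (w x))\<^sup>2 + (2 * \<alpha> * M + \<beta>) * norm (w x) + (\<alpha> * M\<^sup>2 + \<beta> * M + \<delta> * M))"
      unfolding h_def \<alpha>_def[symmetric] \<beta>_def[symmetric] by (auto simp: power2_eq_square algebra_simps)
    then show ?thesis using H2_velocity_quadratic_integrable[OF H2] by simp
  qed
  have bound: "\<bar>?f t x - ?f 0 x\<bar> \<le> h x * \<bar>t\<bar>" if "x \<in> {0..1}" "\<bar>t\<bar> \<le> t0" for t x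
    using energy_density_lipschitz[of "m/2" t "v x" "\<psi>' x" M "\<psi>'' x" \<delta> "w x"] low[OF that(1)] m M that t0 \<delta>
    by (simp add: h_def)
  have int0: "?f 0 integrable_on {0..1}"
  proof -
    have "(\<lambda>x. energy_density \<delta> (v x) (w x)) absolutely_integrable_on {0..1}"
    proof (rule H2_velocity_absolutely_integrable[OF H2])
      show "norm (energy_density \<delta> (v x) (w x)) \<le> 1 / m ^ 3 * (norm (w x))\<^sup>2 + 0 * norm (w x) + \<delta> * K" if "x \<in> {0..1}" for x
        unfolding real_norm_def by (rule energy_density_bound) (use m K \<delta> that in auto)
    qed measurable
    then show ?thesis by (simp add: absolutely_integrable_on_def)
  qed
  have intd: "(\<lambda>x. ?f t x - ?f 0 x) integrable_on {0..1}" if "\<bar>t\<bar> \<le> t0" for t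
  proof (rule measurable_bounded_by_integrable_imp_integrable)
    show "(\<lambda>x. ?f t x - ?f 0 x) \<in> borel_measurable (lebesgue_on {0..1})" by measurable
    show "(\<lambda>x. h x * \<bar>t\<bar>) integrable_on {0..1}" using h by (rule integrable_on_mult_left)
  qed (use bound that in auto)
  have intt: "?f t integrable_on {0..1}" if "\<bar>t\<bar> \<le> t0" for t
    using integrable_add[OF intd[OF that] int0] by simp
  have "((\<lambda>t. (integral {0..1} (?f t) - integral {0..1} (?f 0)) / t) \<longlongrightarrow> integral {0..1} ?g) (at 0)"
    unfolding tendsto_at_iff_sequentially
  proof (intro allI impI)
    fix X :: "nat \<Rightarrow> real" assume X0: "\<forall>i. X i \<in> UNIV - {0}" and X: "X \<longlonglongrightarrow> 0"
    obtain n0 where n0: "\<And>n. n \<ge> n0 \<Longrightarrow> \<bar>X n\<bar> < t0" using LIMSEQ_D[OF X t0(1)] by auto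
    define Y where "Y n = X (n + n0)" for n
    have Y: "Y n \<noteq> 0" "\<bar>Y n\<bar> \<le> t0" for n using X0 n0[of "n + n0"] by (auto simp: Y_def)
    have Ylim: "Y \<longlonglongrightarrow> 0" unfolding Y_def using LIMSEQ_ignore_initial_segment[OF X] .
    have "(\<lambda>n. integral {0..1} (\<lambda>x. (?f (Y n) x - ?f 0 x) / Y n)) \<longlonglongrightarrow> integral {0..1} ?g"
    proof (rule dominated_convergence(2))
      show "(\<lambda>x. (?f (Y n) x - ?f 0 x) / Y n) integrable_on {0..1}" for n
        unfolding divide_inverse by (rule integrable_on_mult_left[OF intd[OF Y(2)]])
      show "norm ((?f (Y n) x - ?f 0 x) / Y n) \<le> h x" if "x \<in> {0..1}" for n x
        using bound[OF that Y(2)[of n]] Y(1)[of n] by (simp add: abs_divide divide_le_eq)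
      show "(\<lambda>n. (?f (Y n) x - ?f 0 x) / Y n) \<longlonglongrightarrow> ?g x" if x: "x \<in> {0..1}" for x
      proof -
        have "v x + 0 *\<^sub>R \<psi>' x \<noteq> 0" using m x by fastforce
        from energy_density_has_derivative[OF this, of \<delta> "w x" "\<psi>'' x"]
        have "((\<lambda>t. (?f t x - ?f 0 x) / (t - 0)) \<longlongrightarrow> ?g x) (at 0)"
          unfolding has_field_derivative_iff by simp
        then show ?thesis unfolding tendsto_at_iff_sequentially using Y(1) Ylim by (auto simp: o_def)
      qed
    qed (rule h)
    moreover have "integral {0..1} (\<lambda>x. (?f (Y n) x - ?f 0 x) / Y n) = (integral {0..1} (?f (Y n)) - integral {0..1} (?f 0)) / Y n" for n
      using integral_diff[OF intt[OF Y(2)] int0] by simp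
    ultimately have "(\<lambda>n. (integral {0..1} (?f (Y n)) - integral {0..1} (?f 0)) / Y n) \<longlonglongrightarrow> integral {0..1} ?g" by (simp only:)
    then show "((\<lambda>t. (integral {0..1} (?f t) - integral {0..1} (?f 0)) / t) \<circ> X) \<longlonglongrightarrow> integral {0..1} ?g"
      unfolding Y_def o_def by (rule LIMSEQ_offset)
  qed
  then show "((\<lambda>t. integral {0..1} (?f t)) has_real_derivative integral {0..1} ?g) (at 0)"
    by (simp add: has_field_derivative_iff)
qed

section \<open>Critical curves are elastica\<close>

text \<open>
  The elastica equation as a first order system for the unit tangent \<open>T\<close> and the curvature \<open>\<kappa>\<close> along a
  parametrization of speed \<open>r\<close>. The vector \<open>b\<close> is the conserved force
  \<open>2 \<kappa>' \<nu> + \<kappa>\<^sup>2 T - \<delta> T\<close> (arclength derivative, \<open>\<nu>\<close> the unit normal): its normal component is the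
  equation for \<open>\<kappa>\<close>, its tangential component the algebraic relation. This form makes sense for every
  \<open>C\<^sup>1\<close> parametrization and is polynomial in \<open>(T, \<kappa>)\<close> when \<open>r\<close> is constant.
\<close>

definition elastica :: "real \<Rightarrow> (real \<Rightarrow> real) \<Rightarrow> (real \<Rightarrow> real^2) \<Rightarrow> (real \<Rightarrow> real) \<Rightarrow> real^2 \<Rightarrow> bool" where
  "elastica \<delta> r T \<kappa> b \<longleftrightarrow> (\<forall>x\<in>{0..1}. r x > 0 \<and> norm (T x) = 1 \<and>
     (T has_vector_derivative (r x * \<kappa> x) *\<^sub>R rot90 (T x)) (at x within {0..1}) \<and>
     (\<kappa> has_vector_derivative r x * (b \<bullet> rot90 (T x)) / 2) (at x within {0..1}) \<and>
     b \<bullet> T x = (\<kappa> x)\<^sup>2 - \<delta>)"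

lemma primitive_norm:
  fixes v w :: "real \<Rightarrow> real^2"
  assumes "primitive v w" "\<And>x. x \<in> {0..1} \<Longrightarrow> v x \<noteq> 0"
  shows "primitive (\<lambda>x. norm (v x)) (\<lambda>x. v x \<bullet> w x / norm (v x))"
proof -
  have p2: "primitive (\<lambda>x. v x \<bullet> v x) (\<lambda>x. v x \<bullet> w x + w x \<bullet> v x)"
    by (rule primitive_bilinear[OF bounded_bilinear_inner assms(1) assms(1)])
  have "primitive (\<lambda>x. sqrt (v x \<bullet> v x)) (\<lambda>x. inverse (sqrt (v x \<bullet> v x)) / 2 * (v x \<bullet> w x + w x \<bullet> v x))"
  proof (rule primitive_chain_real[OF p2, where U = "{0<..}"])
    show "continuous_on {0<..} (\<lambda>x::real. inverse (sqrt x) / 2)"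
      by (intro continuous_intros) auto
  qed (use assms(2) DERIV_real_sqrt in auto)
  moreover have "inverse (sqrt (v x \<bullet> v x)) / 2 * (v x \<bullet> w x + w x \<bullet> v x) = v x \<bullet> w x / norm (v x)" for x
    unfolding norm_eq_sqrt_inner[symmetric] inner_commute[of "w x"] by (simp add: inverse_eq_divide)
  ultimately show ?thesis unfolding norm_eq_sqrt_inner[symmetric] by simp
qed

lemma primitive_normalized:
  fixes v w :: "real \<Rightarrow> real^2"
  assumes "primitive v w" "\<And>x. x \<in> {0..1} \<Longrightarrow> v x \<noteq> 0"
  shows "primitive (\<lambda>x. v x /\<^sub>R norm (v x)) (\<lambda>x. (rot90 (v x) \<bullet> w x / norm (v x) ^ 3) *\<^sub>R rot90 (v x))"
proof -
  have "primitive (\<lambda>x. inverse (norm (v x))) (\<lambda>x. - (inverse (norm (v x)))\<^sup>2 * (v x \<bullet> w x / norm (v x)))"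
  proof (rule primitive_chain_real[OF primitive_norm[OF assms], where U = "{0<..}"])
    show "(inverse has_real_derivative - (inverse y)\<^sup>2) (at y)" if "y \<in> {0<..}" for y :: real
      using that DERIV_inverse[of y] by (simp add: power2_eq_square numeral_2_eq_2)
    show "continuous_on {0<..} (\<lambda>x::real. - (inverse x)\<^sup>2)" by (intro continuous_intros) auto
  qed (use assms(2) in auto)
  from primitive_bilinear[OF bounded_bilinear_scaleR this assms(1)]
  have "primitive (\<lambda>x. v x /\<^sub>R norm (v x)) (\<lambda>x. inverse (norm (v x)) *\<^sub>R w x +
     (- (inverse (norm (v x)))\<^sup>2 * (v x \<bullet> w x / norm (v x))) *\<^sub>R v x)" .
  then show ?thesis
  proof (rule primitive_spike[where S = "{}"])
    fix x :: real assume "x \<in> {0..1} - {}"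
    then have "norm (v x) > 0" using assms(2) by auto
    then have "(1 / norm (v x) ^ 3) *\<^sub>R ((v x \<bullet> v x) *\<^sub>R w x - (v x \<bullet> w x) *\<^sub>R v x) =
      inverse (norm (v x)) *\<^sub>R w x + (- (inverse (norm (v x)))\<^sup>2 * (v x \<bullet> w x / norm (v x))) *\<^sub>R v x"
      by (simp add: scaleR_diff_right dot_square_norm field_simps power2_eq_square power3_eq_cube)
    then show "(rot90 (v x) \<bullet> w x / norm (v x) ^ 3) *\<^sub>R rot90 (v x) =
      inverse (norm (v x)) *\<^sub>R w x + (- (inverse (norm (v x)))\<^sup>2 * (v x \<bullet> w x / norm (v x))) *\<^sub>R v x"
      by (simp flip: rot90_decomposition)
  qed simp
qed

text \<open>
  The coefficients of \<open>\<psi>''\<close> and \<open>\<psi>'\<close> in the first variation. In terms of unit tangent \<open>\<tau>\<close>, unit normal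
  \<open>\<nu>\<close> and curvature \<open>k\<close> the first is \<open>2 k \<nu> / norm v\<close>.
\<close>

definition bending_flux :: "real^2 \<Rightarrow> real^2 \<Rightarrow> real^2" where
  "bending_flux v w = (2 * (rot90 v \<bullet> w) / norm v ^ 5) *\<^sub>R rot90 v"

definition stretching_flux :: "real \<Rightarrow> real^2 \<Rightarrow> real^2 \<Rightarrow> real^2" where
  "stretching_flux \<delta> v w = (- (2 * (rot90 v \<bullet> w) / norm v ^ 5)) *\<^sub>R rot90 w
     + (\<delta> / norm v - 5 * (rot90 v \<bullet> w)\<^sup>2 / norm v ^ 7) *\<^sub>R v"

lemma energy_density_deriv_flux:
  "energy_density_deriv \<delta> v w a b = bending_flux v w \<bullet> b + stretching_flux \<delta> v w \<bullet> a"
proof -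
  have 1: "rot90 a \<bullet> w = - (rot90 w \<bullet> a)" by (simp add: inner_vec2)
  show ?thesis
    unfolding energy_density_deriv_def bending_flux_def stretching_flux_def 1 inner_add_left inner_scaleR_left
    by (simp add: diff_divide_distrib algebra_simps)
qed

lemma flux_measurable [measurable]:
  assumes [measurable]: "V \<in> borel_measurable N" "W \<in> borel_measurable N"
  shows "(\<lambda>x. bending_flux (V x) (W x)) \<in> borel_measurable N"
    "(\<lambda>x. stretching_flux \<delta> (V x) (W x)) \<in> borel_measurable N"
  unfolding bending_flux_def stretching_flux_def by measurable

lemma norm_flux_le:
  assumes "0 < m" "m \<le> norm v" "\<delta> \<ge> 0"
  shows "norm (bending_flux v w) \<le> 2 / m ^ 3 * norm w"
    and "norm (stretching_flux \<delta> v w) \<le> 7 / m ^ 4 * (norm w)\<^sup>2 + \<delta>"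
proof -
  define k where "k = norm v"
  have k: "0 < k" "m \<le> k" using assms by (auto simp: k_def)
  have cs: "\<bar>rot90 v \<bullet> w\<bar> \<le> k * norm w" using Cauchy_Schwarz_ineq2[of "rot90 v" w] by (simp add: k_def)
  have "norm (bending_flux v w) = 2 * \<bar>rot90 v \<bullet> w\<bar> / k ^ 5 * k"
    by (simp add: bending_flux_def k_def abs_mult)
  also have "\<dots> \<le> 2 * (k * norm w) / k ^ 5 * k"
    using cs k by (intro mult_right_mono divide_right_mono mult_left_mono) auto
  also have "\<dots> = 2 * norm w / k ^ 3" using k by (simp add: field_simps power_numeral_reduce)
  also have "\<dots> \<le> 2 * norm w / m ^ 3"
    using k assms by (intro divide_left_mono power_mono mult_pos_pos) auto
  finally show "norm (bending_flux v w) \<le> 2 / m ^ 3 * norm w" by simp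
  have 1: "norm ((- (2 * (rot90 v \<bullet> w) / norm v ^ 5)) *\<^sub>R rot90 w) \<le> 2 / m ^ 4 * (norm w)\<^sup>2"
  proof -
    have "norm ((- (2 * (rot90 v \<bullet> w) / norm v ^ 5)) *\<^sub>R rot90 w) = 2 * \<bar>rot90 v \<bullet> w\<bar> / k ^ 5 * norm w"
      by (simp add: k_def abs_mult)
    also have "\<dots> \<le> 2 * (k * norm w) / k ^ 5 * norm w"
      using cs k by (intro mult_right_mono divide_right_mono mult_left_mono) auto
    also have "\<dots> = 2 * (norm w)\<^sup>2 / k ^ 4" using k by (simp add: field_simps power_numeral_reduce)
    also have "\<dots> \<le> 2 * (norm w)\<^sup>2 / m ^ 4"
      using k assms by (intro divide_left_mono power_mono mult_pos_pos) auto
    finally show ?thesis by simp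
  qed
  have 2: "norm ((\<delta> / norm v - 5 * (rot90 v \<bullet> w)\<^sup>2 / norm v ^ 7) *\<^sub>R v) \<le> \<delta> + 5 / m ^ 4 * (norm w)\<^sup>2"
  proof -
    have "norm ((\<delta> / norm v - 5 * (rot90 v \<bullet> w)\<^sup>2 / norm v ^ 7) *\<^sub>R v) = \<bar>\<delta> / k - 5 * (rot90 v \<bullet> w)\<^sup>2 / k ^ 7\<bar> * k"
      by (simp add: k_def)
    also have "\<dots> \<le> (\<delta> / k + 5 * \<bar>rot90 v \<bullet> w\<bar>\<^sup>2 / k ^ 7) * k"
      using k assms(3) by (intro mult_right_mono order_trans[OF abs_triangle_ineq4]) auto
    also have "\<dots> \<le> (\<delta> / k + 5 * (k * norm w)\<^sup>2 / k ^ 7) * k"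
      using k cs by (intro mult_right_mono add_left_mono divide_right_mono mult_left_mono power_mono) auto
    also have "\<dots> = \<delta> + 5 * (norm w)\<^sup>2 / k ^ 4" using k by (simp add: field_simps power_numeral_reduce)
    also have "\<dots> \<le> \<delta> + 5 * (norm w)\<^sup>2 / m ^ 4"
      using k assms by (intro add_left_mono divide_left_mono power_mono mult_pos_pos) auto
    finally show ?thesis by simp
  qed
  show "norm (stretching_flux \<delta> v w) \<le> 7 / m ^ 4 * (norm w)\<^sup>2 + \<delta>"
    unfolding stretching_flux_def using norm_triangle_le[OF add_mono[OF 1 2]] by (simp add: field_simps)
qed

lemma flux_integrable:
  assumes H2: "H2_velocity v w" and "\<delta> \<ge> 0"
  shows "(\<lambda>x. bending_flux (v x) (w x)) absolutely_integrable_on {0..1}"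
    and "(\<lambda>x. stretching_flux \<delta> (v x) (w x)) absolutely_integrable_on {0..1}"
proof -
  obtain m where m: "m > 0" "\<And>x. x \<in> {0..1} \<Longrightarrow> m \<le> norm (v x)"
    using H2_velocity_lower_bound[OF H2] by blast
  note [measurable] = H2_velocity_measurable[OF H2]
  show "(\<lambda>x. bending_flux (v x) (w x)) absolutely_integrable_on {0..1}"
  proof (rule H2_velocity_absolutely_integrable[OF H2, of _ 0 "2 / m ^ 3" 0])
    fix x :: real assume "x \<in> {0..1}"
    from norm_flux_le(1)[OF m(1) m(2)[OF this] assms(2), of "w x"]
    show "norm (bending_flux (v x) (w x)) \<le> 0 * (norm (w x))\<^sup>2 + 2 / m ^ 3 * norm (w x) + 0" by simp
  qed measurable
  show "(\<lambda>x. stretching_flux \<delta> (v x) (w x)) absolutely_integrable_on {0..1}"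
  proof (rule H2_velocity_absolutely_integrable[OF H2, of _ "7 / m ^ 4" 0 \<delta>])
    fix x :: real assume "x \<in> {0..1}"
    from norm_flux_le(2)[OF m(1) m(2)[OF this] assms(2), of "w x"]
    show "norm (stretching_flux \<delta> (v x) (w x)) \<le> 7 / m ^ 4 * (norm (w x))\<^sup>2 + 0 * norm (w x) + \<delta>" by simp
  qed measurable
qed

text \<open>
  The weak Euler-Lagrange equation, tested only with fields that vanish to first order at both ends:
  these are admissible whatever is prescribed at the junctions.
\<close>

definition H2_critical :: "real \<Rightarrow> (real \<Rightarrow> real^2) \<Rightarrow> (real \<Rightarrow> real^2) \<Rightarrow> bool" where
  "H2_critical \<delta> v w \<longleftrightarrow> (\<forall>\<psi> \<psi>' \<psi>''. smooth_I \<psi>'' \<longrightarrow>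
      (\<forall>x\<in>{0..1}. (\<psi> has_vector_derivative \<psi>' x) (at x within {0..1})) \<longrightarrow>
      (\<forall>x\<in>{0..1}. (\<psi>' has_vector_derivative \<psi>'' x) (at x within {0..1})) \<longrightarrow>
      \<psi> 0 = 0 \<longrightarrow> \<psi> 1 = 0 \<longrightarrow> \<psi>' 0 = 0 \<longrightarrow> \<psi>' 1 = 0 \<longrightarrow>
      integral {0..1} (\<lambda>x. energy_density_deriv \<delta> (v x) (w x) (\<psi>' x) (\<psi>'' x)) = 0)"

text \<open>
  The second order fundamental lemma, applied to each component: the bending flux agrees almost
  everywhere with a primitive of \<open>b\<close> plus the stretching flux.
\<close>

lemma H2_critical_flux_balance:
  assumes H2: "H2_velocity v w" and "\<delta> \<ge> 0" and crit: "H2_critical \<delta> v w"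
  obtains a b :: "real^2" and S where "negligible S"
    "\<forall>x\<in>{0..1} - S.
      bending_flux (v x) (w x) = a + x *\<^sub>R b + integral {0..x} (\<lambda>x. stretching_flux \<delta> (v x) (w x))"
proof -
  let ?P = "\<lambda>x. bending_flux (v x) (w x)" and ?Q = "\<lambda>x. stretching_flux \<delta> (v x) (w x)"
  have P: "?P integrable_on {0..1}" and Q: "?Q integrable_on {0..1}"
    using flux_integrable[OF H2 assms(2)] by (simp_all add: absolutely_integrable_on_def)
  have "\<exists>a b S. negligible S \<and> (\<forall>x\<in>{0..1} - S. ?P x $ i = a + b * x + integral {0..x} ?Q $ i)" for i
  proof -
    have Pi: "(\<lambda>x. ?P x $ i) integrable_on {0..1}" and Qi: "(\<lambda>x. ?Q x $ i) integrable_on {0..1}"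
      using integrable_component[OF P, of "axis i 1"] integrable_component[OF Q, of "axis i 1"] by (simp_all add: inner_axis)
    obtain a b S where abS: "negligible S" "\<And>x. x \<in> {0..1} - S \<Longrightarrow> ?P x $ i = a + b * x + integral {0..x} (\<lambda>x. ?Q x $ i)"
    proof (rule du_Bois_Reymond_second_order[OF Pi Qi])
      fix \<psi> \<psi>' \<psi>'' :: "real \<Rightarrow> real"
      assume s: "smooth_I \<psi>''"
        and d: "\<And>x. x \<in> {0..1} \<Longrightarrow> (\<psi> has_vector_derivative \<psi>' x) (at x within {0..1})"
          "\<And>x. x \<in> {0..1} \<Longrightarrow> (\<psi>' has_vector_derivative \<psi>'' x) (at x within {0..1})"
        and z: "\<psi> 0 = 0" "\<psi> 1 = 0" "\<psi>' 0 = 0" "\<psi>' 1 = 0"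
      let ?e = "axis i 1 :: real^2"
      have d': "((\<lambda>x. f x *\<^sub>R ?e) has_vector_derivative f' *\<^sub>R ?e) (at x within {0..1})"
        if "(f has_vector_derivative f') (at x within {0..1})" for f f' x
        using has_vector_derivative_scaleR[OF that[folded has_real_derivative_iff_has_vector_derivative] has_vector_derivative_const[of ?e]] by simp
      have "integral {0..1} (\<lambda>x. energy_density_deriv \<delta> (v x) (w x) (\<psi>' x *\<^sub>R ?e) (\<psi>'' x *\<^sub>R ?e)) = 0"
        using crit[unfolded H2_critical_def, rule_format, of "\<lambda>x. \<psi>'' x *\<^sub>R ?e" "\<lambda>x. \<psi> x *\<^sub>R ?e" "\<lambda>x. \<psi>' x *\<^sub>R ?e"]
          smooth_I_scaleR_const[OF s, of ?e] d d' z by simp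
      then show "integral {0..1} (\<lambda>x. ?P x $ i * \<psi>'' x + ?Q x $ i * \<psi>' x) = 0"
        by (simp add: energy_density_deriv_flux inner_axis mult.commute)
    qed blast
    have "integral {0..x} (\<lambda>x. ?Q x $ i) = integral {0..x} ?Q $ i" if "x \<in> {0..1}" for x
    proof -
      have "?Q integrable_on {0..x}" using integrable_on_subinterval[OF Q, of 0 x] that by auto
      from integral_component_eq[OF this, of "axis i 1"] show ?thesis by (simp add: inner_axis)
    qed
    then show ?thesis using abS by (intro exI[of _ a] exI[of _ b] exI[of _ S]) auto
  qed
  then obtain a b S where abS: "\<And>i::2. negligible (S i)"
    "\<And>i x. x \<in> {0..1} - S i \<Longrightarrow> ?P x $ i = a i + b i * x + integral {0..x} ?Q $ i" by metis
  show thesis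
  proof (rule that[of "S 1 \<union> S 2" "\<chi> i. a i" "\<chi> i. b i"])
    show "negligible (S 1 \<union> S 2)" by (intro negligible_Un abS(1))
    show "\<forall>x\<in>{0..1} - (S 1 \<union> S 2). ?P x = (\<chi> i. a i) + x *\<^sub>R (\<chi> i. b i) + integral {0..x} ?Q"
    proof
      fix x assume "x \<in> {0..1} - (S 1 \<union> S 2)"
      then have x: "x \<in> {0..1} - S 1" "x \<in> {0..1} - S 2" by auto
      show "?P x = (\<chi> i. a i) + x *\<^sub>R (\<chi> i. b i) + integral {0..x} ?Q"
        unfolding vec2_eq_iff using abS(2)[OF x(1)] abS(2)[OF x(2)] by (simp add: mult.commute)
    qed
  qed
qed

text \<open>
  The stretching flux contains the tangential acceleration, which depends on the parametrization. It
  cancels when the bending flux is multiplied by the speed \<open>norm v\<close> and differentiated.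
\<close>

lemma first_integral_identity:
  assumes "v \<noteq> 0"
  shows "norm v *\<^sub>R stretching_flux \<delta> v w + (v \<bullet> w / norm v) *\<^sub>R bending_flux v w
    = (\<delta> - 3 * (rot90 v \<bullet> w / norm v ^ 3)\<^sup>2) *\<^sub>R v"
proof -
  define n c d where "n = norm v" and "c = rot90 v \<bullet> w" and "d = v \<bullet> w"
  have n: "n > 0" using assms by (simp add: n_def)
  have "rot90 (c *\<^sub>R rot90 v) = rot90 (n\<^sup>2 *\<^sub>R w - d *\<^sub>R v)"
    unfolding c_def d_def rot90_decomposition by (simp add: n_def dot_square_norm)
  then have "n\<^sup>2 *\<^sub>R rot90 w = d *\<^sub>R rot90 v - c *\<^sub>R v" by (simp add: rot90_linear algebra_simps)
  then have "(1 / n\<^sup>2) *\<^sub>R n\<^sup>2 *\<^sub>R rot90 w = (1 / n\<^sup>2) *\<^sub>R (d *\<^sub>R rot90 v - c *\<^sub>R v)" by simp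
  then have Jw: "rot90 w = (d / n\<^sup>2) *\<^sub>R rot90 v - (c / n\<^sup>2) *\<^sub>R v"
    using n by (simp add: scaleR_diff_right)
  have gen: "n *\<^sub>R ((- \<alpha>) *\<^sub>R (\<rho> *\<^sub>R X - \<sigma> *\<^sub>R Y) + \<beta> *\<^sub>R Y) + \<mu> *\<^sub>R (\<alpha> *\<^sub>R X)
      = (n * (- \<alpha>) * \<rho> + \<mu> * \<alpha>) *\<^sub>R X + (n * \<alpha> * \<sigma> + n * \<beta>) *\<^sub>R Y"
    for \<alpha> \<beta> \<rho> \<sigma> \<mu> :: real and X Y :: "real^2"
    by (simp add: algebra_simps)
  have "n *\<^sub>R ((- (2 * c / n ^ 5)) *\<^sub>R rot90 w + (\<delta> / n - 5 * c\<^sup>2 / n ^ 7) *\<^sub>R v) + (d / n) *\<^sub>R ((2 * c / n ^ 5) *\<^sub>R rot90 v)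
     = (n * (- (2 * c / n ^ 5)) * (d / n\<^sup>2) + d / n * (2 * c / n ^ 5)) *\<^sub>R rot90 v +
       (n * (2 * c / n ^ 5) * (c / n\<^sup>2) + n * (\<delta> / n - 5 * c\<^sup>2 / n ^ 7)) *\<^sub>R v"
    unfolding Jw by (rule gen)
  moreover have "n * (- (2 * c / n ^ 5)) * (d / n\<^sup>2) + d / n * (2 * c / n ^ 5) = 0"
    using n by (simp add: field_simps power_numeral_reduce)
  moreover have "n * (2 * c / n ^ 5) * (c / n\<^sup>2) + n * (\<delta> / n - 5 * c\<^sup>2 / n ^ 7) = \<delta> - 3 * (c / n ^ 3)\<^sup>2"
    using n by (simp add: field_simps power_numeral_reduce)
  ultimately show ?thesis
    unfolding stretching_flux_def bending_flux_def c_def[symmetric] d_def[symmetric] n_def[symmetric] by simp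
qed


text \<open>
  The gain of regularity. The field \<open>V = norm v *\<^sub>R bending_flux = 2 \<kappa> \<nu>\<close> has the primitive representation
  \<open>V' = (\<delta> - 3 \<kappa>\<^sup>2) v + norm v *\<^sub>R b\<close>, whose right-hand side is continuous because \<open>V\<close> itself is. So \<open>V\<close>
  and \<open>T\<close>, and with them \<open>\<kappa> = (V \<bullet> \<nu>) / 2\<close>, are \<open>C\<^sup>1\<close>; the normal part of \<open>V'\<close> is the equation for
  \<open>\<kappa>\<close>, and \<open>V \<bullet> T = 0\<close> differentiated is the relation between \<open>b \<bullet> T\<close> and \<open>\<kappa>\<close>. With the weak equation
  solved, integration by parts reduces the first variation to its boundary terms.
\<close>

lemma H2_critical_imp_elastica:
  assumes H2: "H2_velocity v w" and \<delta>: "\<delta> \<ge> 0" and crit: "H2_critical \<delta> v w"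
  defines "T \<equiv> \<lambda>x. v x /\<^sub>R norm (v x)"
  obtains \<kappa> b where "elastica \<delta> (\<lambda>x. norm (v x)) T \<kappa> b"
    and "\<And>\<psi> \<psi>' \<psi>''. \<lbrakk>continuous_on {0..1} \<psi>'';
      \<And>x. x \<in> {0..1} \<Longrightarrow> (\<psi> has_vector_derivative \<psi>' x) (at x within {0..1});
      \<And>x. x \<in> {0..1} \<Longrightarrow> (\<psi>' has_vector_derivative \<psi>'' x) (at x within {0..1})\<rbrakk> \<Longrightarrow>
      integral {0..1} (\<lambda>x. energy_density_deriv \<delta> (v x) (w x) (\<psi>' x) (\<psi>'' x)) =
        ((2 * \<kappa> 1 / norm (v 1)) * (rot90 (T 1) \<bullet> \<psi>' 1) - b \<bullet> \<psi> 1)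
        - ((2 * \<kappa> 0 / norm (v 0)) * (rot90 (T 0) \<bullet> \<psi>' 0) - b \<bullet> \<psi> 0)"
proof -
  let ?P = "\<lambda>x. bending_flux (v x) (w x)" and ?Q = "\<lambda>x. stretching_flux \<delta> (v x) (w x)"
  have prim_v: "primitive v w" and nz: "\<And>x. x \<in> {0..1} \<Longrightarrow> v x \<noteq> 0"
    using H2 by (auto simp: H2_velocity_def)
  have pos: "\<And>x. x \<in> {0..1} \<Longrightarrow> norm (v x) > 0" using nz by simp
  have cv: "continuous_on {0..1} v" by (rule primitive_continuous[OF prim_v])
  obtain a b S where S: "negligible S"
    and P: "\<forall>x\<in>{0..1} - S. ?P x = a + x *\<^sub>R b + integral {0..x} ?Q"
    by (rule H2_critical_flux_balance[OF H2 \<delta> crit]) (rule that)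
  \<comment> \<open>The continuous representative of the bending flux.\<close>
  define p where "p x = (a + x *\<^sub>R b) + (0 + integral {0..x} ?Q)" for x
  have p_eq: "p x = ?P x" if "x \<in> {0..1} - S" for x using bspec[OF P that] by (simp add: p_def)
  have prim_p: "primitive p (\<lambda>x. b + ?Q x)"
    unfolding p_def
  proof (intro primitive_add primitive_integral primitive_deriv)
    show "?Q integrable_on {0..1}" using flux_integrable(2)[OF H2 \<delta>] by (simp add: absolutely_integrable_on_def)
  qed (auto intro!: derivative_eq_intros)
  define V where "V x = norm (v x) *\<^sub>R p x" for x
  have prim_n: "primitive (\<lambda>x. norm (v x)) (\<lambda>x. v x \<bullet> w x / norm (v x))"
    by (rule primitive_norm[OF prim_v nz])
  have prim_V: "primitive V (\<lambda>x. norm (v x) *\<^sub>R (b + ?Q x) + (v x \<bullet> w x / norm (v x)) *\<^sub>R p x)"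
    unfolding V_def by (rule primitive_bilinear[OF bounded_bilinear_scaleR prim_n prim_p])
  have prim_T: "primitive T (\<lambda>x. (rot90 (v x) \<bullet> w x / norm (v x) ^ 3) *\<^sub>R rot90 (v x))"
    unfolding T_def by (rule primitive_normalized[OF prim_v nz])
  have cV: "continuous_on {0..1} V" and cT: "continuous_on {0..1} T"
    using prim_V prim_T by (auto intro: primitive_continuous)
  have cJ: "continuous_on {0..1} (\<lambda>x. rot90 (f x))" if "continuous_on {0..1} f" for f :: "real \<Rightarrow> real^2"
    using bounded_linear.continuous_on[OF bounded_linear_rot90 that] .
  define \<kappa> where "\<kappa> x = (V x \<bullet> rot90 (T x)) / 2" for x
  have c\<kappa>: "continuous_on {0..1} \<kappa>" unfolding \<kappa>_def by (intro continuous_intros cV cT cJ) auto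
  have nT: "norm (T x) = 1" if "x \<in> {0..1}" for x using nz[OF that] by (simp add: T_def)
  have vT: "v x = norm (v x) *\<^sub>R T x" if "x \<in> {0..1}" for x using nz[OF that] by (simp add: T_def)
  have \<kappa>_eq: "\<kappa> x = rot90 (v x) \<bullet> w x / norm (v x) ^ 3" if "x \<in> {0..1} - S" for x
  proof -
    have n: "norm (v x) > 0" using pos that by blast
    have "\<kappa> x = (norm (v x) * (2 * (rot90 (v x) \<bullet> w x) / norm (v x) ^ 5)) * ((rot90 (v x) \<bullet> rot90 (v x)) / norm (v x)) / 2"
      unfolding \<kappa>_def V_def p_eq[OF that] bending_flux_def T_def by (simp add: rot90_linear inverse_eq_divide)
    also have "\<dots> = rot90 (v x) \<bullet> w x / norm (v x) ^ 3"
      using n unfolding rot90_inner dot_square_norm by (simp add: field_simps power_numeral_reduce)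
    finally show ?thesis .
  qed
  \<comment> \<open>The relation holds off \<open>S\<close> by the form of the bending flux, and everywhere by continuity.\<close>
  have VT: "V x \<bullet> T x = 0" if "x \<in> {0..1}" for x
  proof (rule continuous_ae_zero_imp_zero[OF _ S _ that])
    show "continuous_on {0..1} (\<lambda>x. V x \<bullet> T x)" by (intro continuous_intros cV cT)
    show "V x \<bullet> T x = 0" if "x \<in> {0..1} - S" for x
      by (simp add: V_def p_eq[OF that] bending_flux_def T_def)
  qed
  have V_eq: "V x = (2 * \<kappa> x) *\<^sub>R rot90 (T x)" if "x \<in> {0..1}" for x
    using frame_expansion[OF nT[OF that], of "V x"] VT[OF that] by (simp add: \<kappa>_def)
  have dT: "(T has_vector_derivative (norm (v x) * \<kappa> x) *\<^sub>R rot90 (T x)) (at x within {0..1})" if "x \<in> {0..1}" for x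
  proof (rule primitive_continuous_imp_deriv[OF primitive_spike[OF prim_T S] _ that])
    show "continuous_on {0..1} (\<lambda>x. (norm (v x) * \<kappa> x) *\<^sub>R rot90 (T x))"
      by (intro continuous_intros cv c\<kappa> cT cJ)
    fix x assume x: "x \<in> {0..1} - S"
    have "norm (v x) > 0" using pos x by blast
    then show "(norm (v x) * \<kappa> x) *\<^sub>R rot90 (T x) = (rot90 (v x) \<bullet> w x / norm (v x) ^ 3) *\<^sub>R rot90 (v x)"
      unfolding \<kappa>_eq[OF x] T_def by (simp add: rot90_linear)
  qed
  define V' where "V' x = (\<delta> - 3 * (\<kappa> x)\<^sup>2) *\<^sub>R v x + norm (v x) *\<^sub>R b" for x
  have dV: "(V has_vector_derivative V' x) (at x within {0..1})" if "x \<in> {0..1}" for x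
  proof (rule primitive_continuous_imp_deriv[OF primitive_spike[OF prim_V S] _ that])
    show "continuous_on {0..1} V'" unfolding V'_def by (intro continuous_intros cv c\<kappa>)
    fix x assume x: "x \<in> {0..1} - S"
    have "V' x = (norm (v x) *\<^sub>R ?Q x + (v x \<bullet> w x / norm (v x)) *\<^sub>R ?P x) + norm (v x) *\<^sub>R b"
      unfolding V'_def \<kappa>_eq[OF x] using first_integral_identity[of "v x" \<delta> "w x"] nz x by simp
    then show "V' x = norm (v x) *\<^sub>R (b + ?Q x) + (v x \<bullet> w x / norm (v x)) *\<^sub>R p x"
      by (simp add: p_eq[OF x] scaleR_add_right)
  qed
  have JT: "rot90 (T x) \<bullet> rot90 (T x) = 1" "T x \<bullet> T x = 1" if "x \<in> {0..1}" for x
    using nT[OF that] by (simp_all add: dot_square_norm)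
  have d\<kappa>: "(\<kappa> has_vector_derivative norm (v x) * (b \<bullet> rot90 (T x)) / 2) (at x within {0..1})" if x: "x \<in> {0..1}" for x
  proof -
    have "((\<lambda>x. V x \<bullet> rot90 (T x)) has_vector_derivative
        V x \<bullet> rot90 ((norm (v x) * \<kappa> x) *\<^sub>R rot90 (T x)) + V' x \<bullet> rot90 (T x)) (at x within {0..1})"
      by (rule bounded_bilinear.has_vector_derivative[OF bounded_bilinear_inner dV[OF x]
            bounded_linear.has_vector_derivative[OF bounded_linear_rot90 dT[OF x]]])
    moreover have "V x \<bullet> rot90 ((norm (v x) * \<kappa> x) *\<^sub>R rot90 (T x)) + V' x \<bullet> rot90 (T x) = norm (v x) * (b \<bullet> rot90 (T x))"
      unfolding V'_def by (subst (2) vT[OF x]) (simp add: rot90_linear VT[OF x] inner_add_left)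
    ultimately have "((\<lambda>x. V x \<bullet> rot90 (T x)) has_real_derivative norm (v x) * (b \<bullet> rot90 (T x))) (at x within {0..1})"
      by (simp add: has_real_derivative_iff_has_vector_derivative)
    from DERIV_cdivide[OF this, of 2] show ?thesis
      by (simp add: \<kappa>_def[abs_def] has_real_derivative_iff_has_vector_derivative)
  qed
  have bT: "b \<bullet> T x = (\<kappa> x)\<^sup>2 - \<delta>" if x: "x \<in> {0..1}" for x
  proof -
    have "((\<lambda>x. V x \<bullet> T x) has_vector_derivative
        V x \<bullet> ((norm (v x) * \<kappa> x) *\<^sub>R rot90 (T x)) + V' x \<bullet> T x) (at x within {0..1})"
      by (rule bounded_bilinear.has_vector_derivative[OF bounded_bilinear_inner dV[OF x] dT[OF x]])
    then have "D_I (\<lambda>x. V x \<bullet> T x) x = V x \<bullet> ((norm (v x) * \<kappa> x) *\<^sub>R rot90 (T x)) + V' x \<bullet> T x"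
      using x by (rule D_I_eqI)
    moreover have "D_I (\<lambda>x. V x \<bullet> T x) x = D_I (\<lambda>x. 0) x"
      by (rule D_I_cong[OF VT x])
    moreover have "D_I (\<lambda>x. 0::real) x = 0" by (rule D_I_eqI) (use x in auto)
    moreover have "V x \<bullet> ((norm (v x) * \<kappa> x) *\<^sub>R rot90 (T x)) + V' x \<bullet> T x
        = norm (v x) * (2 * (\<kappa> x)\<^sup>2 + (\<delta> - 3 * (\<kappa> x)\<^sup>2) + b \<bullet> T x)"
      unfolding V'_def V_eq[OF x] by (subst (2) vT[OF x]) (simp add: JT[OF x] inner_add_left algebra_simps power2_eq_square)
    ultimately have "norm (v x) * (2 * (\<kappa> x)\<^sup>2 + (\<delta> - 3 * (\<kappa> x)\<^sup>2) + b \<bullet> T x) = 0" by simp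
    then show ?thesis using nz[OF x] by simp
  qed
  have el: "elastica \<delta> (\<lambda>x. norm (v x)) T \<kappa> b"
    unfolding elastica_def using pos nT dT d\<kappa> bT by blast
  have p_eq': "p x = (2 * \<kappa> x / norm (v x)) *\<^sub>R rot90 (T x)" if "x \<in> {0..1}" for x
  proof -
    have "p x = (1 / norm (v x)) *\<^sub>R V x" using nz[OF that] by (simp add: V_def)
    then show ?thesis by (simp add: V_eq[OF that])
  qed
  have "integral {0..1} (\<lambda>x. energy_density_deriv \<delta> (v x) (w x) (\<psi>' x) (\<psi>'' x)) =
        ((2 * \<kappa> 1 / norm (v 1)) * (rot90 (T 1) \<bullet> \<psi>' 1) - b \<bullet> \<psi> 1)
        - ((2 * \<kappa> 0 / norm (v 0)) * (rot90 (T 0) \<bullet> \<psi>' 0) - b \<bullet> \<psi> 0)"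
    if "continuous_on {0..1} \<psi>''"
      and d: "\<And>x. x \<in> {0..1} \<Longrightarrow> (\<psi> has_vector_derivative \<psi>' x) (at x within {0..1})"
      "\<And>x. x \<in> {0..1} \<Longrightarrow> (\<psi>' has_vector_derivative \<psi>'' x) (at x within {0..1})" for \<psi> \<psi>' \<psi>''
  proof -
    have "primitive (\<lambda>x. p x \<bullet> \<psi>' x) (\<lambda>x. p x \<bullet> \<psi>'' x + (b + ?Q x) \<bullet> \<psi>' x)"
      by (rule primitive_bilinear[OF bounded_bilinear_inner prim_p primitive_deriv[OF d(2)]])
    moreover have "primitive (\<lambda>x. b \<bullet> \<psi> x) (\<lambda>x. b \<bullet> \<psi>' x)"
      by (rule primitive_linear[OF primitive_deriv[OF d(1)] bounded_linear_inner_right])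
    ultimately have "primitive (\<lambda>x. p x \<bullet> \<psi>' x - b \<bullet> \<psi> x) (\<lambda>x. (p x \<bullet> \<psi>'' x + (b + ?Q x) \<bullet> \<psi>' x) - b \<bullet> \<psi>' x)"
      by (rule primitive_diff)
    then have "primitive (\<lambda>x. p x \<bullet> \<psi>' x - b \<bullet> \<psi> x) (\<lambda>x. energy_density_deriv \<delta> (v x) (w x) (\<psi>' x) (\<psi>'' x))"
    proof (rule primitive_spike[OF _ S])
      fix x assume "x \<in> {0..1} - S"
      then show "energy_density_deriv \<delta> (v x) (w x) (\<psi>' x) (\<psi>'' x) = (p x \<bullet> \<psi>'' x + (b + ?Q x) \<bullet> \<psi>' x) - b \<bullet> \<psi>' x"
        by (simp add: energy_density_deriv_flux p_eq inner_add_left)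
    qed
    from primitiveD[OF this, of 0 1] show ?thesis
      using p_eq'[of 0] p_eq'[of 1] by (simp add: integral_unique)
  qed
  with el show thesis by (rule that)
qed

section \<open>Geometry and regularity of elastica\<close>

lemma ds_eqI:
  assumes x: "x \<in> {0..1}" and r: "norm (D_I \<sigma> x) = r" "r > 0"
    and f: "\<And>y. y \<in> {0..1} \<Longrightarrow> f y = g y"
    and g: "(g has_vector_derivative r *\<^sub>R d) (at x within {0..1})"
  shows "ds \<sigma> f x = d"
proof -
  have "D_I f x = r *\<^sub>R d" using D_I_cong[of f g, OF f x] D_I_eqI[OF g x] by simp
  then show ?thesis using r by (simp add: ds_def)
qed

context
  fixes \<delta> :: real and \<sigma> :: "real \<Rightarrow> real^2" and r T \<kappa> b
  assumes el: "elastica \<delta> r T \<kappa> b"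
    and \<sigma>: "\<And>x. x \<in> {0..1} \<Longrightarrow> (\<sigma> has_vector_derivative r x *\<^sub>R T x) (at x within {0..1})"
begin

lemma elastica_speed: assumes "x \<in> {0..1}" shows "norm (D_I \<sigma> x) = r x" "r x > 0"
  using D_I_eqI[OF \<sigma>[OF assms] assms] bspec[OF el[unfolded elastica_def] assms] by auto

lemma elastica_unit:
  assumes "x \<in> {0..1}"
  shows "T x \<bullet> T x = 1" "(T has_vector_derivative r x *\<^sub>R (\<kappa> x *\<^sub>R rot90 (T x))) (at x within {0..1})"
    "(\<kappa> has_vector_derivative r x *\<^sub>R (b \<bullet> rot90 (T x) / 2)) (at x within {0..1})"
    "b \<bullet> T x = (\<kappa> x)\<^sup>2 - \<delta>"
  using el assms by (auto simp: elastica_def dot_square_norm)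

lemma elastica_tangent: assumes "x \<in> {0..1}" shows "tangent \<sigma> x = T x"
  unfolding tangent_def by (rule ds_eqI[OF assms elastica_speed[OF assms] refl \<sigma>[OF assms]])

lemma elastica_normal: "x \<in> {0..1} \<Longrightarrow> normal \<sigma> x = rot90 (T x)"
  by (simp add: normal_def elastica_tangent)

lemma elastica_curvature_vec: assumes "x \<in> {0..1}" shows "curvature_vec \<sigma> x = \<kappa> x *\<^sub>R rot90 (T x)"
  unfolding curvature_vec_def
  by (rule ds_eqI[OF assms elastica_speed[OF assms] _ elastica_unit(2)[OF assms]])
     (simp add: elastica_tangent[unfolded tangent_def])

lemma elastica_curvature: assumes "x \<in> {0..1}" shows "curvature \<sigma> x = \<kappa> x"
  using assms by (simp add: curvature_def elastica_curvature_vec elastica_normal elastica_unit)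

lemma elastica_ds_curvature: assumes "x \<in> {0..1}" shows "ds \<sigma> (curvature \<sigma>) x = b \<bullet> rot90 (T x) / 2"
  by (rule ds_eqI[OF assms elastica_speed[OF assms] elastica_curvature elastica_unit(3)[OF assms]])

lemma elastica_has_derivative_normal:
  assumes "x \<in> {0..1}"
  shows "((\<lambda>x. rot90 (T x)) has_vector_derivative r x *\<^sub>R (- \<kappa> x *\<^sub>R T x)) (at x within {0..1})"
  using bounded_linear.has_vector_derivative[OF bounded_linear_rot90 elastica_unit(2)[OF assms]]
  by (simp add: rot90_linear)

lemma elastica_has_derivative_ds_curvature:
  assumes x: "x \<in> {0..1}"
  shows "((\<lambda>x. b \<bullet> rot90 (T x) / 2) has_vector_derivative r x *\<^sub>R (- \<kappa> x * (b \<bullet> T x) / 2)) (at x within {0..1})"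
proof -
  have "((\<lambda>x. b \<bullet> rot90 (T x)) has_vector_derivative b \<bullet> (r x *\<^sub>R (- \<kappa> x *\<^sub>R T x))) (at x within {0..1})"
    by (rule bounded_linear.has_vector_derivative[OF bounded_linear_inner_right elastica_has_derivative_normal[OF x]])
  from bounded_linear.has_vector_derivative[OF bounded_linear_divide[of 2] this]
  show ?thesis by (simp add: mult.assoc)
qed

lemma elastica_ds_ds_curvature:
  assumes x: "x \<in> {0..1}" shows "ds \<sigma> (ds \<sigma> (curvature \<sigma>)) x = - \<kappa> x * (b \<bullet> T x) / 2"
  by (rule ds_eqI[OF x elastica_speed[OF x] elastica_ds_curvature elastica_has_derivative_ds_curvature[OF x]])

lemma elastica_ds_perp:
  assumes x: "x \<in> {0..1}" and f: "\<And>y. y \<in> {0..1} \<Longrightarrow> f y = g y *\<^sub>R rot90 (T y)"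
    and g: "(g has_vector_derivative r x *\<^sub>R g') (at x within {0..1})"
  shows "ds_perp \<sigma> f x = g' *\<^sub>R rot90 (T x)"
proof -
  have "((\<lambda>x. g x *\<^sub>R rot90 (T x)) has_vector_derivative
      g x *\<^sub>R (r x *\<^sub>R (- \<kappa> x *\<^sub>R T x)) + (r x *\<^sub>R g') *\<^sub>R rot90 (T x)) (at x within {0..1})"
    by (rule bounded_bilinear.has_vector_derivative[OF bounded_bilinear_scaleR g elastica_has_derivative_normal[OF x]])
  then have "((\<lambda>x. g x *\<^sub>R rot90 (T x)) has_vector_derivative
      r x *\<^sub>R (g' *\<^sub>R rot90 (T x) - (g x * \<kappa> x) *\<^sub>R T x)) (at x within {0..1})"
    by (simp add: algebra_simps)
  from ds_eqI[OF x elastica_speed[OF x] f this]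
  have "ds \<sigma> f x = g' *\<^sub>R rot90 (T x) - (g x * \<kappa> x) *\<^sub>R T x" .
  then show ?thesis
    unfolding ds_perp_def elastica_tangent[OF x] by (simp add: inner_diff_left elastica_unit(1)[OF x])
qed

text \<open>
  Since \<open>2 \<kappa>'' = - \<kappa> (b \<bullet> T)\<close> in arclength and \<open>b \<bullet> T = \<kappa>\<^sup>2 - \<delta>\<close>, the scalar equation holds; the vector
  equation is the scalar one times the normal, because the normal derivative of \<open>g \<nu>\<close> is \<open>g' \<nu>\<close>.
\<close>

lemma elastica_equations:
  assumes x: "x \<in> {0..1}"
  shows "2 * ds \<sigma> (ds \<sigma> (curvature \<sigma>)) x + curvature \<sigma> x ^ 3 - \<delta> * curvature \<sigma> x = 0"
    and "2 *\<^sub>R ds_perp \<sigma> (ds_perp \<sigma> (curvature_vec \<sigma>)) x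
      + (norm (curvature_vec \<sigma> x))\<^sup>2 *\<^sub>R curvature_vec \<sigma> x - \<delta> *\<^sub>R curvature_vec \<sigma> x = 0"
proof -
  have k: "2 * (- \<kappa> x * (b \<bullet> T x) / 2) + \<kappa> x ^ 3 - \<delta> * \<kappa> x = 0"
    unfolding elastica_unit(4)[OF x] by (simp add: field_simps power2_eq_square power3_eq_cube)
  then show "2 * ds \<sigma> (ds \<sigma> (curvature \<sigma>)) x + curvature \<sigma> x ^ 3 - \<delta> * curvature \<sigma> x = 0"
    using x by (simp add: elastica_ds_ds_curvature elastica_curvature)
  have 1: "ds_perp \<sigma> (curvature_vec \<sigma>) y = (b \<bullet> rot90 (T y) / 2) *\<^sub>R rot90 (T y)" if "y \<in> {0..1}" for y
    by (rule elastica_ds_perp[OF that elastica_curvature_vec elastica_unit(3)[OF that]])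
  from elastica_ds_perp[OF x 1 elastica_has_derivative_ds_curvature[OF x]]
  have 2: "ds_perp \<sigma> (ds_perp \<sigma> (curvature_vec \<sigma>)) x = (- \<kappa> x * (b \<bullet> T x) / 2) *\<^sub>R rot90 (T x)" .
  have 3: "norm (curvature_vec \<sigma> x) ^ 2 = (\<kappa> x)\<^sup>2"
    unfolding power2_norm_eq_inner elastica_curvature_vec[OF x] by (simp add: elastica_unit[OF x] power2_eq_square)
  have "2 *\<^sub>R ds_perp \<sigma> (ds_perp \<sigma> (curvature_vec \<sigma>)) x
      + (norm (curvature_vec \<sigma> x))\<^sup>2 *\<^sub>R curvature_vec \<sigma> x - \<delta> *\<^sub>R curvature_vec \<sigma> x
    = (2 * (- \<kappa> x * (b \<bullet> T x) / 2) + \<kappa> x ^ 3 - \<delta> * \<kappa> x) *\<^sub>R rot90 (T x)"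
    unfolding 2 3 unfolding elastica_curvature_vec[OF x] by (simp add: algebra_simps power2_eq_square power3_eq_cube)
  then show "2 *\<^sub>R ds_perp \<sigma> (ds_perp \<sigma> (curvature_vec \<sigma>)) x
      + (norm (curvature_vec \<sigma> x))\<^sup>2 *\<^sub>R curvature_vec \<sigma> x - \<delta> *\<^sub>R curvature_vec \<sigma> x = 0"
    unfolding k by simp
qed

end

lemma positive_deriv_maps_I:
  fixes \<phi> :: "real \<Rightarrow> real"
  assumes "\<phi> 0 = 0" "\<phi> 1 = 1"
    and d: "\<And>x. x \<in> {0..1} \<Longrightarrow> (\<phi> has_real_derivative \<phi>' x) (at x within {0..1})"
    and pos: "\<And>x. x \<in> {0..1} \<Longrightarrow> \<phi>' x > 0"
  shows "strict_mono_on {0..1} \<phi>" "\<phi> ` {0..1} = {0..1}"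
proof -
  have less: "\<phi> x < \<phi> y" if xy: "x < y" "0 \<le> x" "y \<le> 1" for x y
  proof -
    have "\<exists>z\<in>{x<..<y}. \<phi> y - \<phi> x = (\<lambda>h. \<phi>' z * h) (y - x)"
    proof (rule mvt_simple[OF xy(1), where f' = "\<lambda>z h. \<phi>' z * h"])
      fix z assume "x \<le> z" "z \<le> y"
      then show "(\<phi> has_derivative (*) (\<phi>' z)) (at z within {x..y})"
        using d[of z] xy unfolding has_field_derivative_def by (auto intro: has_derivative_subset)
    qed
    then obtain z where "z \<in> {x<..<y}" "\<phi> y - \<phi> x = \<phi>' z * (y - x)" by auto
    moreover have "\<phi>' z * (y - x) > 0" using pos[of z] \<open>z \<in> {x<..<y}\<close> xy by auto
    ultimately show ?thesis by simp
  qed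
  then show "strict_mono_on {0..1} \<phi>" by (auto simp: strict_mono_on_def)
  have cont: "continuous_on {0..1} \<phi>" using d by (meson DERIV_continuous_on)
  show "\<phi> ` {0..1} = {0..1}"
  proof
    show "\<phi> ` {0..1} \<subseteq> {0..1}"
    proof clarify
      fix x :: real assume x: "x \<in> {0..1}"
      have "\<phi> 0 \<le> \<phi> x" "\<phi> x \<le> \<phi> 1"
        using less[of 0 x] less[of x 1] x by (cases "x = 0"; cases "x = 1"; force)+
      then show "\<phi> x \<in> {0..1}" using assms(1,2) by simp
    qed
    show "{0..1} \<subseteq> \<phi> ` {0..1}"
    proof
      fix y :: real assume "y \<in> {0..1}"
      then obtain x where "0 \<le> x" "x \<le> 1" "\<phi> x = y"
        using IVT'[of \<phi> 0 y 1] cont assms(1,2) by auto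
      then show "y \<in> \<phi> ` {0..1}" by force
    qed
  qed
qed

lemma has_vector_derivative_reparam:
  assumes f: "(f has_vector_derivative f') (at (\<phi> x) within {0..1})"
    and \<phi>: "(\<phi> has_real_derivative \<phi>') (at x within {0..1})" "\<phi> ` {0..1} \<subseteq> {0..1}"
  shows "((\<lambda>x. f (\<phi> x)) has_vector_derivative \<phi>' *\<^sub>R f') (at x within {0..1})"
  using vector_diff_chain_within[OF \<phi>(1)[unfolded has_real_derivative_iff_has_vector_derivative]
      has_vector_derivative_within_subset[OF f \<phi>(2)]] by (simp add: o_def)

lemma elastica_reparam:
  assumes el: "elastica \<delta> r T \<kappa> b"
    and d: "\<And>x. x \<in> {0..1} \<Longrightarrow> (\<phi> has_real_derivative \<phi>' x) (at x within {0..1})"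
    and pos: "\<And>x. x \<in> {0..1} \<Longrightarrow> \<phi>' x > 0" and im: "\<phi> ` {0..1} \<subseteq> {0..1}"
  shows "elastica \<delta> (\<lambda>x. \<phi>' x * r (\<phi> x)) (\<lambda>x. T (\<phi> x)) (\<lambda>x. \<kappa> (\<phi> x)) b"
  unfolding elastica_def
proof
  fix x :: real assume x: "x \<in> {0..1}"
  then have y: "\<phi> x \<in> {0..1}" using im by blast
  note e = el[unfolded elastica_def, rule_format, OF y]
  show "\<phi>' x * r (\<phi> x) > 0 \<and> norm (T (\<phi> x)) = 1 \<and>
     ((\<lambda>x. T (\<phi> x)) has_vector_derivative (\<phi>' x * r (\<phi> x) * \<kappa> (\<phi> x)) *\<^sub>R rot90 (T (\<phi> x))) (at x within {0..1}) \<and>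
     ((\<lambda>x. \<kappa> (\<phi> x)) has_vector_derivative \<phi>' x * r (\<phi> x) * (b \<bullet> rot90 (T (\<phi> x))) / 2) (at x within {0..1}) \<and>
     b \<bullet> T (\<phi> x) = (\<kappa> (\<phi> x))\<^sup>2 - \<delta>"
    using e pos[OF x] has_vector_derivative_reparam[OF conjunct1[OF conjunct2[OF conjunct2[OF e]]] d[OF x] im]
      has_vector_derivative_reparam[OF conjunct1[OF conjunct2[OF conjunct2[OF conjunct2[OF e]]]] d[OF x] im]
    by (simp add: mult.assoc)
qed

lemma has_vector_derivative_reverse:
  assumes "(f has_vector_derivative f') (at (1 - x) within {0..1::real})"
  shows "((\<lambda>x. f (1 - x)) has_vector_derivative - f') (at x within {0..1})"
proof -
  have "((\<lambda>x. f (1 - x)) has_vector_derivative (- 1) *\<^sub>R f') (at x within {0..1})"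
    by (rule has_vector_derivative_reparam[where \<phi> = "\<lambda>x. 1 - x", OF assms]) (auto intro!: derivative_eq_intros)
  then show ?thesis by simp
qed

lemma elastica_reverse:
  assumes "elastica \<delta> r T \<kappa> b"
  shows "elastica \<delta> (\<lambda>x. r (1 - x)) (\<lambda>x. - T (1 - x)) (\<lambda>x. - \<kappa> (1 - x)) (- b)"
  unfolding elastica_def
proof
  fix x :: real assume "x \<in> {0..1}"
  then have y: "1 - x \<in> {0..1}" by auto
  note e = assms[unfolded elastica_def, rule_format, OF y]
  have "((\<lambda>x. - T (1 - x)) has_vector_derivative - (- ((r (1 - x) * \<kappa> (1 - x)) *\<^sub>R rot90 (T (1 - x))))) (at x within {0..1})"
    by (intro has_vector_derivative_minus has_vector_derivative_reverse) (use e in blast)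
  moreover have "((\<lambda>x. - \<kappa> (1 - x)) has_vector_derivative - (- (r (1 - x) * (b \<bullet> rot90 (T (1 - x))) / 2))) (at x within {0..1})"
    by (intro has_vector_derivative_minus has_vector_derivative_reverse) (use e in blast)
  ultimately show "r (1 - x) > 0 \<and> norm (- T (1 - x)) = 1 \<and>
     ((\<lambda>x. - T (1 - x)) has_vector_derivative (r (1 - x) * - \<kappa> (1 - x)) *\<^sub>R rot90 (- T (1 - x))) (at x within {0..1}) \<and>
     ((\<lambda>x. - \<kappa> (1 - x)) has_vector_derivative r (1 - x) * (- b \<bullet> rot90 (- T (1 - x))) / 2) (at x within {0..1}) \<and>
     - b \<bullet> - T (1 - x) = (- \<kappa> (1 - x))\<^sup>2 - \<delta>"
    using e by (simp add: rot90_linear)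
qed

text \<open>
  The polynomials in the components of \<open>T\<close> and in \<open>\<kappa>\<close>. At constant speed the elastica system is
  polynomial, so this class is closed under derivatives.
\<close>

inductive_set frame_polynomials :: "(real \<Rightarrow> real^2) \<Rightarrow> (real \<Rightarrow> real) \<Rightarrow> (real \<Rightarrow> real) set"
  for T \<kappa> where
  "(\<lambda>x. T x $ i) \<in> frame_polynomials T \<kappa>"
| "\<kappa> \<in> frame_polynomials T \<kappa>"
| "(\<lambda>x. c) \<in> frame_polynomials T \<kappa>"
| "\<lbrakk>f \<in> frame_polynomials T \<kappa>; g \<in> frame_polynomials T \<kappa>\<rbrakk> \<Longrightarrow> (\<lambda>x. f x + g x) \<in> frame_polynomials T \<kappa>"
| "\<lbrakk>f \<in> frame_polynomials T \<kappa>; g \<in> frame_polynomials T \<kappa>\<rbrakk> \<Longrightarrow> (\<lambda>x. f x * g x) \<in> frame_polynomials T \<kappa>"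

lemma frame_polynomials_deriv:
  assumes el: "elastica \<delta> (\<lambda>x. l) T \<kappa> b" and "f \<in> frame_polynomials T \<kappa>"
  shows "\<exists>g\<in>frame_polynomials T \<kappa>. \<forall>x\<in>{0..1}. (f has_vector_derivative g x) (at x within {0..1})"
  using assms(2)
proof induction
  case (1 i)
  have J: "(\<lambda>x. rot90 (T x) $ i) \<in> frame_polynomials T \<kappa>" for i
  proof -
    have "(\<lambda>x. - 1 * T x $ 2) \<in> frame_polynomials T \<kappa>" "(\<lambda>x. T x $ 1) \<in> frame_polynomials T \<kappa>"
      by (intro frame_polynomials.intros)+
    then show ?thesis using exhaust_2[of i] by auto
  qed
  show ?case
  proof (intro bexI ballI)
    show "(\<lambda>x. l * \<kappa> x * rot90 (T x) $ i) \<in> frame_polynomials T \<kappa>"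
      by (intro frame_polynomials.intros J)
    show "((\<lambda>x. T x $ i) has_vector_derivative l * \<kappa> x * rot90 (T x) $ i) (at x within {0..1})" if "x \<in> {0..1}" for x
    using bounded_linear.has_vector_derivative[OF bounded_linear_vec_nth elastica_def[THEN iffD1, OF el, rule_format, OF that, THEN conjunct2, THEN conjunct2, THEN conjunct1], of i]
      by simp
  qed
next
  case 2
  have "(\<lambda>x. (l / 2) * (b $ 1 * (- 1 * T x $ 2) + b $ 2 * T x $ 1)) \<in> frame_polynomials T \<kappa>"
    by (intro frame_polynomials.intros)
  moreover have "(\<lambda>x. (l / 2) * (b $ 1 * (- 1 * T x $ 2) + b $ 2 * T x $ 1)) = (\<lambda>x. l * (b \<bullet> rot90 (T x)) / 2)"
    by (simp add: inner_vec2)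
  ultimately have "(\<lambda>x. l * (b \<bullet> rot90 (T x)) / 2) \<in> frame_polynomials T \<kappa>" by (simp only:)
  then show ?case by (rule bexI[rotated]) (use el in \<open>simp add: elastica_def\<close>)
next
  case (3 c)
  then show ?case by (intro bexI[of _ "\<lambda>x. 0"]) (auto intro: frame_polynomials.intros)
next
  case (4 f g)
  then obtain f' g' where "f' \<in> frame_polynomials T \<kappa>" "g' \<in> frame_polynomials T \<kappa>"
    "\<forall>x\<in>{0..1}. (f has_vector_derivative f' x) (at x within {0..1})"
    "\<forall>x\<in>{0..1}. (g has_vector_derivative g' x) (at x within {0..1})" by blast
  then show ?case
    by (intro bexI[of _ "\<lambda>x. f' x + g' x"]) (auto intro: frame_polynomials.intros has_vector_derivative_add)
next
  case (5 f g)
  then obtain f' g' where "f' \<in> frame_polynomials T \<kappa>" "g' \<in> frame_polynomials T \<kappa>"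
    "\<forall>x\<in>{0..1}. (f has_vector_derivative f' x) (at x within {0..1})"
    "\<forall>x\<in>{0..1}. (g has_vector_derivative g' x) (at x within {0..1})" by blast
  note fg = this
  have "(\<lambda>x. f x * g' x + f' x * g x) \<in> frame_polynomials T \<kappa>"
    by (intro frame_polynomials.intros(4,5) fg(1,2) "5.hyps")
  then show ?case by (rule bexI[rotated]) (use fg(3,4) in \<open>auto intro: has_vector_derivative_mult\<close>)
qed

lemma elastica_smooth_tangent:
  assumes el: "elastica \<delta> (\<lambda>x. l) T \<kappa> b"
  shows "smooth_I T"
proof -
  have "smooth_I (\<lambda>x. T x $ i)" for i
    by (rule smooth_I_coinduct[of _ "frame_polynomials T \<kappa>"]) (auto intro: frame_polynomials.intros frame_polynomials_deriv[OF el])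
  from smooth_I_linear[OF smooth_I_scaleR_const[OF this] smooth_I_scaleR_const[OF this], of 1 1 "axis 1 1" 1 2 "axis 2 1"]
  have "smooth_I (\<lambda>x. T x $ 1 *\<^sub>R axis 1 1 + T x $ 2 *\<^sub>R (axis 2 1 :: real^2))" by simp
  moreover have "(\<lambda>x. T x $ 1 *\<^sub>R axis 1 1 + T x $ 2 *\<^sub>R (axis 2 1 :: real^2)) = T"
    by (simp add: fun_eq_iff vec2_eq_iff axis_def)
  ultimately show ?thesis by simp
qed

text \<open>
  The one-sided derivatives at the ends come out of the same limit as the others: the inverse is
  continuous and injective, hence maps the punctured filter at \<open>s\<close> to that at \<open>\<phi> s\<close>.
\<close>

lemma inverse_reparam:
  fixes u :: "real \<Rightarrow> real"
  assumes u: "u 0 = 0" "u 1 = 1"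
    and d: "\<And>x. x \<in> {0..1} \<Longrightarrow> (u has_real_derivative u' x) (at x within {0..1})"
    and pos: "\<And>x. x \<in> {0..1} \<Longrightarrow> u' x > 0"
  obtains \<phi> where "\<phi> 0 = 0" "\<phi> 1 = 1" "\<phi> ` {0..1} \<subseteq> {0..1}" "continuous_on {0..1} \<phi>"
    "\<And>s. s \<in> {0..1} \<Longrightarrow> (\<phi> has_real_derivative 1 / u' (\<phi> s)) (at s within {0..1})"
proof -
  have mono: "strict_mono_on {0..1} u" and im: "u ` {0..1} = {0..1}"
    using positive_deriv_maps_I[OF u d pos] by auto
  have inj: "inj_on u {0..1}" using mono by (rule strict_mono_on_imp_inj_on)
  define \<phi> where "\<phi> = the_inv_into {0..1} u"
  have \<phi>u: "\<phi> (u x) = x" if "x \<in> {0..1}" for x using inj that unfolding \<phi>_def by (rule the_inv_into_f_f)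
  have u\<phi>: "u (\<phi> s) = s" if "s \<in> {0..1}" for s
    using f_the_inv_into_f[OF inj, of s] im that unfolding \<phi>_def by auto
  have \<phi>I: "\<phi> s \<in> {0..1}" if "s \<in> {0..1}" for s
    using that im \<phi>u by (metis imageE)
  have cu: "continuous_on {0..1} u" using d by (meson DERIV_continuous_on)
  have c: "continuous_on {0..1} \<phi>"
    using continuous_on_inv[OF cu, of \<phi>] \<phi>u im by auto
  show thesis
  proof (rule that[of \<phi>])
    show "\<phi> 0 = 0" "\<phi> 1 = 1" using \<phi>u[of 0] \<phi>u[of 1] u by auto
    show "\<phi> ` {0..1} \<subseteq> {0..1}" using \<phi>I by blast
    show "continuous_on {0..1} \<phi>" by (rule c)
    fix s :: real assume s: "s \<in> {0..1}"
    have lim: "((\<lambda>y. (u y - u (\<phi> s)) / (y - \<phi> s)) \<longlongrightarrow> u' (\<phi> s)) (at (\<phi> s) within {0..1})"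
      using d[OF \<phi>I[OF s]] by (simp add: has_field_derivative_iff)
    have "(\<phi> \<longlongrightarrow> \<phi> s) (at s within {0..1})" using c s by (simp add: continuous_on_def)
    moreover have "\<forall>\<^sub>F t in at s within {0..1}. \<phi> t \<in> {0..1} \<and> \<phi> t \<noteq> \<phi> s"
      unfolding eventually_at_filter using \<phi>I u\<phi> s by (intro always_eventually) metis
    ultimately have fl: "filterlim \<phi> (at (\<phi> s) within {0..1}) (at s within {0..1})"
      by (simp add: filterlim_at)
    have "((\<lambda>t. inverse ((u (\<phi> t) - u (\<phi> s)) / (\<phi> t - \<phi> s))) \<longlongrightarrow> inverse (u' (\<phi> s))) (at s within {0..1})"
      using filterlim_compose[OF lim fl] pos[OF \<phi>I[OF s]] by (intro tendsto_inverse) auto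
    then have "((\<lambda>t. (\<phi> t - \<phi> s) / (t - s)) \<longlongrightarrow> inverse (u' (\<phi> s))) (at s within {0..1})"
    proof (rule Lim_transform_eventually)
      show "\<forall>\<^sub>F t in at s within {0..1}. inverse ((u (\<phi> t) - u (\<phi> s)) / (\<phi> t - \<phi> s)) = (\<phi> t - \<phi> s) / (t - s)"
        unfolding eventually_at_filter using u\<phi> s by (intro always_eventually) simp
    qed
    then show "(\<phi> has_real_derivative 1 / u' (\<phi> s)) (at s within {0..1})"
      by (simp add: has_field_derivative_iff inverse_eq_divide)
  qed
qed

text \<open>
  The reparametrization proportional to arclength has constant speed \<open>l\<close>, the length of the curve, and
  is the integral of a smooth tangent.
\<close>

lemma elastica_smooth_curve:
  assumes el: "elastica \<delta> r T \<kappa> b" and cr: "continuous_on {0..1} r"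
    and \<gamma>: "\<And>x. x \<in> {0..1} \<Longrightarrow> (\<gamma> has_vector_derivative r x *\<^sub>R T x) (at x within {0..1})"
  shows "smooth_curve \<gamma>"
proof -
  have pos: "r x > 0" if "x \<in> {0..1}" for x using el that by (auto simp: elastica_def)
  define l where "l = integral {0..1} r"
  have "l \<noteq> 0"
    using integral_eq_0_iff[OF cr] pos less_imp_le[OF pos] unfolding l_def by force
  moreover have "l \<ge> 0" unfolding l_def using pos by (intro integral_nonneg integrable_continuous_real cr) (auto intro: less_imp_le)
  ultimately have l: "l > 0" by simp
  define u where "u x = integral {0..x} r / l" for x
  obtain \<phi> where \<phi>: "\<phi> 0 = 0" "\<phi> 1 = 1" "\<phi> ` {0..1} \<subseteq> {0..1}" "continuous_on {0..1} \<phi>"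
    "\<And>s. s \<in> {0..1} \<Longrightarrow> (\<phi> has_real_derivative 1 / (r (\<phi> s) / l)) (at s within {0..1})"
  proof (rule inverse_reparam[of u "\<lambda>x. r x / l"])
    show "(u has_real_derivative r x / l) (at x within {0..1})" if "x \<in> {0..1}" for x
      unfolding u_def by (intro DERIV_cdivide integral_has_real_derivative cr that)
  qed (use l pos in \<open>auto simp: u_def l_def\<close>)
  define \<phi>' where "\<phi>' s = l / r (\<phi> s)" for s
  have \<phi>d: "(\<phi> has_real_derivative \<phi>' s) (at s within {0..1})" if "s \<in> {0..1}" for s
    using \<phi>(5)[OF that] by (simp add: \<phi>'_def)
  have r\<phi>: "r (\<phi> s) > 0" if "s \<in> {0..1}" for s using pos \<phi>(3) that by blast
  have \<phi>'pos: "\<phi>' s > 0" if "s \<in> {0..1}" for s using r\<phi>[OF that] l by (simp add: \<phi>'_def)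
  have \<phi>'c: "continuous_on {0..1} \<phi>'"
    unfolding \<phi>'_def using r\<phi>
    by (intro continuous_intros continuous_on_compose2[OF cr \<phi>(4) \<phi>(3)]) force
  define \<sigma> where "\<sigma> s = \<gamma> (\<phi> s)" for s
  have el': "elastica \<delta> (\<lambda>x. l) (\<lambda>x. T (\<phi> x)) (\<lambda>x. \<kappa> (\<phi> x)) b"
  proof -
    have "elastica \<delta> (\<lambda>x. \<phi>' x * r (\<phi> x)) (\<lambda>x. T (\<phi> x)) (\<lambda>x. \<kappa> (\<phi> x)) b"
      by (rule elastica_reparam[OF el \<phi>d \<phi>'pos \<phi>(3)])
    moreover have "\<phi>' x * r (\<phi> x) = l" if "x \<in> {0..1}" for x using r\<phi>[OF that] by (simp add: \<phi>'_def)
    ultimately show ?thesis unfolding elastica_def by simp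
  qed
  have d\<sigma>: "(\<sigma> has_vector_derivative l *\<^sub>R T (\<phi> s)) (at s within {0..1})" if "s \<in> {0..1}" for s
  proof -
    have "\<phi> s \<in> {0..1}" using \<phi>(3) that by blast
    from has_vector_derivative_reparam[OF \<gamma>[OF this] \<phi>d[OF that] \<phi>(3)] r\<phi>[OF that]
    show ?thesis by (simp add: \<sigma>_def[abs_def] \<phi>'_def)
  qed
  have "reparametrization \<gamma> \<sigma>"
    unfolding reparametrization_def using \<phi>(1,2) \<phi>d \<phi>'pos \<phi>'c \<sigma>_def by blast
  moreover have "regular_curve \<sigma>"
    unfolding regular_curve_def
  proof
    fix x :: real assume x: "x \<in> {0..1}"
    have "norm (T (\<phi> x)) = 1" using bspec[OF el'[unfolded elastica_def] x] by blast
    then have "T (\<phi> x) \<noteq> 0" by auto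
    then show "\<sigma> differentiable at x within {0..1} \<and> D_I \<sigma> x \<noteq> 0"
      using d\<sigma>[OF x] D_I_eqI[OF d\<sigma>[OF x] x] l by (auto intro: differentiableI_vector)
  qed
  moreover have "smooth_I \<sigma>"
  proof (rule smooth_I_antideriv[OF _ d\<sigma>])
    show "smooth_I (\<lambda>s. l *\<^sub>R T (\<phi> s))"
      using smooth_I_linear[OF elastica_smooth_tangent[OF el'] elastica_smooth_tangent[OF el'], of l 0] by simp
  qed
  ultimately show ?thesis unfolding smooth_curve_def smooth_parametrization_def by blast
qed

lemma elastica_reparametrization:
  assumes el: "elastica \<delta> r T \<kappa> b"
    and \<gamma>: "\<And>x. x \<in> {0..1} \<Longrightarrow> (\<gamma> has_vector_derivative r x *\<^sub>R T x) (at x within {0..1})"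
    and rep: "reparametrization \<gamma> \<sigma>"
  obtains r' T' \<kappa>' where "elastica \<delta> r' T' \<kappa>' b"
    "\<And>x. x \<in> {0..1} \<Longrightarrow> (\<sigma> has_vector_derivative r' x *\<^sub>R T' x) (at x within {0..1})"
    "T' 0 = T 0" "\<kappa>' 0 = \<kappa> 0"
proof -
  obtain \<phi> \<phi>' where \<phi>: "\<phi> 0 = 0" "\<phi> 1 = 1"
    "\<And>x. x \<in> {0..1} \<Longrightarrow> (\<phi> has_real_derivative \<phi>' x) (at x within {0..1})" "\<And>x. x \<in> {0..1} \<Longrightarrow> \<phi>' x > 0"
    "\<And>x. x \<in> {0..1} \<Longrightarrow> \<sigma> x = \<gamma> (\<phi> x)"
    using rep unfolding reparametrization_def by metis
  have im: "\<phi> ` {0..1} \<subseteq> {0..1}" using positive_deriv_maps_I(2)[OF \<phi>(1-4)] by simp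
  show thesis
  proof (rule that[of "\<lambda>x. \<phi>' x * r (\<phi> x)" "\<lambda>x. T (\<phi> x)" "\<lambda>x. \<kappa> (\<phi> x)"])
    show "elastica \<delta> (\<lambda>x. \<phi>' x * r (\<phi> x)) (\<lambda>x. T (\<phi> x)) (\<lambda>x. \<kappa> (\<phi> x)) b"
      by (rule elastica_reparam[OF el \<phi>(3,4) im])
    fix x :: real assume x: "x \<in> {0..1}"
    then have "\<phi> x \<in> {0..1}" using im by blast
    from has_vector_derivative_reparam[OF \<gamma>[OF this] \<phi>(3)[OF x] im]
    have d: "((\<lambda>x. \<gamma> (\<phi> x)) has_vector_derivative (\<phi>' x * r (\<phi> x)) *\<^sub>R T (\<phi> x)) (at x within {0..1})" by simp
    show "(\<sigma> has_vector_derivative (\<phi>' x * r (\<phi> x)) *\<^sub>R T (\<phi> x)) (at x within {0..1})"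
      by (rule has_vector_derivative_transform[OF x _ d]) (rule \<phi>(5))
  qed (simp_all add: \<phi>)
qed

section \<open>Variations of a network\<close>

definition H2_data :: "(real \<Rightarrow> real^2) \<Rightarrow> (real \<Rightarrow> real^2) \<Rightarrow> (real \<Rightarrow> real^2) \<Rightarrow> bool" where
  "H2_data \<gamma> v w \<longleftrightarrow> H2_velocity v w \<and>
     (\<forall>x\<in>{0..1}. (\<gamma> has_vector_derivative v x) (at x within {0..1})) \<and>
     (\<exists>S. negligible S \<and> (\<forall>x\<in>{0..1} - S. (v has_vector_derivative w x) (at x within {0..1})))"

lemma regular_H2_curve_data:
  assumes "regular_curve \<gamma>" "H2_curve \<gamma>"
  shows "\<exists>v w. H2_data \<gamma> v w"
proof -
  obtain v w S where d: "\<forall>x\<in>{0..1}. (\<gamma> has_vector_derivative v x) (at x within {0..1})"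
    and S: "negligible S" "\<forall>x\<in>{0..1} - S. (v has_vector_derivative w x) (at x within {0..1})"
    and w: "w absolutely_integrable_on {0..1}" "\<forall>x\<in>{0..1}. (w has_integral (v x - v 0)) {0..x}"
      "(\<lambda>x. (norm (w x))\<^sup>2) integrable_on {0..1}"
    using assms(2) unfolding H2_curve_def by blast
  have "v x \<noteq> 0" if x: "x \<in> {0..1}" for x
    using assms(1) D_I_eqI[OF bspec[OF d x] x] x unfolding regular_curve_def by metis
  then have "H2_velocity v w" using w unfolding H2_velocity_def primitive_def by blast
  then show ?thesis unfolding H2_data_def using d S by blast
qed

text \<open>
  To be applied off the exceptional null set, where the curvature is not an arbitrary value; a null set
  does not affect the energy.
\<close>

lemma curvature_energy_density:
  assumes \<sigma>: "\<And>y. y \<in> {0..1} \<Longrightarrow> (\<sigma> has_vector_derivative V y) (at y within {0..1})"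
    and nz: "\<And>y. y \<in> {0..1} \<Longrightarrow> V y \<noteq> 0"
    and W: "(V has_vector_derivative W) (at x within {0..1})" and x: "x \<in> {0..1}"
  shows "((curvature \<sigma> x)\<^sup>2 + \<delta>) * norm (D_I \<sigma> x) = energy_density \<delta> (V x) W"
proof -
  have D: "D_I \<sigma> y = V y" if "y \<in> {0..1}" for y using D_I_eqI[OF \<sigma>[OF that] that] .
  have n: "norm (V x) > 0" using nz[OF x] by simp
  have tan: "ds \<sigma> \<sigma> y = V y /\<^sub>R norm (V y)" if "y \<in> {0..1}" for y using D[OF that] by (simp add: ds_def)
  have "D_I (ds \<sigma> \<sigma>) x = (rot90 (V x) \<bullet> W / norm (V x) ^ 3) *\<^sub>R rot90 (V x)"
    using D_I_cong[of "ds \<sigma> \<sigma>", OF tan x] D_I_eqI[OF has_vector_derivative_normalized[OF W nz[OF x]] x] by simp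
  then have "curvature \<sigma> x = ((rot90 (V x) \<bullet> W / norm (V x) ^ 3) / norm (V x)) * ((rot90 (V x) \<bullet> rot90 (V x)) / norm (V x))"
    unfolding curvature_def curvature_vec_def ds_def[of \<sigma> "ds \<sigma> \<sigma>"] normal_def tangent_def tan[OF x] D[OF x]
    by (simp add: rot90_linear inverse_eq_divide)
  also have "\<dots> = (rot90 (V x) \<bullet> W) / norm (V x) ^ 3"
    using n unfolding rot90_inner dot_square_norm by (simp add: field_simps power_numeral_reduce)
  finally have c: "curvature \<sigma> x = (rot90 (V x) \<bullet> W) / norm (V x) ^ 3" .
  show ?thesis
    unfolding c D[OF x] energy_density_def using n by (simp add: field_simps power_numeral_reduce)
qed

lemma curve_first_variation:
  assumes \<gamma>: "H2_data \<gamma> v w" and \<delta>: "\<delta> \<ge> 0" and c: "continuous_on {0..1} \<psi>''"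
    and d: "\<And>x. x \<in> {0..1} \<Longrightarrow> (\<psi> has_vector_derivative \<psi>' x) (at x within {0..1})"
      "\<And>x. x \<in> {0..1} \<Longrightarrow> (\<psi>' has_vector_derivative \<psi>'' x) (at x within {0..1})"
  shows "((\<lambda>t. integral {0..1} (\<lambda>x. ((curvature (\<lambda>x. \<gamma> x + t *\<^sub>R \<psi> x) x)\<^sup>2 + \<delta>) * norm (D_I (\<lambda>x. \<gamma> x + t *\<^sub>R \<psi> x) x)))
    has_real_derivative integral {0..1} (\<lambda>x. energy_density_deriv \<delta> (v x) (w x) (\<psi>' x) (\<psi>'' x))) (at 0)"
proof -
  obtain S where H2: "H2_velocity v w"
    and g: "\<And>x. x \<in> {0..1} \<Longrightarrow> (\<gamma> has_vector_derivative v x) (at x within {0..1})"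
    and S: "negligible S" "\<And>x. x \<in> {0..1} - S \<Longrightarrow> (v has_vector_derivative w x) (at x within {0..1})"
    using \<gamma> unfolding H2_data_def by blast
  have c': "continuous_on {0..1} \<psi>'"
    by (rule primitive_continuous[OF primitive_deriv[OF d(2)]])
  let ?E = "\<lambda>t. integral {0..1} (\<lambda>x. ((curvature (\<lambda>x. \<gamma> x + t *\<^sub>R \<psi> x) x)\<^sup>2 + \<delta>) * norm (D_I (\<lambda>x. \<gamma> x + t *\<^sub>R \<psi> x) x))"
  let ?F = "\<lambda>t. integral {0..1} (\<lambda>x. energy_density \<delta> (v x + t *\<^sub>R \<psi>' x) (w x + t *\<^sub>R \<psi>'' x))"
  have eq: "?E t = ?F t" if nz: "\<forall>x\<in>{0..1}. v x + t *\<^sub>R \<psi>' x \<noteq> 0" for t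
  proof (rule integral_spike[OF S(1)])
    fix x assume x: "x \<in> {0..1} - S"
    have "((curvature (\<lambda>x. \<gamma> x + t *\<^sub>R \<psi> x) x)\<^sup>2 + \<delta>) * norm (D_I (\<lambda>x. \<gamma> x + t *\<^sub>R \<psi> x) x)
      = energy_density \<delta> ((\<lambda>x. v x + t *\<^sub>R \<psi>' x) x) (w x + t *\<^sub>R \<psi>'' x)"
    proof (rule curvature_energy_density)
      show "((\<lambda>x. \<gamma> x + t *\<^sub>R \<psi> x) has_vector_derivative v y + t *\<^sub>R \<psi>' y) (at y within {0..1})" if "y \<in> {0..1}" for y
        using g[OF that] d(1)[OF that] by (auto intro!: derivative_eq_intros)
      show "((\<lambda>x. v x + t *\<^sub>R \<psi>' x) has_vector_derivative w x + t *\<^sub>R \<psi>'' x) (at x within {0..1})"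
        using S(2)[OF x] d(2)[of x] x by (auto intro!: derivative_eq_intros)
    qed (use nz x in auto)
    then show "energy_density \<delta> (v x + t *\<^sub>R \<psi>' x) (w x + t *\<^sub>R \<psi>'' x) =
      ((curvature (\<lambda>x. \<gamma> x + t *\<^sub>R \<psi> x) x)\<^sup>2 + \<delta>) * norm (D_I (\<lambda>x. \<gamma> x + t *\<^sub>R \<psi> x) x)" by simp
  qed
  have "\<forall>\<^sub>F t in at 0. ?E t = ?F t"
    using first_variation_density(2)[OF H2 c' c \<delta>] by eventually_elim (rule eq)
  moreover have "?E 0 = ?F 0" by (rule eq) (use H2 in \<open>simp add: H2_velocity_def\<close>)
  ultimately have ev: "\<forall>\<^sub>F t in nhds 0. ?E t = ?F t" by (simp add: eventually_nhds_conv_at)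
  show ?thesis
    using DERIV_cong_ev[OF refl ev refl] first_variation_density(1)[OF H2 c' c \<delta>] by blast
qed

lemma stationary_first_variation:
  assumes st: "stationary_point \<delta> N \<gamma> C" and \<delta>: "\<delta> \<ge> 0"
    and data: "\<And>i. i \<in> {1..N} \<Longrightarrow> H2_data (\<gamma> i) (v i) (w i)"
    and s: "\<And>i. i \<in> {1..N} \<Longrightarrow> smooth_I (\<psi>'' i)"
    and d: "\<And>i x. i \<in> {1..N} \<Longrightarrow> x \<in> {0..1} \<Longrightarrow> (\<psi> i has_vector_derivative \<psi>' i x) (at x within {0..1})"
      "\<And>i x. i \<in> {1..N} \<Longrightarrow> x \<in> {0..1} \<Longrightarrow> (\<psi>' i has_vector_derivative \<psi>'' i x) (at x within {0..1})"
    and adm: "preserves_junctions N \<gamma> \<psi>" "C \<psi>"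
  shows "(\<Sum>i=1..N. integral {0..1} (\<lambda>x. energy_density_deriv \<delta> (v i x) (w i x) (\<psi>' i x) (\<psi>'' i x))) = 0"
proof -
  have "smooth_I (\<psi> i)" if "i \<in> {1..N}" for i
    by (rule smooth_I_antideriv[OF smooth_I_antideriv[OF s[OF that] d(2)[OF that]] d(1)[OF that]])
  then have "((\<lambda>t. elastic_energy \<delta> N (perturb \<gamma> \<psi> t)) has_real_derivative 0) (at 0)"
    using st adm unfolding stationary_point_def by blast
  moreover have "((\<lambda>t. elastic_energy \<delta> N (perturb \<gamma> \<psi> t)) has_real_derivative
     (\<Sum>i=1..N. integral {0..1} (\<lambda>x. energy_density_deriv \<delta> (v i x) (w i x) (\<psi>' i x) (\<psi>'' i x)))) (at 0)"
  proof -
    have p: "perturb \<gamma> \<psi> t i = (\<lambda>x. \<gamma> i x + t *\<^sub>R \<psi> i x)" for t i by (simp add: perturb_def fun_eq_iff)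
    show ?thesis
      unfolding elastic_energy_def p
      by (intro DERIV_sum curve_first_variation[OF data \<delta> smooth_I_continuous[OF s] d])
  qed
  ultimately show ?thesis by (rule DERIV_unique[symmetric])
qed

text \<open>
  Quantities at a curve end that change sign when the curve is oriented to start there.
\<close>

definition outward :: "nat \<times> real \<Rightarrow> 'a::uminus \<Rightarrow> 'a" where
  "outward c z = (if snd c = 0 then z else - z)"

lemma outward_simps [simp]:
  fixes u z :: "'a::real_inner"
  shows "outward c z \<bullet> outward c u = z \<bullet> u" "outward c (0::'a) = 0"
    "outward c (a *\<^sub>R z) = a *\<^sub>R outward c z" "norm (outward c z) = norm z"
  by (auto simp: outward_def)

lemma rot90_outward: "rot90 (outward c z) = outward c (rot90 z)"
  by (auto simp: outward_def rot90_linear)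

lemma from_end_has_vector_derivative:
  assumes "(f (fst c) has_vector_derivative d) (at (snd c) within {0..1})" "snd c \<in> {0, 1}"
  shows "(from_end f c has_vector_derivative outward c d) (at 0 within {0..1})"
proof (cases "snd c = 0")
  case True
  then show ?thesis using assms by (simp add: from_end_def outward_def)
next
  case False
  then have "snd c = 1" using assms(2) by auto
  then have "((\<lambda>x. f (fst c) (1 - x)) has_vector_derivative - d) (at 0 within {0..1})"
    using assms(1) by (intro has_vector_derivative_reverse) simp
  then show ?thesis using False by (simp add: from_end_def outward_def reversepath_def[abs_def])
qed

lemma elastica_from_end:
  assumes el: "elastica \<delta> r T \<kappa> b"
    and \<gamma>: "\<And>x. x \<in> {0..1} \<Longrightarrow> (\<gamma> (fst c) has_vector_derivative r x *\<^sub>R T x) (at x within {0..1})"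
    and c: "snd c \<in> {0, 1}"
  obtains r' T' \<kappa>' where "elastica \<delta> r' T' \<kappa>' (outward c b)"
    "\<And>x. x \<in> {0..1} \<Longrightarrow> (from_end \<gamma> c has_vector_derivative r' x *\<^sub>R T' x) (at x within {0..1})"
    "T' 0 = outward c (T (snd c))" "\<kappa>' 0 = outward c (\<kappa> (snd c))"
proof (cases "snd c = 0")
  case True
  then show thesis using el \<gamma> by (intro that[of r T \<kappa>]) (auto simp: outward_def from_end_def)
next
  case False
  then have c1: "snd c = 1" using c by auto
  show thesis
  proof (rule that[of "\<lambda>x. r (1 - x)" "\<lambda>x. - T (1 - x)" "\<lambda>x. - \<kappa> (1 - x)"])
    show "elastica \<delta> (\<lambda>x. r (1 - x)) (\<lambda>x. - T (1 - x)) (\<lambda>x. - \<kappa> (1 - x)) (outward c b)"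
      using elastica_reverse[OF el] False by (simp add: outward_def)
    fix x :: real assume "x \<in> {0..1}"
    then have "((\<lambda>x. \<gamma> (fst c) (1 - x)) has_vector_derivative - (r (1 - x) *\<^sub>R T (1 - x))) (at x within {0..1})"
      by (intro has_vector_derivative_reverse \<gamma>) auto
    then show "(from_end \<gamma> c has_vector_derivative r (1 - x) *\<^sub>R - T (1 - x)) (at x within {0..1})"
      using False by (simp add: from_end_def reversepath_def[abs_def])
  qed (use False c1 in \<open>simp_all add: outward_def\<close>)
qed

lemma ends_atD: "c \<in> ends_at N \<gamma> p \<Longrightarrow> fst c \<in> {1..N} \<and> snd c \<in> {0, 1} \<and> \<gamma> (fst c) (snd c) = p"
  by (auto simp: ends_at_def)

lemma preserves_junctionsI:
  assumes "\<And>c. fst c \<in> {1..N} \<Longrightarrow> snd c \<in> {0, 1} \<Longrightarrow> \<psi> (fst c) (snd c) = h (\<gamma> (fst c) (snd c))"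
  shows "preserves_junctions N \<gamma> \<psi>"
  unfolding preserves_junctions_def using assms[of "(_, _)"] by (auto simp: ends_at_def)

lemma ds_from_end:
  assumes "(\<gamma> (fst c) has_vector_derivative v) (at (snd c) within {0..1})"
    and "(\<psi> (fst c) has_vector_derivative d) (at (snd c) within {0..1})" "snd c \<in> {0, 1}"
  shows "ds (from_end \<gamma> c) (from_end \<psi> c) 0 = outward c (d /\<^sub>R norm v)"
proof -
  have "D_I (from_end \<gamma> c) 0 = outward c v" "D_I (from_end \<psi> c) 0 = outward c d"
    using assms by (auto intro!: D_I_eqI from_end_has_vector_derivative)
  then show ?thesis unfolding ds_def by simp
qed

lemma tangent_from_end:
  assumes "(\<gamma> (fst c) has_vector_derivative v) (at (snd c) within {0..1})" "snd c \<in> {0, 1}"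
  shows "tangent (from_end \<gamma> c) 0 = outward c (v /\<^sub>R norm v)"
  unfolding tangent_def by (rule ds_from_end[of \<gamma> c v \<gamma> v, OF assms(1,1,2)])

text \<open>
  Fields whose derivatives vanish at the ends leave the end tangents of all perturbed networks unchanged.
\<close>

lemma first_order_vanishing_admissible:
  assumes g: "\<And>i x. i \<in> {1..N} \<Longrightarrow> x \<in> {0..1} \<Longrightarrow> (\<gamma> i has_vector_derivative v i x) (at x within {0..1})"
    and z: "\<And>i e. i \<in> {1..N} \<Longrightarrow> e \<in> {0, 1} \<Longrightarrow> (\<psi> i has_vector_derivative 0) (at e within {0..1})"
  shows "preserves_angles N \<gamma> \<psi>" "preserves_equal_angles N \<gamma> \<psi>"
proof -
  have g': "(\<gamma> (fst c) has_vector_derivative v (fst c) (snd c)) (at (snd c) within {0..1})"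
    and z': "(\<psi> (fst c) has_vector_derivative 0) (at (snd c) within {0..1})"
    and e: "snd c \<in> {0, 1}" if "c \<in> ends_at N \<gamma> p" for c p
    using ends_atD[OF that] g[of "fst c" "snd c"] z[of "fst c" "snd c"] by auto
  show "preserves_equal_angles N \<gamma> \<psi>"
    unfolding preserves_equal_angles_def
  proof (intro ballI sum.neutral)
    fix p c assume "c \<in> ends_at N \<gamma> p"
    from ds_from_end[of \<gamma> c _ \<psi>, OF g'[OF this] z'[OF this] e[OF this]]
    show "ds_perp (from_end \<gamma> c) (from_end \<psi> c) 0 = 0" by (simp add: ds_perp_def)
  qed
  have t: "tangent (from_end (perturb \<gamma> \<psi> t) c) 0 = tangent (from_end \<gamma> c) 0" if "c \<in> ends_at N \<gamma> p" for t c p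
  proof -
    have "((\<lambda>x. \<gamma> (fst c) x + t *\<^sub>R \<psi> (fst c) x) has_vector_derivative v (fst c) (snd c) + t *\<^sub>R 0) (at (snd c) within {0..1})"
      by (intro has_vector_derivative_add g'[OF that] bounded_linear.has_vector_derivative[OF bounded_linear_scaleR_right] z'[OF that])
    then have "(perturb \<gamma> \<psi> t (fst c) has_vector_derivative v (fst c) (snd c)) (at (snd c) within {0..1})"
      by (simp add: perturb_def[abs_def])
    from tangent_from_end[of "perturb \<gamma> \<psi> t" c, OF this e[OF that]] tangent_from_end[of \<gamma> c, OF g'[OF that] e[OF that]]
    show ?thesis by simp
  qed
  show "preserves_angles N \<gamma> \<psi>"
    unfolding preserves_angles_def normal_def using t by simp
qed

text \<open>
  A variation that moves a single curve and vanishes to first order at its ends is admissible, so each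
  curve is critical by itself.
\<close>

lemma stationary_imp_H2_critical:
  assumes st: "stationary_point \<delta> N \<gamma> C" and \<delta>: "\<delta> \<ge> 0"
    and data: "\<And>i. i \<in> {1..N} \<Longrightarrow> H2_data (\<gamma> i) (v i) (w i)"
    and C: "\<And>\<psi>. (\<And>i e. i \<in> {1..N} \<Longrightarrow> e \<in> {0, 1} \<Longrightarrow> (\<psi> i has_vector_derivative 0) (at e within {0..1})) \<Longrightarrow> C \<psi>"
    and j: "j \<in> {1..N}"
  shows "H2_critical \<delta> (v j) (w j)"
  unfolding H2_critical_def
proof (intro allI impI)
  fix f f' f'' :: "real \<Rightarrow> real^2"
  assume s: "smooth_I f''"
    and d: "\<forall>x\<in>{0..1}. (f has_vector_derivative f' x) (at x within {0..1})"
      "\<forall>x\<in>{0..1}. (f' has_vector_derivative f'' x) (at x within {0..1})"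
    and z: "f 0 = 0" "f 1 = 0" "f' 0 = 0" "f' 1 = 0"
  define on_j :: "(real \<Rightarrow> real^2) \<Rightarrow> nat \<Rightarrow> real \<Rightarrow> real^2" where "on_j g i = (if i = j then g else (\<lambda>x. 0))" for g i
  have s0: "smooth_I (\<lambda>x. 0 :: real^2)" using smooth_I_linear[OF s s, of 0 0] by simp
  have dd: "(on_j g i has_vector_derivative on_j g' i x) (at x within {0..1})"
    if "\<forall>x\<in>{0..1}. (g has_vector_derivative g' x) (at x within {0..1})" "x \<in> {0..1}" for g g' i x
    using that by (simp add: on_j_def)
  have "(\<Sum>i=1..N. integral {0..1} (\<lambda>x. energy_density_deriv \<delta> (v i x) (w i x) (on_j f' i x) (on_j f'' i x))) = 0"
  proof (rule stationary_first_variation[OF st \<delta> data])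
    show "smooth_I (on_j f'' i)" for i using s s0 by (simp add: on_j_def)
    show "(on_j f i has_vector_derivative on_j f' i x) (at x within {0..1})" if "x \<in> {0..1}" for i x
      by (rule dd[OF d(1) that])
    show "(on_j f' i has_vector_derivative on_j f'' i x) (at x within {0..1})" if "x \<in> {0..1}" for i x
      by (rule dd[OF d(2) that])
    show "preserves_junctions N \<gamma> (on_j f)"
      by (rule preserves_junctionsI[where h = "\<lambda>_. 0"]) (use z in \<open>auto simp: on_j_def\<close>)
    show "C (on_j f)"
    proof (rule C)
      fix i and e :: real assume "e \<in> {0, 1}"
      then show "(on_j f i has_vector_derivative 0) (at e within {0..1})"
        using dd[OF d(1), of e i] z by (auto simp: on_j_def split: if_splits)
    qed
  qed
  also have "(\<Sum>i=1..N. integral {0..1} (\<lambda>x. energy_density_deriv \<delta> (v i x) (w i x) (on_j f' i x) (on_j f'' i x))) =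
     (\<Sum>i=1..N. if i = j then integral {0..1} (\<lambda>x. energy_density_deriv \<delta> (v j x) (w j x) (f' x) (f'' x)) else 0)"
    by (rule sum.cong) (auto simp: on_j_def energy_density_deriv_def rot90_linear)
  also have "\<dots> = integral {0..1} (\<lambda>x. energy_density_deriv \<delta> (v j x) (w j x) (f' x) (f'' x))"
    using j by (subst sum.delta) auto
  finally show "integral {0..1} (\<lambda>x. energy_density_deriv \<delta> (v j x) (w j x) (f' x) (f'' x)) = 0" .
qed

text \<open>
  Cubic fields with prescribed values and derivatives at both ends, to isolate the boundary terms.
\<close>

lemma hermite_interpolation:
  fixes A D :: "real \<Rightarrow> real^2"
  obtains \<psi> \<psi>' \<psi>'' where "smooth_I \<psi>''"
    "\<And>x. (\<psi> has_vector_derivative \<psi>' x) (at x within {0..1})"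
    "\<And>x. (\<psi>' has_vector_derivative \<psi>'' x) (at x within {0..1})"
    "\<And>e. e \<in> {0, 1} \<Longrightarrow> \<psi> e = A e" "\<And>e. e \<in> {0, 1} \<Longrightarrow> \<psi>' e = D e"
proof -
  define P Q where "P = 3 *\<^sub>R (A 1 - A 0) - 2 *\<^sub>R D 0 - D 1" and "Q = 2 *\<^sub>R (A 0 - A 1) + D 0 + D 1"
  define \<psi> where "\<psi> x = A 0 + x *\<^sub>R D 0 + (x\<^sup>2) *\<^sub>R P + (x ^ 3) *\<^sub>R Q" for x
  define \<psi>' where "\<psi>' x = D 0 + (2 * x) *\<^sub>R P + (3 * x\<^sup>2) *\<^sub>R Q" for x
  define \<psi>'' where "\<psi>'' x = 2 *\<^sub>R P + (6 * x) *\<^sub>R Q" for x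
  show thesis
  proof (rule that)
    have "smooth_I (\<lambda>x. 1 *\<^sub>R ((2 * 1) *\<^sub>R P) + 1 *\<^sub>R ((6 * x) *\<^sub>R Q))"
      by (intro smooth_I_linear smooth_I_scaleR_const smooth_I_real_polynomial_function)
         (auto intro!: real_polynomial_function.intros bounded_linear_mult_right)
    then show "smooth_I \<psi>''" unfolding \<psi>''_def by simp
    show "(\<psi> has_vector_derivative \<psi>' x) (at x within {0..1})" for x
      unfolding \<psi>_def \<psi>'_def by (auto intro!: derivative_eq_intros simp: algebra_simps)
    show "(\<psi>' has_vector_derivative \<psi>'' x) (at x within {0..1})" for x
      unfolding \<psi>'_def \<psi>''_def by (auto intro!: derivative_eq_intros simp: algebra_simps)
    show "\<psi> e = A e" "\<psi>' e = D e" if "e \<in> {0, 1}" for e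
      using that by (auto simp: \<psi>_def \<psi>'_def P_def Q_def vec2_eq_iff algebra_simps)
  qed
qed


text \<open>
  What is left of the first variation after integration by parts along each elastica.
\<close>

definition boundary_variation ::
  "nat \<Rightarrow> (nat \<Rightarrow> real \<Rightarrow> real^2) \<Rightarrow> (nat \<Rightarrow> real \<Rightarrow> real^2) \<Rightarrow> (nat \<Rightarrow> real \<Rightarrow> real) \<Rightarrow> (nat \<Rightarrow> real^2)
    \<Rightarrow> (nat \<Rightarrow> real \<Rightarrow> real^2) \<Rightarrow> (nat \<Rightarrow> real \<Rightarrow> real^2) \<Rightarrow> real" where
  "boundary_variation N v T \<kappa> b \<psi> \<psi>' =
     (\<Sum>i=1..N. ((2 * \<kappa> i 1 / norm (v i 1)) * (rot90 (T i 1) \<bullet> \<psi>' i 1) - b i \<bullet> \<psi> i 1)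
        - ((2 * \<kappa> i 0 / norm (v i 0)) * (rot90 (T i 0) \<bullet> \<psi>' i 0) - b i \<bullet> \<psi> i 0))"

lemma elastic_network:
  assumes reg: "regular_H2_network N \<gamma>" and \<delta>: "\<delta> > 0" and st: "stationary_point \<delta> N \<gamma> C"
    and C: "\<And>\<psi>. preserves_angles N \<gamma> \<psi> \<Longrightarrow> preserves_equal_angles N \<gamma> \<psi> \<Longrightarrow> C \<psi>"
  obtains v T \<kappa> b where
    "\<forall>i\<in>{1..N}. \<forall>x\<in>{0..1}. (\<gamma> i has_vector_derivative norm (v i x) *\<^sub>R T i x) (at x within {0..1})"
    "\<forall>i\<in>{1..N}. continuous_on {0..1} (v i)"
    "\<forall>i\<in>{1..N}. elastica \<delta> (\<lambda>x. norm (v i x)) (T i) (\<kappa> i) (b i)"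
    "\<forall>\<psi> \<psi>' \<psi>''. (\<forall>i\<in>{1..N}. smooth_I (\<psi>'' i)) \<longrightarrow>
      (\<forall>i\<in>{1..N}. \<forall>x\<in>{0..1}. (\<psi> i has_vector_derivative \<psi>' i x) (at x within {0..1})) \<longrightarrow>
      (\<forall>i\<in>{1..N}. \<forall>x\<in>{0..1}. (\<psi>' i has_vector_derivative \<psi>'' i x) (at x within {0..1})) \<longrightarrow>
      preserves_junctions N \<gamma> \<psi> \<longrightarrow> C \<psi> \<longrightarrow> boundary_variation N v T \<kappa> b \<psi> \<psi>' = 0"
proof -
  have "\<forall>i\<in>{1..N}. \<exists>v w. H2_data (\<gamma> i) v w"
    using reg regular_H2_curve_data unfolding regular_H2_network_def by blast
  then obtain v w where data: "\<And>i. i \<in> {1..N} \<Longrightarrow> H2_data (\<gamma> i) (v i) (w i)" by metis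
  have H2: "H2_velocity (v i) (w i)" if "i \<in> {1..N}" for i using data[OF that] by (simp add: H2_data_def)
  have g: "(\<gamma> i has_vector_derivative v i x) (at x within {0..1})" if "i \<in> {1..N}" "x \<in> {0..1}" for i x
    using data[OF that(1)] that(2) by (simp add: H2_data_def)
  have crit: "H2_critical \<delta> (v i) (w i)" if "i \<in> {1..N}" for i
  proof (rule stationary_imp_H2_critical[OF st less_imp_le[OF \<delta>] data _ that])
    fix \<psi> :: "nat \<Rightarrow> real \<Rightarrow> real^2"
    assume z: "\<And>i e. i \<in> {1..N} \<Longrightarrow> e \<in> {0, 1} \<Longrightarrow> (\<psi> i has_vector_derivative 0) (at e within {0..1})"
    show "C \<psi>" by (intro C first_order_vanishing_admissible[of N \<gamma> v] g z)
  qed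
  define T where "T i x = v i x /\<^sub>R norm (v i x)" for i x
  let ?bdry = "\<lambda>i \<kappa> b \<psi> \<psi>'. ((2 * \<kappa> 1 / norm (v i 1)) * (rot90 (T i 1) \<bullet> \<psi>' 1) - b \<bullet> \<psi> 1)
        - ((2 * \<kappa> 0 / norm (v i 0)) * (rot90 (T i 0) \<bullet> \<psi>' 0) - b \<bullet> \<psi> (0::real))"
  define R where "R i \<kappa> b \<longleftrightarrow> elastica \<delta> (\<lambda>x. norm (v i x)) (T i) \<kappa> b \<and>
      (\<forall>\<psi> \<psi>' \<psi>''. continuous_on {0..1} \<psi>'' \<longrightarrow>
      (\<forall>x\<in>{0..1}. (\<psi> has_vector_derivative \<psi>' x) (at x within {0..1})) \<longrightarrow>
      (\<forall>x\<in>{0..1}. (\<psi>' has_vector_derivative \<psi>'' x) (at x within {0..1})) \<longrightarrow>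
      integral {0..1} (\<lambda>x. energy_density_deriv \<delta> (v i x) (w i x) (\<psi>' x) (\<psi>'' x)) = ?bdry i \<kappa> b \<psi> \<psi>')" for i \<kappa> b
  have "\<forall>i\<in>{1..N}. \<exists>\<kappa> b. R i \<kappa> b"
  proof
    fix i assume i: "i \<in> {1..N}"
    have T: "T i = (\<lambda>x. v i x /\<^sub>R norm (v i x))" by (simp add: T_def fun_eq_iff)
    show "\<exists>\<kappa> b. R i \<kappa> b"
      unfolding R_def
    proof (rule H2_critical_imp_elastica[OF H2[OF i] less_imp_le[OF \<delta>] crit[OF i]], goal_cases)
      case (1 \<kappa> b)
      show ?case
      proof (intro exI[of _ \<kappa>] exI[of _ b] conjI allI impI)
        show "elastica \<delta> (\<lambda>x. norm (v i x)) (T i) \<kappa> b" unfolding T by (rule 1(1))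
        fix \<psi> \<psi>' \<psi>'' :: "real \<Rightarrow> real^2"
        assume "continuous_on {0..1} \<psi>''"
          "\<forall>x\<in>{0..1}. (\<psi> has_vector_derivative \<psi>' x) (at x within {0..1})"
          "\<forall>x\<in>{0..1}. (\<psi>' has_vector_derivative \<psi>'' x) (at x within {0..1})"
        from 1(2)[OF this(1) bspec[OF this(2)] bspec[OF this(3)]]
        show "integral {0..1} (\<lambda>x. energy_density_deriv \<delta> (v i x) (w i x) (\<psi>' x) (\<psi>'' x)) = ?bdry i \<kappa> b \<psi> \<psi>'"
          unfolding T_def .
      qed
    qed
  qed
  then obtain \<kappa> b where R: "\<And>i. i \<in> {1..N} \<Longrightarrow> R i (\<kappa> i) (b i)" by metis
  have el: "elastica \<delta> (\<lambda>x. norm (v i x)) (T i) (\<kappa> i) (b i)" if "i \<in> {1..N}" for i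
    using R[OF that] unfolding R_def by (rule conjunct1)
  note bd = R[unfolded R_def, THEN conjunct2, rule_format]
  show thesis
  proof (rule that[of v T \<kappa> b])
    show "\<forall>i\<in>{1..N}. continuous_on {0..1} (v i)" using H2 primitive_continuous unfolding H2_velocity_def by blast
    show "\<forall>i\<in>{1..N}. elastica \<delta> (\<lambda>x. norm (v i x)) (T i) (\<kappa> i) (b i)" using el by blast
    show "\<forall>i\<in>{1..N}. \<forall>x\<in>{0..1}. (\<gamma> i has_vector_derivative norm (v i x) *\<^sub>R T i x) (at x within {0..1})"
    proof (intro ballI)
      fix i and x :: real assume i: "i \<in> {1..N}" and x: "x \<in> {0..1}"
      have "v i x \<noteq> 0" using H2[OF i] x by (simp add: H2_velocity_def)
      then show "(\<gamma> i has_vector_derivative norm (v i x) *\<^sub>R T i x) (at x within {0..1})"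
        using g[OF i x] by (simp add: T_def)
    qed
    show "\<forall>\<psi> \<psi>' \<psi>''. (\<forall>i\<in>{1..N}. smooth_I (\<psi>'' i)) \<longrightarrow>
      (\<forall>i\<in>{1..N}. \<forall>x\<in>{0..1}. (\<psi> i has_vector_derivative \<psi>' i x) (at x within {0..1})) \<longrightarrow>
      (\<forall>i\<in>{1..N}. \<forall>x\<in>{0..1}. (\<psi>' i has_vector_derivative \<psi>'' i x) (at x within {0..1})) \<longrightarrow>
      preserves_junctions N \<gamma> \<psi> \<longrightarrow> C \<psi> \<longrightarrow> boundary_variation N v T \<kappa> b \<psi> \<psi>' = 0"
    proof (intro allI impI)
      fix \<psi> \<psi>' \<psi>'' :: "nat \<Rightarrow> real \<Rightarrow> real^2"
      assume s: "\<forall>i\<in>{1..N}. smooth_I (\<psi>'' i)"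
        and d: "\<forall>i\<in>{1..N}. \<forall>x\<in>{0..1}. (\<psi> i has_vector_derivative \<psi>' i x) (at x within {0..1})"
          "\<forall>i\<in>{1..N}. \<forall>x\<in>{0..1}. (\<psi>' i has_vector_derivative \<psi>'' i x) (at x within {0..1})"
        and adm: "preserves_junctions N \<gamma> \<psi>" "C \<psi>"
      have "boundary_variation N v T \<kappa> b \<psi> \<psi>' =
         (\<Sum>i=1..N. integral {0..1} (\<lambda>x. energy_density_deriv \<delta> (v i x) (w i x) (\<psi>' i x) (\<psi>'' i x)))"
        unfolding boundary_variation_def
      proof (rule sum.cong[OF refl])
        fix i assume i: "i \<in> {1..N}"
        show "?bdry i (\<kappa> i) (b i) (\<psi> i) (\<psi>' i) = integral {0..1} (\<lambda>x. energy_density_deriv \<delta> (v i x) (w i x) (\<psi>' i x) (\<psi>'' i x))"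
          by (rule bd[OF i smooth_I_continuous[OF bspec[OF s i]] bspec[OF bspec[OF d(1) i]] bspec[OF bspec[OF d(2) i]], symmetric])
      qed
      also have "\<dots> = 0"
        by (rule stationary_first_variation[OF st less_imp_le[OF \<delta>] data]) (use s d adm in auto)
      finally show "boundary_variation N v T \<kappa> b \<psi> \<psi>' = 0" .
    qed
  qed
qed

lemma sum_over_ends:
  fixes B :: "nat \<times> real \<Rightarrow> 'a::comm_monoid_add"
  shows "(\<Sum>i=1..N. B (i, 0) + B (i, 1)) = (\<Sum>c\<in>{1..N} \<times> {0, 1}. B c)"
proof -
  have "(\<Sum>i=1..N. B (i, 0) + B (i, 1)) = (\<Sum>i\<in>{1..N}. \<Sum>e\<in>{0, 1}. B (i, e))" by simp
  also have "\<dots> = (\<Sum>c\<in>{1..N} \<times> {0, 1}. B c)" unfolding sum.cartesian_product by (simp add: split_def)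
  finally show ?thesis .
qed

lemma ends_at_eq: "ends_at N \<gamma> p = {c \<in> {1..N} \<times> {0, 1}. \<gamma> (fst c) (snd c) = p}"
  by (auto simp: ends_at_def)

section \<open>The equations on the curves and at the junctions\<close>

lemma elastic_network_curve:
  assumes el: "elastica \<delta> (\<lambda>x. norm (v x)) T \<kappa> b" and c: "continuous_on {0..1} v"
    and \<gamma>: "\<And>x. x \<in> {0..1} \<Longrightarrow> (\<gamma> has_vector_derivative norm (v x) *\<^sub>R T x) (at x within {0..1})"
  shows "smooth_curve \<gamma>" "\<And>\<sigma> x. smooth_parametrization \<gamma> \<sigma> \<Longrightarrow> x \<in> {0..1} \<Longrightarrow>
       2 *\<^sub>R ds_perp \<sigma> (ds_perp \<sigma> (curvature_vec \<sigma>)) x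
                 + (norm (curvature_vec \<sigma> x))\<^sup>2 *\<^sub>R curvature_vec \<sigma> x
                 - \<delta> *\<^sub>R curvature_vec \<sigma> x = 0 \<and>
               2 * ds \<sigma> (ds \<sigma> (curvature \<sigma>)) x + curvature \<sigma> x ^ 3 - \<delta> * curvature \<sigma> x = 0"
proof -
  show "smooth_curve \<gamma>" by (rule elastica_smooth_curve[OF el continuous_on_norm[OF c] \<gamma>])
  fix \<sigma> and x :: real assume \<sigma>: "smooth_parametrization \<gamma> \<sigma>" and x: "x \<in> {0..1}"
  have "reparametrization \<gamma> \<sigma>" using \<sigma> by (simp add: smooth_parametrization_def)
  from elastica_reparametrization[OF el \<gamma> this]
  obtain r' T' \<kappa>' where el': "elastica \<delta> r' T' \<kappa>' b"
    and \<sigma>': "\<And>x. x \<in> {0..1} \<Longrightarrow> (\<sigma> has_vector_derivative r' x *\<^sub>R T' x) (at x within {0..1})"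
    by metis
  show "2 *\<^sub>R ds_perp \<sigma> (ds_perp \<sigma> (curvature_vec \<sigma>)) x
                 + (norm (curvature_vec \<sigma> x))\<^sup>2 *\<^sub>R curvature_vec \<sigma> x
                 - \<delta> *\<^sub>R curvature_vec \<sigma> x = 0 \<and>
               2 * ds \<sigma> (ds \<sigma> (curvature \<sigma>)) x + curvature \<sigma> x ^ 3 - \<delta> * curvature \<sigma> x = 0"
    using elastica_equations[OF el' \<sigma>' x] by simp
qed

text \<open>
  The second junction condition is a balance of forces: its summand is the force \<open>b\<close> up to the multiple
  \<open>\<delta> T\<close> of the tangent.
\<close>

lemma elastica_junction_term:
  assumes el: "elastica \<delta> r T \<kappa> b"
    and \<sigma>: "\<And>x. x \<in> {0..1} \<Longrightarrow> (\<sigma> has_vector_derivative r x *\<^sub>R T x) (at x within {0..1})"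
  shows "(2 * ds \<sigma> (curvature \<sigma>) 0) *\<^sub>R normal \<sigma> 0 + (curvature \<sigma> 0)\<^sup>2 *\<^sub>R tangent \<sigma> 0 = b + \<delta> *\<^sub>R T 0"
proof -
  have I: "(0::real) \<in> {0..1}" by simp
  have "norm (T 0) = 1" using el by (simp add: elastica_def)
  from frame_expansion[OF this, of b]
  have "b + \<delta> *\<^sub>R T 0 = (b \<bullet> rot90 (T 0)) *\<^sub>R rot90 (T 0) + (b \<bullet> T 0 + \<delta>) *\<^sub>R T 0"
    by (simp add: algebra_simps)
  moreover have "ds \<sigma> (curvature \<sigma>) 0 = b \<bullet> rot90 (T 0) / 2" by (rule elastica_ds_curvature[OF el \<sigma> I])
  moreover have "normal \<sigma> 0 = rot90 (T 0)" by (rule elastica_normal[OF el \<sigma> I])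
  moreover have "tangent \<sigma> 0 = T 0" by (rule elastica_tangent[OF el \<sigma> I])
  moreover have "curvature \<sigma> 0 = \<kappa> 0" by (rule elastica_curvature[OF el \<sigma> I])
  moreover have "b \<bullet> T 0 = (\<kappa> 0)\<^sup>2 - \<delta>" by (rule elastica_unit(4)[OF el \<sigma> I])
  ultimately show ?thesis by simp
qed

text \<open>
  Two families of cubic tests. A translation of the junction \<open>p\<close> by \<open>u\<close> with vanishing derivatives
  shows that the outgoing forces sum to 0; since the outgoing tangents sum to 0 as well, this is the
  second condition. A rotation of the three tangents with unit speed is admissible because the
  outgoing normals sum to 0, and it shows that the outgoing curvatures sum to 0.
\<close>

lemma equal_angle_junction_conditions:
  assumes reg: "regular_H2_network N \<gamma>" and \<delta>: "\<delta> > 0"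
    and ang: "equal_angle_triple_junctions N \<gamma>"
    and st: "stationary_point \<delta> N \<gamma> (preserves_equal_angles N \<gamma>)"
    and p: "p \<in> junctions N \<gamma>"
    and \<sigma>: "\<And>c. c \<in> ends_at N \<gamma> p \<Longrightarrow> reparametrization (from_end \<gamma> c) (\<sigma> c)"
  shows "(\<Sum>c\<in>ends_at N \<gamma> p. curvature (\<sigma> c) 0) = 0"
    and "(\<Sum>c\<in>ends_at N \<gamma> p.
            (2 * ds (\<sigma> c) (curvature (\<sigma> c)) 0) *\<^sub>R normal (\<sigma> c) 0
              + (curvature (\<sigma> c) 0)\<^sup>2 *\<^sub>R tangent (\<sigma> c) 0) = 0"
proof -
  obtain v T \<kappa> b where
    g: "\<forall>i\<in>{1..N}. \<forall>x\<in>{0..1}. (\<gamma> i has_vector_derivative norm (v i x) *\<^sub>R T i x) (at x within {0..1})"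
    and "\<forall>i\<in>{1..N}. continuous_on {0..1} (v i)"
    and el: "\<forall>i\<in>{1..N}. elastica \<delta> (\<lambda>x. norm (v i x)) (T i) (\<kappa> i) (b i)"
    and var: "\<forall>\<psi> \<psi>' \<psi>''. (\<forall>i\<in>{1..N}. smooth_I (\<psi>'' i)) \<longrightarrow>
      (\<forall>i\<in>{1..N}. \<forall>x\<in>{0..1}. (\<psi> i has_vector_derivative \<psi>' i x) (at x within {0..1})) \<longrightarrow>
      (\<forall>i\<in>{1..N}. \<forall>x\<in>{0..1}. (\<psi>' i has_vector_derivative \<psi>'' i x) (at x within {0..1})) \<longrightarrow>
      preserves_junctions N \<gamma> \<psi> \<longrightarrow> preserves_equal_angles N \<gamma> \<psi> \<longrightarrow> boundary_variation N v T \<kappa> b \<psi> \<psi>' = 0"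
    by (rule elastic_network[OF reg \<delta> st]) (assumption, rule that)
  define To ko bo where "To c = outward c (T (fst c) (snd c))" and "ko c = outward c (\<kappa> (fst c) (snd c))"
    and "bo c = outward c (b (fst c))" for c :: "nat \<times> real"
  define E where "E = {1..N} \<times> {0, 1::real}"
  have finE: "finite E" by (simp add: E_def)
  have endsE: "ends_at N \<gamma> q = {c \<in> E. \<gamma> (fst c) (snd c) = q}" for q by (simp add: E_def ends_at_eq)
  have cE: "fst c \<in> {1..N}" "snd c \<in> {0, 1}" "snd c \<in> {0..1}" if "c \<in> E" for c using that by (auto simp: E_def)
  have endE: "c \<in> E" if "c \<in> ends_at N \<gamma> q" for c q using that by (simp add: endsE)
  have gE: "(\<gamma> (fst c) has_vector_derivative norm (v (fst c) (snd c)) *\<^sub>R T (fst c) (snd c)) (at (snd c) within {0..1})"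
    if "c \<in> E" for c using g cE[OF that] by blast
  have pos: "norm (v (fst c) (snd c)) > 0" and T1: "norm (T (fst c) (snd c)) = 1" if "c \<in> E" for c
    using bspec[OF bspec[OF el cE(1)[OF that], unfolded elastica_def] cE(3)[OF that]] by blast+
  have tan: "tangent (from_end \<gamma> c) 0 = To c" if "c \<in> E" for c
    using tangent_from_end[of \<gamma> c, OF gE[OF that] cE(2)[OF that]] pos[OF that] T1[OF that] by (simp add: To_def)
  have sumT: "(\<Sum>c\<in>ends_at N \<gamma> q. To c) = 0" if "q \<in> junctions N \<gamma>" for q
  proof -
    have "(\<Sum>c\<in>ends_at N \<gamma> q. To c) = (\<Sum>c\<in>ends_at N \<gamma> q. tangent (from_end \<gamma> c) 0)"
      by (rule sum.cong) (simp_all add: tan endE)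
    then show ?thesis using ang that by (simp add: equal_angle_triple_junctions_def)
  qed
  \<comment> \<open>A test is given by its values \<open>A\<close> at junction points and its derivatives \<open>D\<close> at curve ends.\<close>
  have test: "(\<Sum>c\<in>E. (2 * \<kappa> (fst c) (snd c) / norm (v (fst c) (snd c))) * (rot90 (To c) \<bullet> D c) - bo c \<bullet> A (\<gamma> (fst c) (snd c))) = 0"
    if perp: "\<And>q. q \<in> junctions N \<gamma> \<Longrightarrow> (\<Sum>c\<in>ends_at N \<gamma> q. outward c (D c /\<^sub>R norm (v (fst c) (snd c)))
        - (outward c (D c /\<^sub>R norm (v (fst c) (snd c))) \<bullet> To c) *\<^sub>R To c) = 0"
    for A :: "real^2 \<Rightarrow> real^2" and D :: "nat \<times> real \<Rightarrow> real^2"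
  proof -
    have "\<exists>\<psi> \<psi>' \<psi>''. smooth_I \<psi>'' \<and> (\<forall>x. (\<psi> has_vector_derivative \<psi>' x) (at x within {0..1})) \<and>
      (\<forall>x. (\<psi>' has_vector_derivative \<psi>'' x) (at x within {0..1})) \<and>
      (\<forall>e\<in>{0, 1}. \<psi> e = A (\<gamma> i e)) \<and> (\<forall>e\<in>{0, 1}. \<psi>' e = D (i, e))" for i
      by (rule hermite_interpolation[of "\<lambda>e. A (\<gamma> i e)" "\<lambda>e. D (i, e)"]) blast
    then obtain \<psi> \<psi>' \<psi>'' where h: "\<And>i. smooth_I (\<psi>'' i)"
      "\<And>i x. (\<psi> i has_vector_derivative \<psi>' i x) (at x within {0..1})"
      "\<And>i x. (\<psi>' i has_vector_derivative \<psi>'' i x) (at x within {0..1})"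
      "\<And>i e. e \<in> {0, 1} \<Longrightarrow> \<psi> i e = A (\<gamma> i e)" "\<And>i e. e \<in> {0, 1} \<Longrightarrow> \<psi>' i e = D (i, e)"
      by metis
    have j: "preserves_junctions N \<gamma> \<psi>" by (rule preserves_junctionsI[of _ _ A]) (rule h(4))
    have a: "preserves_equal_angles N \<gamma> \<psi>"
      unfolding preserves_equal_angles_def
    proof
      fix q assume q: "q \<in> junctions N \<gamma>"
      have "ds_perp (from_end \<gamma> c) (from_end \<psi> c) 0 = outward c (D c /\<^sub>R norm (v (fst c) (snd c)))
        - (outward c (D c /\<^sub>R norm (v (fst c) (snd c))) \<bullet> To c) *\<^sub>R To c" if c: "c \<in> ends_at N \<gamma> q" for c
      proof -
        have cE': "c \<in> E" by (rule endE[OF c])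
        have "\<psi>' (fst c) (snd c) = D c" using h(5)[OF cE(2)[OF cE']] by simp
        then have "ds (from_end \<gamma> c) (from_end \<psi> c) 0 = outward c (D c /\<^sub>R norm (v (fst c) (snd c)))"
          using ds_from_end[of \<gamma> c _ \<psi>, OF gE[OF cE'] h(2) cE(2)[OF cE']] T1[OF cE'] by simp
        then show ?thesis unfolding ds_perp_def tan[OF cE'] by simp
      qed
      then show "(\<Sum>c\<in>ends_at N \<gamma> q. ds_perp (from_end \<gamma> c) (from_end \<psi> c) 0) = 0"
        using perp[OF q] by simp
    qed
    let ?B = "\<lambda>c. (2 * \<kappa> (fst c) (snd c) / norm (v (fst c) (snd c))) * (rot90 (To c) \<bullet> D c) - bo c \<bullet> A (\<gamma> (fst c) (snd c))"
    have var0: "boundary_variation N v T \<kappa> b \<psi> \<psi>' = 0" using var h(1-3) j a by blast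
    have "(\<Sum>i=1..N. ?B (i, 0) + ?B (i, 1)) = (\<Sum>i=1..N. - (((2 * \<kappa> i 1 / norm (v i 1)) * (rot90 (T i 1) \<bullet> \<psi>' i 1) - b i \<bullet> \<psi> i 1)
        - ((2 * \<kappa> i 0 / norm (v i 0)) * (rot90 (T i 0) \<bullet> \<psi>' i 0) - b i \<bullet> \<psi> i 0)))"
      by (rule sum.cong) (simp_all add: To_def bo_def outward_def h(4,5) rot90_linear)
    also have "\<dots> = 0"
      unfolding sum_negf neg_equal_0_iff_equal by (rule var0[unfolded boundary_variation_def])
    finally show ?thesis unfolding sum_over_ends[of ?B] E_def .
  qed
  have at_p: "(\<Sum>c\<in>E. if \<gamma> (fst c) (snd c) = p then f c else 0) = (\<Sum>c\<in>ends_at N \<gamma> p. f c)" for f :: "nat \<times> real \<Rightarrow> real"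
    unfolding endsE by (rule sum.inter_filter[OF finE, symmetric])
  \<comment> \<open>Moving the junction in direction \<open>u\<close>.\<close>
  have "(\<Sum>c\<in>ends_at N \<gamma> p. bo c) \<bullet> u = 0" for u
  proof -
    have "(\<Sum>c\<in>E. (2 * \<kappa> (fst c) (snd c) / norm (v (fst c) (snd c))) * (rot90 (To c) \<bullet> 0)
         - bo c \<bullet> (if \<gamma> (fst c) (snd c) = p then u else 0)) = 0"
      by (rule test[of "\<lambda>c. 0" "\<lambda>q. if q = p then u else 0"]) simp
    moreover have "(\<Sum>c\<in>E. (2 * \<kappa> (fst c) (snd c) / norm (v (fst c) (snd c))) * (rot90 (To c) \<bullet> 0)
         - bo c \<bullet> (if \<gamma> (fst c) (snd c) = p then u else 0)) = - (\<Sum>c\<in>E. if \<gamma> (fst c) (snd c) = p then bo c \<bullet> u else 0)"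
      unfolding sum_negf[symmetric] by (rule sum.cong) auto
    ultimately show ?thesis unfolding at_p by (simp add: inner_sum_left)
  qed
  then have sumb: "(\<Sum>c\<in>ends_at N \<gamma> p. bo c) = 0" by (metis inner_eq_zero_iff)
  have sumk: "(\<Sum>c\<in>ends_at N \<gamma> p. ko c) = 0"
  proof -
    \<comment> \<open>The derivative that rotates the tangent at each end in \<open>p\<close> with unit speed.\<close>
    define D where "D c = (if \<gamma> (fst c) (snd c) = p then norm (v (fst c) (snd c)) *\<^sub>R rot90 (T (fst c) (snd c)) else 0)" for c :: "nat \<times> real"
    have "(\<Sum>c\<in>E. (2 * \<kappa> (fst c) (snd c) / norm (v (fst c) (snd c))) * (rot90 (To c) \<bullet> D c) - bo c \<bullet> 0) = 0"
    proof (rule test[of D "\<lambda>q. 0"])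
      fix q assume q: "q \<in> junctions N \<gamma>"
      have "outward c (D c /\<^sub>R norm (v (fst c) (snd c))) - (outward c (D c /\<^sub>R norm (v (fst c) (snd c))) \<bullet> To c) *\<^sub>R To c
         = (if q = p then rot90 (To c) else 0)" if c: "c \<in> ends_at N \<gamma> q" for c
        using pos[OF endE[OF c]] c by (auto simp: D_def To_def endsE rot90_outward)
      then have "(\<Sum>c\<in>ends_at N \<gamma> q. outward c (D c /\<^sub>R norm (v (fst c) (snd c))) - (outward c (D c /\<^sub>R norm (v (fst c) (snd c))) \<bullet> To c) *\<^sub>R To c)
         = (\<Sum>c\<in>ends_at N \<gamma> q. if q = p then rot90 (To c) else 0)" by (rule sum.cong[OF refl])
      also have "\<dots> = (if q = p then rot90 (\<Sum>c\<in>ends_at N \<gamma> q. To c) else 0)"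
        by (simp add: linear_sum[OF bounded_linear.linear[OF bounded_linear_rot90]])
      also have "\<dots> = 0" by (simp add: sumT[OF p] rot90_linear)
      finally show "(\<Sum>c\<in>ends_at N \<gamma> q. outward c (D c /\<^sub>R norm (v (fst c) (snd c))) - (outward c (D c /\<^sub>R norm (v (fst c) (snd c))) \<bullet> To c) *\<^sub>R To c) = 0" .
    qed
    also have "(\<Sum>c\<in>E. (2 * \<kappa> (fst c) (snd c) / norm (v (fst c) (snd c))) * (rot90 (To c) \<bullet> D c) - bo c \<bullet> 0)
        = (\<Sum>c\<in>E. if \<gamma> (fst c) (snd c) = p then 2 * ko c else 0)"
    proof (rule sum.cong[OF refl])
      fix c assume c: "c \<in> E"
      have "rot90 (T (fst c) (snd c)) \<bullet> rot90 (T (fst c) (snd c)) = 1" using T1[OF c] by (simp add: dot_square_norm)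
      then show "(2 * \<kappa> (fst c) (snd c) / norm (v (fst c) (snd c))) * (rot90 (To c) \<bullet> D c) - bo c \<bullet> 0
        = (if \<gamma> (fst c) (snd c) = p then 2 * ko c else 0)"
        using pos[OF c] by (cases "snd c = 0") (simp_all add: D_def To_def ko_def outward_def rot90_linear)
    qed
    finally show ?thesis unfolding at_p by (simp flip: sum_distrib_left)
  qed
  have at_end: "curvature (\<sigma> c) 0 = ko c"
    "(2 * ds (\<sigma> c) (curvature (\<sigma> c)) 0) *\<^sub>R normal (\<sigma> c) 0 + (curvature (\<sigma> c) 0)\<^sup>2 *\<^sub>R tangent (\<sigma> c) 0 = bo c + \<delta> *\<^sub>R To c"
    if c: "c \<in> ends_at N \<gamma> p" for c
  proof -
    have cE': "c \<in> E" by (rule endE[OF c])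
    from elastica_from_end[of \<delta> _ _ _ _ \<gamma> c, OF bspec[OF el cE(1)[OF cE']] bspec[OF bspec[OF g cE(1)[OF cE']]] cE(2)[OF cE']]
    obtain r1 T1 \<kappa>1 where 1: "elastica \<delta> r1 T1 \<kappa>1 (bo c)"
      "\<And>x. x \<in> {0..1} \<Longrightarrow> (from_end \<gamma> c has_vector_derivative r1 x *\<^sub>R T1 x) (at x within {0..1})"
      "T1 0 = To c" "\<kappa>1 0 = ko c" unfolding bo_def To_def ko_def by metis
    from elastica_reparametrization[OF 1(1,2) \<sigma>[OF c]]
    obtain r2 T2 \<kappa>2 where 2: "elastica \<delta> r2 T2 \<kappa>2 (bo c)"
      "\<And>x. x \<in> {0..1} \<Longrightarrow> (\<sigma> c has_vector_derivative r2 x *\<^sub>R T2 x) (at x within {0..1})"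
      "T2 0 = T1 0" "\<kappa>2 0 = \<kappa>1 0" by metis
    show "curvature (\<sigma> c) 0 = ko c" using elastica_curvature[OF 2(1,2), of 0] 1(4) 2(4) by simp
    show "(2 * ds (\<sigma> c) (curvature (\<sigma> c)) 0) *\<^sub>R normal (\<sigma> c) 0 + (curvature (\<sigma> c) 0)\<^sup>2 *\<^sub>R tangent (\<sigma> c) 0 = bo c + \<delta> *\<^sub>R To c"
      using elastica_junction_term[OF 2(1,2)] 1(3) 2(3) by simp
  qed
  show "(\<Sum>c\<in>ends_at N \<gamma> p. curvature (\<sigma> c) 0) = 0"
    using sumk at_end(1) by simp
  show "(\<Sum>c\<in>ends_at N \<gamma> p. (2 * ds (\<sigma> c) (curvature (\<sigma> c)) 0) *\<^sub>R normal (\<sigma> c) 0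
              + (curvature (\<sigma> c) 0)\<^sup>2 *\<^sub>R tangent (\<sigma> c) 0) = 0"
    using sumb sumT[OF p] at_end(2) by (simp add: sum.distrib flip: scaleR_sum_right)
qed

theorem proposition4p1:
  fixes \<delta> :: real and N :: nat and \<gamma> :: "nat \<Rightarrow> real \<Rightarrow> real^2"
  assumes "\<delta> > 0" and "regular_H2_network N \<gamma>"
  shows
    "(stationary_point \<delta> N \<gamma> (\<lambda>\<psi>. True) \<or>
      stationary_point \<delta> N \<gamma> (preserves_angles N \<gamma>) \<or>
      equal_angle_triple_junctions N \<gamma> \<and> stationary_point \<delta> N \<gamma> (preserves_equal_angles N \<gamma>)
      \<longrightarrow>
      (\<forall>i\<in>{1..N}.
         smooth_curve (\<gamma> i) \<and>
         (\<forall>\<sigma>. smooth_parametrization (\<gamma> i) \<sigma> \<longrightarrow>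
            (\<forall>x\<in>{0<..<1}.
               2 *\<^sub>R ds_perp \<sigma> (ds_perp \<sigma> (curvature_vec \<sigma>)) x
                 + (norm (curvature_vec \<sigma> x))\<^sup>2 *\<^sub>R curvature_vec \<sigma> x
                 - \<delta> *\<^sub>R curvature_vec \<sigma> x = 0 \<and>
               2 * ds \<sigma> (ds \<sigma> (curvature \<sigma>)) x + curvature \<sigma> x ^ 3 - \<delta> * curvature \<sigma> x = 0))))
     \<and>
     (equal_angle_triple_junctions N \<gamma> \<and> stationary_point \<delta> N \<gamma> (preserves_equal_angles N \<gamma>)
      \<longrightarrow>
      (\<forall>p\<in>junctions N \<gamma>. \<forall>\<sigma>.
         (\<forall>c\<in>ends_at N \<gamma> p. smooth_parametrization (from_end \<gamma> c) (\<sigma> c)) \<longrightarrow>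
         (\<Sum>c\<in>ends_at N \<gamma> p. curvature (\<sigma> c) 0) = 0 \<and>
         (\<Sum>c\<in>ends_at N \<gamma> p.
            (2 * ds (\<sigma> c) (curvature (\<sigma> c)) 0) *\<^sub>R normal (\<sigma> c) 0
              + (curvature (\<sigma> c) 0)\<^sup>2 *\<^sub>R tangent (\<sigma> c) 0) = 0))"
proof (intro conjI impI)
  assume "stationary_point \<delta> N \<gamma> (\<lambda>\<psi>. True) \<or>
      stationary_point \<delta> N \<gamma> (preserves_angles N \<gamma>) \<or>
      equal_angle_triple_junctions N \<gamma> \<and> stationary_point \<delta> N \<gamma> (preserves_equal_angles N \<gamma>)"
  \<comment> \<open>Each of the three constraints admits the variations that vanish to first order at the ends.\<close>
  then obtain C where st: "stationary_point \<delta> N \<gamma> C"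
    and C: "\<And>\<psi>. preserves_angles N \<gamma> \<psi> \<Longrightarrow> preserves_equal_angles N \<gamma> \<psi> \<Longrightarrow> C \<psi>"
    by metis
  obtain v T \<kappa> b where
    g: "\<forall>i\<in>{1..N}. \<forall>x\<in>{0..1}. (\<gamma> i has_vector_derivative norm (v i x :: real^2) *\<^sub>R T i x) (at x within {0..1})"
    and c: "\<forall>i\<in>{1..N}. continuous_on {0..1} (v i)"
    and el: "\<forall>i\<in>{1..N}. elastica \<delta> (\<lambda>x. norm (v i x)) (T i) (\<kappa> i) (b i)"
    by (rule elastic_network[OF assms(2,1) st C]) (assumption, assumption, rule that)
  show "\<forall>i\<in>{1..N}. smooth_curve (\<gamma> i) \<and>
         (\<forall>\<sigma>. smooth_parametrization (\<gamma> i) \<sigma> \<longrightarrow>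
            (\<forall>x\<in>{0<..<1}.
               2 *\<^sub>R ds_perp \<sigma> (ds_perp \<sigma> (curvature_vec \<sigma>)) x
                 + (norm (curvature_vec \<sigma> x))\<^sup>2 *\<^sub>R curvature_vec \<sigma> x
                 - \<delta> *\<^sub>R curvature_vec \<sigma> x = 0 \<and>
               2 * ds \<sigma> (ds \<sigma> (curvature \<sigma>)) x + curvature \<sigma> x ^ 3 - \<delta> * curvature \<sigma> x = 0))"
  proof (intro ballI)
    fix i assume i: "i \<in> {1..N}"
    note frame = bspec[OF el i] bspec[OF c i] bspec[OF bspec[OF g i]]
    have "smooth_curve (\<gamma> i)" by (rule elastic_network_curve(1)[OF frame])
    moreover have "2 *\<^sub>R ds_perp \<sigma> (ds_perp \<sigma> (curvature_vec \<sigma>)) x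
                 + (norm (curvature_vec \<sigma> x))\<^sup>2 *\<^sub>R curvature_vec \<sigma> x
                 - \<delta> *\<^sub>R curvature_vec \<sigma> x = 0 \<and>
               2 * ds \<sigma> (ds \<sigma> (curvature \<sigma>)) x + curvature \<sigma> x ^ 3 - \<delta> * curvature \<sigma> x = 0"
      if "smooth_parametrization (\<gamma> i) \<sigma>" "x \<in> {0<..<1}" for \<sigma> x
    proof (rule elastic_network_curve(2)[OF frame that(1)])
      show "x \<in> {0..1}" using that(2) by auto
    qed
    ultimately show "smooth_curve (\<gamma> i) \<and>
         (\<forall>\<sigma>. smooth_parametrization (\<gamma> i) \<sigma> \<longrightarrow>
            (\<forall>x\<in>{0<..<1}.
               2 *\<^sub>R ds_perp \<sigma> (ds_perp \<sigma> (curvature_vec \<sigma>)) x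
                 + (norm (curvature_vec \<sigma> x))\<^sup>2 *\<^sub>R curvature_vec \<sigma> x
                 - \<delta> *\<^sub>R curvature_vec \<sigma> x = 0 \<and>
               2 * ds \<sigma> (ds \<sigma> (curvature \<sigma>)) x + curvature \<sigma> x ^ 3 - \<delta> * curvature \<sigma> x = 0))"
      by blast
  qed
next
  assume "equal_angle_triple_junctions N \<gamma> \<and> stationary_point \<delta> N \<gamma> (preserves_equal_angles N \<gamma>)"
  then have ang: "equal_angle_triple_junctions N \<gamma>" and st: "stationary_point \<delta> N \<gamma> (preserves_equal_angles N \<gamma>)"
    by simp_all
  show "\<forall>p\<in>junctions N \<gamma>. \<forall>\<sigma>.
         (\<forall>c\<in>ends_at N \<gamma> p. smooth_parametrization (from_end \<gamma> c) (\<sigma> c)) \<longrightarrow>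
         (\<Sum>c\<in>ends_at N \<gamma> p. curvature (\<sigma> c) 0) = 0 \<and>
         (\<Sum>c\<in>ends_at N \<gamma> p.
            (2 * ds (\<sigma> c) (curvature (\<sigma> c)) 0) *\<^sub>R normal (\<sigma> c) 0
              + (curvature (\<sigma> c) 0)\<^sup>2 *\<^sub>R tangent (\<sigma> c) 0) = 0"
  proof (intro ballI allI impI)
    fix p and \<sigma> :: "nat \<times> real \<Rightarrow> real \<Rightarrow> real^2"
    assume p: "p \<in> junctions N \<gamma>"
      and \<sigma>: "\<forall>c\<in>ends_at N \<gamma> p. smooth_parametrization (from_end \<gamma> c) (\<sigma> c)"
    have "reparametrization (from_end \<gamma> c) (\<sigma> c)" if "c \<in> ends_at N \<gamma> p" for c
      using \<sigma> that by (simp add: smooth_parametrization_def)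
    from equal_angle_junction_conditions[OF assms(2,1) ang st p this]
    show "(\<Sum>c\<in>ends_at N \<gamma> p. curvature (\<sigma> c) 0) = 0 \<and>
         (\<Sum>c\<in>ends_at N \<gamma> p.
            (2 * ds (\<sigma> c) (curvature (\<sigma> c)) 0) *\<^sub>R normal (\<sigma> c) 0
              + (curvature (\<sigma> c) 0)\<^sup>2 *\<^sub>R tangent (\<sigma> c) 0) = 0" by blast
  qed
qed

end
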